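(* A semigroup variety $\mathbf V$ is a cancellable element of the lattice $\mathbb{SEM}$ of all semigroup varieties if and only if either $\mathbf V=\mathbf{SEM}$ or $\mathbf V=\mathbf M\vee\mathbf N$ where $\mathbf M$ is one of the varieties $\mathbf T$ or $\mathbf{SL}$, while $\mathbf N$ is one of the varieties $\mathbf T$, $\mathbf X_{m,n}$ or $\mathbf Y_{m,n}$ with $2\le m\le n\le\infty$.
   Context: An element $x$ of a lattice $L$ is cancellable if for all $y,z\in L$: $x\vee y=x\vee z$ and $x\wedge y=x\wedge z$ imply $y=z$. $\mathbb{SEM}$ is the lattice of all semigroup varieties: $\mathbf X\vee\mathbf Y$ is the variety generated by $\mathbf X\cup\mathbf Y$, and $\mathbf X\wedge\mathbf Y=\mathbf X\cap\mathbf Y$. $\mathbf T$, $\mathbf{SL}$ and $\mathbf{SEM}$ denote the trivial semigroup variety, the variety of all semilattices and the variety of all semigroups, respectively. $\operatorname{var}\Sigma$ denotes the semigroup variety given by the identity system $\Sigma$. For a word $\mathbf w$, the identity $\mathbf w\approx 0$ is a short form of the system $\mathbf wx\approx x\mathbf w\approx\mathbf w$ where the letter $x$ does not occur in $\mathbf w$; a semigroup satisfies it iff it has a zero element $0$ and all values of $\mathbf w$ in it equal $0$. $S_m$ is the symmetric group on $\{1,\dots,m\}$ (permutations written on the right), and for $\pi\in S_m$, $p_m[\pi]$ denotes the identity $x_1x_2\cdots x_m\approx x_{1\pi}x_{2\pi}\cdots x_{m\pi}$. Put $$\mathbf X_{\infty,\infty}=\operatorname{var}\{x^2y\approx xyx\approx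 yx^2\approx 0\},$$ $$\mathbf X_{m,\infty}=\mathbf X_{\infty,\infty}\wedge\operatorname{var}\{p_m[\pi]\mid\pi\in S_m\}\quad(2\le m<\infty),$$ $$\mathbf X_{m,n}=\mathbf X_{m,\infty}\wedge\operatorname{var}\{x_1x_2\cdots x_n\approx 0\}\quad(2\le m\le n<\infty),$$ $$\mathbf Y_{m,n}=\mathbf X_{m,n}\wedge\operatorname{var}\{x^2\approx 0\}\quad(2\le m\le n\le\infty).$$ *)

theory Defs
  imports "HOL-Algebra.Lattice" "HOL-Library.Extended_Nat" "HOL-Combinatorics.Permutations"
begin

section \<open>Cancellable elements of a lattice\<close>

definition cancellable :: "('l, 'm) gorder_scheme \<Rightarrow> 'l \<Rightarrow> bool" where
  "cancellable L x \<longleftrightarrow>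
     x \<in> carrier L \<and>
     (\<forall>y \<in> carrier L. \<forall>z \<in> carrier L.
        x \<squnion>\<^bsub>L\<^esub> y = x \<squnion>\<^bsub>L\<^esub> z \<and> x \<sqinter>\<^bsub>L\<^esub> y = x \<sqinter>\<^bsub>L\<^esub> z \<longrightarrow> y = z)"

section \<open>Semigroups and identities\<close>

record 'a magma = "'a partial_object" +
  mul :: "'a \<Rightarrow> 'a \<Rightarrow> 'a" (infixl \<open>\<cdot>\<index>\<close> 70)

definition is_semigroup :: "'a magma \<Rightarrow> bool" where
  "is_semigroup S \<longleftrightarrow>
     carrier S \<noteq> {} \<and>
     (\<forall>a \<in> carrier S. \<forall>b \<in> carrier S. a \<cdot>\<^bsub>S\<^esub> b \<in> carrier S) \<and>
     (\<forall>a \<in> carrier S. \<forall>b \<in> carrier S. \<forall>c \<in> carrier S.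
        (a \<cdot>\<^bsub>S\<^esub> b) \<cdot>\<^bsub>S\<^esub> c = a \<cdot>\<^bsub>S\<^esub> (b \<cdot>\<^bsub>S\<^esub> c))"

text \<open>Letters are natural numbers; a word is a nonempty list of letters.  The empty list is not
  a word: its value is unspecified, and \<open>variety\<close> below admits only identities between nonempty
  lists.\<close>

type_synonym word = "nat list"
type_synonym identity = "word \<times> word"

fun eval_word :: "'a magma \<Rightarrow> (nat \<Rightarrow> 'a) \<Rightarrow> word \<Rightarrow> 'a" where
  "eval_word S \<phi> [] = undefined"
| "eval_word S \<phi> [x] = \<phi> x"
| "eval_word S \<phi> (x # y # w) = \<phi> x \<cdot>\<^bsub>S\<^esub> eval_word S \<phi> (y # w)"

definition satisfies :: "'a magma \<Rightarrow> identity \<Rightarrow> bool" where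
  "satisfies S e \<longleftrightarrow>
     (\<forall>\<phi>. (\<forall>i. \<phi> i \<in> carrier S) \<longrightarrow> eval_word S \<phi> (fst e) = eval_word S \<phi> (snd e))"

definition var :: "identity set \<Rightarrow> 'a magma set" where
  "var \<Sigma> = {S. is_semigroup S \<and> (\<forall>e \<in> \<Sigma>. satisfies S e)}"

section \<open>The lattice of semigroup varieties\<close>

text \<open>HOL has no class of all semigroups, so a variety is represented by those of its members
  whose carrier is a set of elements of the type \<open>'a\<close>.  If \<open>'a\<close> is infinite, this loses
  nothing: a variety is generated by its free semigroup of countable rank, which has an isomorphic
  copy with carrier in \<open>'a\<close>, so distinct varieties stay distinct, and inclusions,
  intersections and joins are those of the varieties themselves.\<close>

definition variety :: "'a magma set \<Rightarrow> bool" where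
  "variety V \<longleftrightarrow> (\<exists>\<Sigma>. (\<forall>(u, v) \<in> \<Sigma>. u \<noteq> [] \<and> v \<noteq> []) \<and> V = var \<Sigma>)"

definition SEM :: "'a magma set gorder" where
  "SEM = \<lparr>carrier = {V. variety V}, eq = (=), le = (\<subseteq>)\<rparr>"

definition generated_variety :: "'a magma set \<Rightarrow> 'a magma set" where
  "generated_variety K = \<Inter>{V. variety V \<and> K \<subseteq> V}"

lemma carrier_SEM [simp]: "V \<in> carrier SEM \<longleftrightarrow> variety V"
  by (simp add: SEM_def)

lemma le_SEM [simp]: "V \<sqsubseteq>\<^bsub>SEM\<^esub> W \<longleftrightarrow> V \<subseteq> W"
  by (simp add: SEM_def)

lemma variety_var: "(\<And>u v. (u, v) \<in> \<Sigma> \<Longrightarrow> u \<noteq> [] \<and> v \<noteq> []) \<Longrightarrow> variety (var \<Sigma>)"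
  unfolding variety_def by blast

lemma var_Un: "var (\<Sigma> \<union> \<Sigma>') = var \<Sigma> \<inter> var \<Sigma>'"
  by (auto simp: var_def)

lemma variety_Int: "variety V \<Longrightarrow> variety W \<Longrightarrow> variety (V \<inter> W)"
  unfolding variety_def by (metis (no_types, lifting) Un_iff var_Un)

lemma variety_Inter:
  assumes "\<And>V. V \<in> \<V> \<Longrightarrow> variety V" and "\<V> \<noteq> {}"
  shows "variety (\<Inter>\<V>)"
proof -
  from assms(1) have "\<forall>V \<in> \<V>. \<exists>\<Sigma>. (\<forall>(u, v) \<in> \<Sigma>. u \<noteq> [] \<and> v \<noteq> []) \<and> V = var \<Sigma>"
    by (simp add: variety_def)
  then obtain F where F: "\<And>V. V \<in> \<V> \<Longrightarrow> (\<forall>(u, v) \<in> F V. u \<noteq> [] \<and> v \<noteq> []) \<and> V = var (F V)"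
    by metis
  have mem: "S \<in> V \<longleftrightarrow> is_semigroup S \<and> (\<forall>e \<in> F V. satisfies S e)" if "V \<in> \<V>" for S V
    using F[OF that] unfolding var_def by blast
  have "\<Inter>\<V> = var (\<Union>V \<in> \<V>. F V)"
    using assms(2) mem by (fastforce simp: var_def)
  moreover have "\<forall>(u, v) \<in> (\<Union>V \<in> \<V>. F V). u \<noteq> [] \<and> v \<noteq> []"
    using F by fastforce
  ultimately show ?thesis
    unfolding variety_def by blast
qed

lemma variety_all: "variety (var {})"
  by (rule variety_var) simp

lemma variety_subset_all: "variety V \<Longrightarrow> V \<subseteq> var {}"
  by (auto simp: variety_def var_def)

lemma variety_generated:
  assumes "K \<subseteq> var {}"
  shows "variety (generated_variety K)"
  unfolding generated_variety_def
  by (rule variety_Inter) (use assms variety_all in auto)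

lemma least_SEM:
  assumes "variety V" "variety W"
  shows "least SEM (generated_variety (V \<union> W)) (Upper SEM {V, W})"
  using assms variety_generated[of "V \<union> W"] variety_subset_all[of V] variety_subset_all[of W]
  by (auto simp: least_def Upper_def generated_variety_def)

lemma greatest_SEM:
  assumes "variety V" "variety W"
  shows "greatest SEM (V \<inter> W) (Lower SEM {V, W})"
  using assms variety_Int[of V W] by (auto simp: greatest_def Lower_def)

lemma lattice_SEM: "lattice (SEM :: 'a magma set gorder)"
proof
  show "(.=\<^bsub>SEM\<^esub>) = (=)"
    by (simp add: SEM_def)
next
  fix V W :: "'a magma set"
  assume "V \<in> carrier SEM" "W \<in> carrier SEM"
  then show "\<exists>s. least SEM s (Upper SEM {V, W})" "\<exists>s. greatest SEM s (Lower SEM {V, W})"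
    using least_SEM greatest_SEM by fastforce+
qed (auto simp: SEM_def)

lemma join_SEM:
  assumes "variety V" "variety W"
  shows "V \<squnion>\<^bsub>SEM\<^esub> W = generated_variety (V \<union> W)"
proof -
  interpret lattice SEM by (rule lattice_SEM)
  show ?thesis
    unfolding join_def sup_def using least_SEM[OF assms]
    by (metis (mono_tags, lifting) least_unique someI)
qed

lemma meet_SEM:
  assumes "variety V" "variety W"
  shows "V \<sqinter>\<^bsub>SEM\<^esub> W = V \<inter> W"
proof -
  interpret lattice SEM by (rule lattice_SEM)
  show ?thesis
    unfolding meet_def inf_def using greatest_SEM[OF assms]
    by (metis (mono_tags, lifting) greatest_unique someI)
qed

section \<open>The varieties in the classification\<close>

definition all_semigroups :: "'a magma set" where
  "all_semigroups = {S. is_semigroup S}"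

definition trivial_variety :: "'a magma set" where
  "trivial_variety = {S. is_semigroup S \<and> (\<exists>a. carrier S = {a})}"

definition semilattices :: "'a magma set" where
  "semilattices =
     {S. is_semigroup S \<and>
         (\<forall>a \<in> carrier S. \<forall>b \<in> carrier S. a \<cdot>\<^bsub>S\<^esub> b = b \<cdot>\<^bsub>S\<^esub> a) \<and>
         (\<forall>a \<in> carrier S. a \<cdot>\<^bsub>S\<^esub> a = a)}"

text \<open>The system \<open>w \<approx> 0\<close>, with every letter \<open>x\<close> not occurring in \<open>w\<close>
  instead of an arbitrarily chosen one.\<close>

definition zero_ids :: "word \<Rightarrow> identity set" where
  "zero_ids w =
     {(w @ [x], w) | x. x \<notin> set w} \<union> {(x # w, w) | x. x \<notin> set w}"

definition perm_id :: "nat \<Rightarrow> (nat \<Rightarrow> nat) \<Rightarrow> identity" where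
  "perm_id m \<pi> = ([1..<m + 1], map \<pi> [1..<m + 1])"

text \<open>The letters \<open>x, y\<close> are \<open>1, 2\<close>, so that the words are \<open>xxy\<close>, \<open>xyx\<close>, \<open>yxx\<close>.\<close>

definition X_inf_inf :: "'a magma set" where
  "X_inf_inf = var (zero_ids [1, 1, 2] \<union> zero_ids [1, 2, 1] \<union> zero_ids [2, 1, 1])"

text \<open>For \<open>m = \<infinity>\<close> and finite \<open>n\<close> the value has no meaning; this case is excluded by \<open>m \<le> n\<close>.\<close>

definition X_variety :: "enat \<Rightarrow> enat \<Rightarrow> 'a magma set" where
  "X_variety m n =
     X_inf_inf
     \<inter> (case m of enat k \<Rightarrow> var {perm_id k \<pi> | \<pi>. \<pi> permutes {1..k}} | \<infinity> \<Rightarrow> all_semigroups)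
     \<inter> (case n of enat k \<Rightarrow> var (zero_ids [1..<k + 1]) | \<infinity> \<Rightarrow> all_semigroups)"

definition Y_variety :: "enat \<Rightarrow> enat \<Rightarrow> 'a magma set" where
  "Y_variety m n = X_variety m n \<inter> var (zero_ids [1, 1])"

lemma eval_word_in_carrier:
  assumes "is_semigroup S" "\<forall>i. \<phi> i \<in> carrier S" "w \<noteq> []"
  shows "eval_word S \<phi> w \<in> carrier S"
  using assms(3)
proof (induction w rule: induct_list012)
  case (3 x y w)
  then show ?case using assms(1,2) by (simp add: is_semigroup_def)
qed (use assms in auto)

lemma eval_word_cong:
  "w \<noteq> [] \<Longrightarrow> (\<And>i. i \<in> set w \<Longrightarrow> \<phi> i = \<psi> i) \<Longrightarrow> eval_word S \<phi> w = eval_word S \<psi> w"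
  by (induction w rule: induct_list012) auto

lemma eval_word_append:
  assumes "is_semigroup S" "\<forall>i. \<phi> i \<in> carrier S" "u \<noteq> []" "v \<noteq> []"
  shows "eval_word S \<phi> (u @ v) = eval_word S \<phi> u \<cdot>\<^bsub>S\<^esub> eval_word S \<phi> v"
  using assms(3)
proof (induction u rule: induct_list012)
  case (2 x)
  then show ?case using assms(4) by (cases v) auto
next
  case (3 x y w)
  have "\<phi> x \<in> carrier S" "eval_word S \<phi> (y # w) \<in> carrier S" "eval_word S \<phi> v \<in> carrier S"
    using assms eval_word_in_carrier by auto
  with 3 show ?case using assms(1) by (simp add: is_semigroup_def)
qed simp

lemma var_zero_ids_iff:
  assumes "w \<noteq> []"
  shows "S \<in> var (zero_ids w) \<longleftrightarrow>
    is_semigroup S \<and>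
    (\<exists>z \<in> carrier S.
       (\<forall>a \<in> carrier S. z \<cdot>\<^bsub>S\<^esub> a = z \<and> a \<cdot>\<^bsub>S\<^esub> z = z) \<and>
       (\<forall>\<phi>. (\<forall>i. \<phi> i \<in> carrier S) \<longrightarrow> eval_word S \<phi> w = z))"
    (is "?L \<longleftrightarrow> is_semigroup S \<and> ?R")
proof safe
  assume ?L
  then have sg: "is_semigroup S" and sat: "\<And>e. e \<in> zero_ids w \<Longrightarrow> satisfies S e"
    by (auto simp: var_def)
  show "is_semigroup S" by (rule sg)
  obtain x where x: "x \<notin> set w"
    using ex_new_if_finite[of "set w"] by auto
  have ann: "eval_word S \<phi> w \<cdot>\<^bsub>S\<^esub> a = eval_word S \<phi> w \<and> a \<cdot>\<^bsub>S\<^esub> eval_word S \<phi> w = eval_word S \<phi> w"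
    if \<phi>: "\<forall>i. \<phi> i \<in> carrier S" and a: "a \<in> carrier S" for \<phi> a
  proof -
    let ?\<psi> = "\<phi>(x := a)"
    have \<psi>: "\<forall>i. ?\<psi> i \<in> carrier S" using \<phi> a by simp
    have eq: "eval_word S ?\<psi> w = eval_word S \<phi> w"
      by (rule eval_word_cong) (use assms x in auto)
    have "satisfies S (w @ [x], w)" "satisfies S ([x] @ w, w)"
      using x by (auto intro: sat simp: zero_ids_def)
    then have "eval_word S ?\<psi> (w @ [x]) = eval_word S ?\<psi> w"
      "eval_word S ?\<psi> ([x] @ w) = eval_word S ?\<psi> w"
      using \<psi> unfolding satisfies_def fst_conv snd_conv by blast+
    then show ?thesis
      using eval_word_append[OF sg \<psi> assms, of "[x]"] eval_word_append[OF sg \<psi> _ assms, of "[x]"] eq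
      by (simp del: fun_upd_apply add: fun_upd_same)
  qed
  obtain b where b: "b \<in> carrier S" using sg by (auto simp: is_semigroup_def)
  let ?z = "eval_word S (\<lambda>_. b) w"
  have z: "?z \<in> carrier S" using eval_word_in_carrier[OF sg _ assms] b by simp
  show ?R
  proof (intro bexI[OF _ z] conjI allI impI ballI)
    fix \<phi> :: "nat \<Rightarrow> 'a" assume \<phi>: "\<forall>i. \<phi> i \<in> carrier S"
    have "eval_word S \<phi> w \<in> carrier S" using eval_word_in_carrier[OF sg \<phi> assms] .
    then show "eval_word S \<phi> w = ?z"
      using ann[OF \<phi> z] ann[of "\<lambda>_. b" "eval_word S \<phi> w"] b by metis
  qed (use ann b in auto)
next
  fix z
  assume sg: "is_semigroup S" and z: "z \<in> carrier S"
    and zero: "\<forall>a \<in> carrier S. z \<cdot>\<^bsub>S\<^esub> a = z \<and> a \<cdot>\<^bsub>S\<^esub> z = z"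
    and val: "\<forall>\<phi>. (\<forall>i. \<phi> i \<in> carrier S) \<longrightarrow> eval_word S \<phi> w = z"
  have "eval_word S \<phi> (w @ [x]) = z" "eval_word S \<phi> (x # w) = z"
    if "\<forall>i. \<phi> i \<in> carrier S" for \<phi> x
    using eval_word_append[OF sg that assms, of "[x]"] eval_word_append[OF sg that _ assms, of "[x]"]
      that zero val by auto
  then show ?L using sg val by (auto simp: var_def zero_ids_def satisfies_def)
qed

lemma all_semigroups_var: "all_semigroups = var {}"
  by (simp add: all_semigroups_def var_def)

lemma trivial_variety_var: "trivial_variety = var {([1], [2])}"
proof -
  have "(\<exists>a. carrier S = {a}) \<longleftrightarrow> satisfies S ([1], [2])" if "is_semigroup S" for S :: "'a magma"
  proof
    assume sat: "satisfies S ([1], [2])"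
    have "a = b" if "a \<in> carrier S" "b \<in> carrier S" for a b
      using sat[unfolded satisfies_def, rule_format, of "\<lambda>i. if i = 1 then a else b"] that by simp
    moreover have "carrier S \<noteq> {}" using that by (simp add: is_semigroup_def)
    ultimately show "\<exists>a. carrier S = {a}" by blast
  qed (auto simp: satisfies_def)
  then show ?thesis by (auto simp: trivial_variety_def var_def)
qed

lemma semilattices_var: "semilattices = var {([1, 2], [2, 1]), ([1, 1], [1])}"
proof -
  have 1: "(\<forall>a \<in> carrier S. \<forall>b \<in> carrier S. a \<cdot>\<^bsub>S\<^esub> b = b \<cdot>\<^bsub>S\<^esub> a) \<longleftrightarrow> satisfies S ([1, 2], [2, 1])"
    for S :: "'a magma"
  proof
    assume sat: "satisfies S ([1, 2], [2, 1])"
    show "\<forall>a \<in> carrier S. \<forall>b \<in> carrier S. a \<cdot>\<^bsub>S\<^esub> b = b \<cdot>\<^bsub>S\<^esub> a"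
    proof (intro ballI)
      fix a b assume "a \<in> carrier S" "b \<in> carrier S"
      then show "a \<cdot>\<^bsub>S\<^esub> b = b \<cdot>\<^bsub>S\<^esub> a"
        using sat[unfolded satisfies_def, rule_format, of "\<lambda>i. if i = 1 then a else b"] by simp
    qed
  qed (auto simp: satisfies_def)
  have 2: "(\<forall>a \<in> carrier S. a \<cdot>\<^bsub>S\<^esub> a = a) \<longleftrightarrow> satisfies S ([1, 1], [1])" for S :: "'a magma"
  proof
    assume sat: "satisfies S ([1, 1], [1])"
    show "\<forall>a \<in> carrier S. a \<cdot>\<^bsub>S\<^esub> a = a"
      using sat[unfolded satisfies_def, rule_format, of "\<lambda>_. _"] by auto
  qed (auto simp: satisfies_def)
  show ?thesis unfolding semilattices_def var_def by (simp add: 1 2)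
qed

lemma variety_zero_ids: "w \<noteq> [] \<Longrightarrow> variety (var (zero_ids w))"
  by (rule variety_var) (auto simp: zero_ids_def)

lemma variety_X:
  assumes "2 \<le> m" "2 \<le> n"
  shows "variety (X_variety m n)"
proof -
  have "variety (X_inf_inf :: 'a magma set)"
    unfolding X_inf_inf_def by (rule variety_var) (auto simp: zero_ids_def)
  moreover have "variety (var {perm_id k \<pi> | \<pi>. \<pi> permutes {1..k}} :: 'a magma set)" if "m = enat k" for k
    using that assms(1) by (intro variety_var) (auto simp: perm_id_def numeral_eq_enat)
  moreover have "variety (var (zero_ids [1..<k + 1]) :: 'a magma set)" if "n = enat k" for k
    using that assms(2) by (intro variety_zero_ids) (auto simp: numeral_eq_enat)
  ultimately show ?thesis
    unfolding X_variety_def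
    by (auto simp: all_semigroups_var variety_all intro!: variety_Int split: enat.split)
qed

lemma variety_Y: "2 \<le> m \<Longrightarrow> 2 \<le> n \<Longrightarrow> variety (Y_variety m n)"
  unfolding Y_variety_def by (intro variety_Int variety_X variety_zero_ids) auto

lemma variety_trivial: "variety trivial_variety"
  unfolding trivial_variety_var by (rule variety_var) auto

lemma variety_semilattices: "variety semilattices"
  unfolding semilattices_var by (rule variety_var) auto

end

theory Submission
  imports Defs "HOL-Library.Multiset"
begin

text \<open>Varieties are replaced by their equational theories. A theory is a fully invariant
  congruence of the free semigroup over the letters \<open>0, 1, 2, \<dots>\<close>, and a variety is
  determined by it; passing to the theory turns joins into intersections and meets into
  joins of congruences (\<open>identities_join\<close>, \<open>identities_meet\<close>). As cancellability is
  self-dual, a variety is cancellable iff its theory is a cancellable element of the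
  lattice of fully invariant congruences (\<open>cancellable_iff_cancel\<close>). There the claim
  becomes: \<open>\<Theta>\<close> is cancellable iff it is the identity relation, or some
  \<open>nil_congruence c m n\<close>, or the intersection of one with \<open>same_letters\<close>, the theory of
  semilattices. Modulo \<open>nil_congruence c m n\<close>, the nonlinear words of length at least \<open>c\<close>
  and all words of length at least \<open>n\<close> are zero, and a linear word, one without repeated
  letters, may be rearranged once its length is at least \<open>m\<close>. The varieties of the
  classification have \<open>c = 3\<close> (the \<open>X\<close>), \<open>c = 2\<close> (the \<open>Y\<close>) and \<open>n = 1\<close> (the trivial
  variety).

  Sufficiency. Each of these congruences has an ideal \<open>Z\<close> that contains all nonlinear
  words of length at least 3; it relates all words of \<open>Z\<close>, or all those with the same
  letters, and outside \<open>Z\<close> it at most rearranges linear words (locale \<open>special\<close>). Let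
  \<open>\<beta>\<close> and \<open>\<gamma>\<close> have the same intersection and the same join with \<open>\<Theta>\<close>.
  They agree on \<open>Z\<close>: in the presence of semilattices this is
  \<open>agree_of_agree_same_letters\<close>. If \<open>\<beta>\<close> takes a word \<open>p\<close> outside \<open>Z\<close> into \<open>Z\<close>, then
  so does \<open>\<gamma>\<close>, because the joins are equal (\<open>reaches_ideal\<close>); the difficulty is
  that the two may arrive at different places, \<open>q\<close> and \<open>r\<close>. The lemma \<open>confluence\<close> says
  that \<open>q\<close> and \<open>r\<close> are related after all. It rests on a fact about a single congruence
  (\<open>left_absorbs_or_peels\<close>): if a product \<open>p\<close> of distinct letters is related to a longer
  word with the same letters, then \<open>p\<close> is related to some \<open>g p\<close>, or the first letter
  splits off, that is, \<open>p = x p'\<close> is related to some \<open>x V\<close> with \<open>V\<close> longer than \<open>p'\<close> and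
  with the same letters. Absorption on both sides gives the claim at once, and a split
  letter allows induction on the length of \<open>p\<close>.

  Necessity. Contradictions come from small modifications of one congruence that are not
  seen by the intersection or the join with \<open>\<Theta>\<close>. Merging a word \<open>u\<close> with \<open>v\<close>, or
  instead with a word \<open>v'\<close> related to \<open>v\<close>, shows that a word \<open>u\<close> not related to \<open>v\<close> cannot
  be incomparable with \<open>v\<close> and \<open>v'\<close> in the order of occurrence
  (\<open>incomparable_impossible\<close>). This yields in turn an identity whose sides have different
  lengths, hence a periodicity law \<open>t\<^sup>n \<approx> t\<^sup>m\<close> (\<open>periodic\<close>); the law
  \<open>t\<^sup>N \<approx> t\<^sup>N t\<close> (\<open>aperiodic\<close>); and that \<open>xxy\<close>, \<open>xyx\<close>, \<open>yxx\<close> belong to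
  the ideal \<open>Z\<close> of words related to a word that contains an \<open>N\<close>-th power (\<open>cubic_words\<close>).
  Exchanging two positions of the linear words of length \<open>k\<close> shows that each permutation
  identity of \<open>\<Theta>\<close> preserves \<open>{i, j}\<close> whenever the exchange of \<open>i\<close> and \<open>j\<close> is no
  identity of \<open>\<Theta>\<close> (\<open>swap_preserved\<close>), so that one permutation identity implies all
  of the same length (\<open>all_permutations\<close>). What is left is to read off \<open>c\<close>, \<open>m\<close> and \<open>n\<close>
  (\<open>cancel_classification\<close>).\<close>

section \<open>Words, substitutions and fully invariant congruences\<close>

definition substitute :: "(nat \<Rightarrow> word) \<Rightarrow> word \<Rightarrow> word" where
  "substitute \<sigma> w = concat (map \<sigma> w)"

abbreviation nonerasing :: "(nat \<Rightarrow> word) \<Rightarrow> bool" where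
  "nonerasing \<sigma> \<equiv> (\<forall>x. \<sigma> x \<noteq> [])"

abbreviation replace :: "nat \<Rightarrow> word \<Rightarrow> nat \<Rightarrow> word" where
  "replace x t \<equiv> (\<lambda>y. [y])(x := t)"

lemma substitute_simps [simp]:
  "substitute \<sigma> [] = []"
  "substitute \<sigma> (x # w) = \<sigma> x @ substitute \<sigma> w"
  "substitute \<sigma> (u @ v) = substitute \<sigma> u @ substitute \<sigma> v"
  by (simp_all add: substitute_def)

lemma set_substitute: "set (substitute \<sigma> w) = (\<Union>x\<in>set w. set (\<sigma> x))"
  by (simp add: substitute_def)

lemma substitute_cong: "(\<And>x. x \<in> set w \<Longrightarrow> \<sigma> x = \<tau> x) \<Longrightarrow> substitute \<sigma> w = substitute \<tau> w"
  by (induction w) auto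

lemma substitute_letters: "substitute (\<lambda>x. [f x]) w = map f w"
  by (induction w) auto

lemma substitute_id [simp]: "substitute (\<lambda>x. [x]) w = w"
  by (induction w) auto

lemma substitute_upd_notin: "x \<notin> set w \<Longrightarrow> substitute (\<sigma>(x := t)) w = substitute \<sigma> w"
  by (intro substitute_cong) auto

lemma substitute_substitute:
  "substitute \<tau> (substitute \<sigma> w) = substitute (\<lambda>x. substitute \<tau> (\<sigma> x)) w"
  by (induction w) auto

lemma substitute_eq_Nil [simp]: "nonerasing \<sigma> \<Longrightarrow> substitute \<sigma> w = [] \<longleftrightarrow> w = []"
  by (cases w) auto

lemma length_substitute_ge: "nonerasing \<sigma> \<Longrightarrow> length w \<le> length (substitute \<sigma> w)"
proof (induction w)
  case (Cons x w)
  then have "length (\<sigma> x) \<ge> 1" by (simp add: Suc_leI)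
  with Cons show ?case by simp
qed simp

lemma not_distinct_substitute:
  assumes "\<not> distinct w" "nonerasing \<sigma>"
  shows "\<not> distinct (substitute \<sigma> w)"
proof -
  obtain a s b x where w: "w = a @ [x] @ s @ [x] @ b" using not_distinct_decomp[OF assms(1)] by blast
  obtain y t where "\<sigma> x = y # t" using assms(2) by (metis neq_Nil_conv)
  then show ?thesis using w by simp
qed

lemma length_substitute_eq:
  "length (substitute \<sigma> w) = (\<Sum>x\<in>#mset w. length (\<sigma> x))"
  by (induction w) auto

lemma count_list_substitute_ge:
  "count_list (\<sigma> x) z \<ge> 1 \<Longrightarrow> count_list w x \<le> count_list (substitute \<sigma> w) z"
  by (induction w) auto

text \<open>The empty list, which is not a word, forms a class of its own; this makes contexts with
  possibly empty sides available in one law.\<close>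

locale ficong =
  fixes \<theta> :: "(word \<times> word) set"
  assumes refl [simp, intro]: "(w, w) \<in> \<theta>"
    and sym: "(u, v) \<in> \<theta> \<Longrightarrow> (v, u) \<in> \<theta>"
    and trans [trans]: "(u, v) \<in> \<theta> \<Longrightarrow> (v, w) \<in> \<theta> \<Longrightarrow> (u, w) \<in> \<theta>"
    and Nil: "([], v) \<in> \<theta> \<Longrightarrow> v = []"
    and ctx: "(u, v) \<in> \<theta> \<Longrightarrow> (a @ u @ b, a @ v @ b) \<in> \<theta>"
    and sub: "(u, v) \<in> \<theta> \<Longrightarrow> nonerasing \<sigma> \<Longrightarrow> (substitute \<sigma> u, substitute \<sigma> v) \<in> \<theta>"
begin

lemma left: "(u, v) \<in> \<theta> \<Longrightarrow> (a @ u, a @ v) \<in> \<theta>"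
  using ctx[of u v a "[]"] by simp

lemma right: "(u, v) \<in> \<theta> \<Longrightarrow> (u @ b, v @ b) \<in> \<theta>"
  using ctx[of u v "[]" b] by simp

lemma mult: "(u, v) \<in> \<theta> \<Longrightarrow> (u', v') \<in> \<theta> \<Longrightarrow> (u @ u', v @ v') \<in> \<theta>"
  using left right trans by blast

lemma rename: "(u, v) \<in> \<theta> \<Longrightarrow> (map f u, map f v) \<in> \<theta>"
  using sub[of u v "\<lambda>x. [f x]"] by (simp add: substitute_letters)

lemma Nil_iff: "(u, v) \<in> \<theta> \<Longrightarrow> u = [] \<longleftrightarrow> v = []"
  using Nil sym by blast

lemma substitute_pointwise:
  assumes "\<And>x. x \<in> set w \<Longrightarrow> (\<sigma> x, \<tau> x) \<in> \<theta>"
  shows "(substitute \<sigma> w, substitute \<tau> w) \<in> \<theta>"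
  using assms by (induction w) (auto intro: mult)

lemma all_to_letter:
  assumes "(u, v) \<in> \<theta>"
  shows "(replicate (length u) a, replicate (length v) a) \<in> \<theta>"
  using rename[OF assms, of "\<lambda>_. a"] by (simp add: map_replicate_const)

end

definition word_power :: "word \<Rightarrow> nat \<Rightarrow> word" where
  "word_power w n = concat (replicate n w)"

lemma word_power_simps [simp]:
  "word_power w 0 = []" "word_power w (Suc n) = w @ word_power w n" "word_power [] n = []"
  by (simp_all add: word_power_def)

lemma word_power_add: "word_power w (m + n) = word_power w m @ word_power w n"
  by (simp add: word_power_def replicate_add)

lemma word_power_Suc_right: "word_power w (Suc n) = word_power w n @ w"
  using word_power_add[of w n 1] by simp

lemma length_power [simp]: "length (word_power w n) = n * length w"
  by (induction n) auto

lemma set_power: "set (word_power w n) = (if n = 0 then {} else set w)"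
  by (induction n) auto

lemma word_power_letter: "word_power [a] n = replicate n a"
  by (induction n) auto

lemma word_power_eq_Nil: "word_power w n = [] \<longleftrightarrow> n = 0 \<or> w = []"
  by (cases n) auto

lemma substitute_replicate: "substitute \<sigma> (replicate n x) = word_power (\<sigma> x) n"
  by (induction n) auto

lemma substitute_power: "substitute \<sigma> (word_power w n) = word_power (substitute \<sigma> w) n"
  by (induction n) auto

lemma substitute_const: "substitute (\<lambda>_. t) w = word_power t (length w)"
  by (induction w) auto

text \<open>Substitute \<open>t\<close> for every letter; if the sides differ in length, this is a periodicity
  law.\<close>

lemma (in ficong) power_of_length:
  assumes "(u, v) \<in> \<theta>"
  shows "(word_power t (length u), word_power t (length v)) \<in> \<theta>"
proof (cases "t = []")
  case False
  then show ?thesis using sub[OF assms, of "\<lambda>_. t"] by (simp add: substitute_const)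
qed simp

definition cjoin :: "(word \<times> word) set \<Rightarrow> (word \<times> word) set \<Rightarrow> (word \<times> word) set" where
  "cjoin \<theta> \<beta> = (\<theta> \<union> \<beta>)\<^sup>*"

lemma cjoin_upper: "\<theta> \<subseteq> cjoin \<theta> \<beta>" "\<beta> \<subseteq> cjoin \<theta> \<beta>"
  by (auto simp: cjoin_def)

lemma cjoin_least:
  assumes "ficong \<gamma>" "\<theta> \<subseteq> \<gamma>" "\<beta> \<subseteq> \<gamma>"
  shows "cjoin \<theta> \<beta> \<subseteq> \<gamma>"
proof (rule subrelI)
  interpret \<gamma>: ficong \<gamma> by fact
  fix u v assume "(u, v) \<in> cjoin \<theta> \<beta>"
  then show "(u, v) \<in> \<gamma>" unfolding cjoin_def
    by (induction rule: rtrancl_induct) (use assms(2,3) \<gamma>.trans in blast)+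
qed

lemma ficong_cjoin:
  assumes "ficong \<theta>" "ficong \<beta>"
  shows "ficong (cjoin \<theta> \<beta>)"
proof -
  interpret \<theta>: ficong \<theta> by fact
  interpret \<beta>: ficong \<beta> by fact
  have lift: "(f u, f v) \<in> cjoin \<theta> \<beta>"
    if "(u, v) \<in> cjoin \<theta> \<beta>" "\<And>u v. (u, v) \<in> \<theta> \<Longrightarrow> (f u, f v) \<in> \<theta>" "\<And>u v. (u, v) \<in> \<beta> \<Longrightarrow> (f u, f v) \<in> \<beta>"
    for f :: "word \<Rightarrow> word" and u v
    using that(1) unfolding cjoin_def
  proof (induction rule: rtrancl_induct)
    case (step y z)
    then have "(f y, f z) \<in> \<theta> \<union> \<beta>" using that(2,3) by blast
    with step(3) show ?case by (rule rtrancl_into_rtrancl)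
  qed simp
  show ?thesis
  proof
    show "(w, w) \<in> cjoin \<theta> \<beta>" for w by (simp add: cjoin_def)
    show "(v, u) \<in> cjoin \<theta> \<beta>" if "(u, v) \<in> cjoin \<theta> \<beta>" for u v
    proof -
      have "sym (\<theta> \<union> \<beta>)" by (auto intro!: symI dest: \<theta>.sym \<beta>.sym)
      then have "sym ((\<theta> \<union> \<beta>)\<^sup>*)" by (rule sym_rtrancl)
      then show ?thesis using that by (auto simp: cjoin_def dest: symD)
    qed
    show "(u, w) \<in> cjoin \<theta> \<beta>" if "(u, v) \<in> cjoin \<theta> \<beta>" "(v, w) \<in> cjoin \<theta> \<beta>" for u v w
      using that by (simp add: cjoin_def)
    show "v = []" if "([], v) \<in> cjoin \<theta> \<beta>" for v
      using that unfolding cjoin_def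
      by (induction rule: rtrancl_induct) (use \<theta>.Nil \<beta>.Nil in auto)
    show "(a @ u @ b, a @ v @ b) \<in> cjoin \<theta> \<beta>" if "(u, v) \<in> cjoin \<theta> \<beta>" for u v a b
      using lift[OF that, of "\<lambda>w. a @ w @ b"] \<theta>.ctx \<beta>.ctx by blast
    show "(substitute \<sigma> u, substitute \<sigma> v) \<in> cjoin \<theta> \<beta>"
      if "(u, v) \<in> cjoin \<theta> \<beta>" "nonerasing \<sigma>" for u v \<sigma>
      using lift[OF that(1), of "substitute \<sigma>"] \<theta>.sub \<beta>.sub that(2) by blast
  qed
qed

lemma ficong_Int:
  assumes "ficong \<theta>" "ficong \<beta>"
  shows "ficong (\<theta> \<inter> \<beta>)"
proof -
  interpret \<theta>: ficong \<theta> by fact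
  interpret \<beta>: ficong \<beta> by fact
  show ?thesis
    by unfold_locales (auto dest: \<theta>.sym \<beta>.sym \<theta>.Nil \<beta>.Nil intro: \<theta>.trans \<beta>.trans \<theta>.ctx \<beta>.ctx \<theta>.sub \<beta>.sub)
qed

definition cancel :: "(word \<times> word) set \<Rightarrow> bool" where
  "cancel \<theta> \<longleftrightarrow>
     (\<forall>\<beta> \<gamma>. ficong \<beta> \<longrightarrow> ficong \<gamma> \<longrightarrow> \<theta> \<inter> \<beta> = \<theta> \<inter> \<gamma> \<longrightarrow> cjoin \<theta> \<beta> = cjoin \<theta> \<gamma> \<longrightarrow> \<beta> = \<gamma>)"

definition same_letters :: "(word \<times> word) set" where
  "same_letters = {(u, v). set u = set v}"

lemma ficong_same_letters: "ficong same_letters"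
  by unfold_locales (auto simp: same_letters_def set_substitute)

lemma ficong_Id: "ficong Id"
  by unfold_locales auto

locale verbal_ideal =
  fixes Z :: "word set"
  assumes nonempty: "[] \<notin> Z"
    and mult: "w \<in> Z \<Longrightarrow> a @ w @ b \<in> Z"
    and sub: "w \<in> Z \<Longrightarrow> nonerasing \<sigma> \<Longrightarrow> substitute \<sigma> w \<in> Z"
begin

lemma left: "w \<in> Z \<Longrightarrow> a @ w \<in> Z"
  using mult[of w a "[]"] by simp

lemma right: "w \<in> Z \<Longrightarrow> w @ b \<in> Z"
  using mult[of w "[]" b] by simp

lemma rename: "w \<in> Z \<Longrightarrow> map f w \<in> Z"
  using sub[of w "\<lambda>x. [f x]"] by (simp add: substitute_letters)

end

section \<open>Identities of a variety\<close>

text \<open>The empty list has to be treated apart because \<open>eval_word\<close> gives it an arbitrary value.\<close>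

definition identities :: "'a magma set \<Rightarrow> (word \<times> word) set" where
  "identities V = {(u, v). (u = [] \<longleftrightarrow> v = []) \<and> (u \<noteq> [] \<longrightarrow> (\<forall>S\<in>V. satisfies S (u, v)))}"

lemma eval_word_substitute:
  assumes S: "is_semigroup S" and \<phi>: "\<forall>i. \<phi> i \<in> carrier S" and \<sigma>: "nonerasing \<sigma>" and w: "w \<noteq> []"
  shows "eval_word S \<phi> (substitute \<sigma> w) = eval_word S (\<lambda>i. eval_word S \<phi> (\<sigma> i)) w"
  using w
proof (induction w rule: induct_list012)
  case (3 x y w)
  have "substitute \<sigma> (y # w) \<noteq> []" using \<sigma> by simp
  moreover have "\<sigma> x \<noteq> []" using \<sigma> by simp
  ultimately have "eval_word S \<phi> (substitute \<sigma> (x # y # w)) =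
      eval_word S \<phi> (\<sigma> x) \<cdot>\<^bsub>S\<^esub> eval_word S \<phi> (substitute \<sigma> (y # w))"
    using eval_word_append[OF S \<phi>, of "\<sigma> x" "substitute \<sigma> (y # w)"] by simp
  then show ?case using 3 by simp
qed auto

lemma satisfies_eval:
  "satisfies S (u, v) \<Longrightarrow> (\<And>i. \<phi> i \<in> carrier S) \<Longrightarrow> eval_word S \<phi> u = eval_word S \<phi> v"
  by (auto simp: satisfies_def)

lemma ficong_identities:
  assumes V: "\<And>S. S \<in> V \<Longrightarrow> is_semigroup S"
  shows "ficong (identities V)"
proof
  show "(w, w) \<in> identities V" for w by (auto simp: identities_def satisfies_def)
  show "(v, u) \<in> identities V" if "(u, v) \<in> identities V" for u v
    using that by (auto simp: identities_def satisfies_def)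
  show "(u, w) \<in> identities V" if "(u, v) \<in> identities V" "(v, w) \<in> identities V" for u v w
    using that by (auto simp: identities_def satisfies_def)
  show "v = []" if "([], v) \<in> identities V" for v
    using that by (auto simp: identities_def)
  show "(a @ u @ b, a @ v @ b) \<in> identities V" if uv: "(u, v) \<in> identities V" for u v a b
  proof (cases "u = []")
    case True
    then show ?thesis using uv by (auto simp: identities_def satisfies_def)
  next
    case False
    have "eval_word S \<phi> (a @ u @ b) = eval_word S \<phi> (a @ v @ b)"
      if S: "S \<in> V" and \<phi>: "\<forall>i. \<phi> i \<in> carrier S" for S \<phi>
    proof -
      have v: "v \<noteq> []" and e: "eval_word S \<phi> u = eval_word S \<phi> v"
        using uv False S \<phi> by (auto simp: identities_def satisfies_def)
      have "eval_word S \<phi> (u @ b) = eval_word S \<phi> (v @ b)"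
        using eval_word_append[OF V[OF S] \<phi> False, of b] eval_word_append[OF V[OF S] \<phi> v, of b] e
        by (cases "b = []") auto
      then show ?thesis
        using eval_word_append[OF V[OF S] \<phi>, of a "u @ b"] eval_word_append[OF V[OF S] \<phi>, of a "v @ b"] False v
        by (cases "a = []") auto
    qed
    then show ?thesis using uv False by (auto simp: identities_def satisfies_def)
  qed
  show "(substitute \<sigma> u, substitute \<sigma> v) \<in> identities V"
    if uv: "(u, v) \<in> identities V" and \<sigma>: "nonerasing \<sigma>" for u v \<sigma>
  proof (cases "u = []")
    case True
    then show ?thesis using uv by (auto simp: identities_def satisfies_def)
  next
    case False
    then have v: "v \<noteq> []" using uv by (auto simp: identities_def)
    have "eval_word S \<phi> (substitute \<sigma> u) = eval_word S \<phi> (substitute \<sigma> v)"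
      if S: "S \<in> V" and \<phi>: "\<forall>i. \<phi> i \<in> carrier S" for S \<phi>
    proof -
      have "\<forall>i. eval_word S \<phi> (\<sigma> i) \<in> carrier S"
        using eval_word_in_carrier[OF V[OF S] \<phi>] \<sigma> by blast
      then have "eval_word S (\<lambda>i. eval_word S \<phi> (\<sigma> i)) u = eval_word S (\<lambda>i. eval_word S \<phi> (\<sigma> i)) v"
        using uv False S by (auto simp: identities_def satisfies_def)
      then show ?thesis
        using eval_word_substitute[OF V[OF S] \<phi> \<sigma>] False v by simp
    qed
    then show ?thesis using False v \<sigma> by (auto simp: identities_def satisfies_def)
  qed
qed

lemma var_identities:
  assumes "variety V"
  shows "var (identities V) = V"
proof -
  obtain \<Sigma> where \<Sigma>: "\<forall>(u, v) \<in> \<Sigma>. u \<noteq> [] \<and> v \<noteq> []" "V = var \<Sigma>"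
    using assms by (auto simp: variety_def)
  have "\<Sigma> \<subseteq> identities V"
    using \<Sigma> by (auto simp: identities_def var_def)
  then have "var (identities V) \<subseteq> V" using \<Sigma>(2) by (auto simp: var_def)
  moreover have "satisfies S (u, v)" if "S \<in> V" "(u, v) \<in> identities V" for S u v
    using that by (cases "u = []") (auto simp: identities_def satisfies_def)
  then have "V \<subseteq> var (identities V)"
    using variety_subset_all[OF assms] by (auto simp: var_def)
  ultimately show ?thesis by blast
qed

text \<open>Words modulo \<open>\<theta>\<close> form a semigroup that satisfies exactly the identities in
  \<open>\<theta>\<close>. It is countable, so an infinite type has room for an isomorphic copy: \<open>h\<close>
  sends a word to the code of its class, and \<open>g\<close> picks a word from a class.\<close>

lemma identities_var:
  assumes inf: "infinite (UNIV :: 'a set)" and "ficong \<theta>"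
  shows "identities (var \<theta> :: 'a magma set) = \<theta>"
proof
  interpret ficong \<theta> by fact
  show "\<theta> \<subseteq> identities (var \<theta> :: 'a magma set)"
  proof (rule subrelI)
    fix u v assume uv: "(u, v) \<in> \<theta>"
    then show "(u, v) \<in> identities (var \<theta> :: 'a magma set)"
      using Nil_iff[OF uv] by (auto simp: identities_def var_def)
  qed
  obtain f :: "nat \<Rightarrow> 'a" where f: "inj f"
    using infinite_countable_subset[OF inf] by auto
  define rep where "rep w = (SOME v. (w, v) \<in> \<theta>)" for w
  define h where "h w = f (to_nat (rep w))" for w
  have rep: "(w, rep w) \<in> \<theta>" for w
    unfolding rep_def by (rule someI[of _ w]) simp
  have rep_eq: "rep u = rep v" if "(u, v) \<in> \<theta>" for u v
  proof -
    have "(\<lambda>w. (u, w) \<in> \<theta>) = (\<lambda>w. (v, w) \<in> \<theta>)"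
      by (intro ext iffI) (use that sym[OF that] trans in \<open>blast+\<close>)
    then show ?thesis by (simp add: rep_def)
  qed
  have h_iff: "h u = h v \<longleftrightarrow> (u, v) \<in> \<theta>" for u v
  proof
    assume "h u = h v"
    then have "rep u = rep v"
      using f by (auto simp: h_def inj_eq)
    then show "(u, v) \<in> \<theta>" using trans[OF rep[of u] sym[of v "rep u"]] rep[of v] by simp
  qed (simp add: h_def rep_eq)
  define g where "g a = (SOME w. w \<noteq> [] \<and> h w = a)" for a
  define S :: "'a magma" where
    "S = \<lparr>carrier = h ` {w. w \<noteq> []}, mul = (\<lambda>a b. h (g a @ g b))\<rparr>"
  have g: "g a \<noteq> [] \<and> h (g a) = a" if "a \<in> carrier S" for a
  proof -
    obtain w where "w \<noteq> []" "h w = a" using \<open>a \<in> carrier S\<close> by (auto simp: S_def)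
    then show ?thesis
      unfolding g_def by (intro someI[of "\<lambda>w. w \<noteq> [] \<and> h w = a" w]) auto
  qed
  have hS: "h w \<in> carrier S" if "w \<noteq> []" for w
    using that by (auto simp: S_def)
  have gh: "(g (h w), w) \<in> \<theta>" if "w \<noteq> []" for w
    using g[OF hS[OF that]] h_iff by blast
  have mul: "h u \<cdot>\<^bsub>S\<^esub> h v = h (u @ v)" if "u \<noteq> []" "v \<noteq> []" for u v
  proof -
    have "h u \<cdot>\<^bsub>S\<^esub> h v = h (g (h u) @ g (h v))" by (simp add: S_def)
    also have "\<dots> = h (u @ v)" using mult[OF gh gh] that h_iff by blast
    finally show ?thesis .
  qed
  have carrier_ex: "\<exists>w. w \<noteq> [] \<and> a = h w" if "a \<in> carrier S" for a
    using that by (auto simp: S_def)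
  have sg: "is_semigroup S"
    unfolding is_semigroup_def
  proof (intro conjI ballI)
    show "carrier S \<noteq> {}" using hS[of "[0]"] by auto
    fix a b assume "a \<in> carrier S" "b \<in> carrier S"
    then obtain u v where uv: "u \<noteq> []" "a = h u" "v \<noteq> []" "b = h v" using carrier_ex by meson
    show "a \<cdot>\<^bsub>S\<^esub> b \<in> carrier S" using uv mul hS by simp
    fix c assume "c \<in> carrier S"
    then obtain w where w: "w \<noteq> []" "c = h w" using carrier_ex by meson
    show "a \<cdot>\<^bsub>S\<^esub> b \<cdot>\<^bsub>S\<^esub> c = a \<cdot>\<^bsub>S\<^esub> (b \<cdot>\<^bsub>S\<^esub> c)" using uv w mul by simp
  qed
  have eval: "eval_word S \<phi> w = h (substitute (\<lambda>i. g (\<phi> i)) w)"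
    if \<phi>: "\<forall>i. \<phi> i \<in> carrier S" and w: "w \<noteq> []" for \<phi> :: "nat \<Rightarrow> 'a" and w
    using w
  proof (induction w rule: induct_list012)
    case (2 x)
    then show ?case using g \<phi> by simp
  next
    case (3 x y w)
    have "g (\<phi> x) \<noteq> []" "h (g (\<phi> x)) = \<phi> x" "g (\<phi> y) \<noteq> []" using g \<phi> by auto
    then show ?case using 3 mul[of "g (\<phi> x)" "substitute (\<lambda>i. g (\<phi> i)) (y # w)"] by simp
  qed simp
  have "S \<in> var \<theta>"
    unfolding var_def
  proof (intro CollectI conjI sg ballI)
    fix e assume "e \<in> \<theta>"
    then obtain u v where e: "e = (u, v)" "(u, v) \<in> \<theta>" by (cases e) auto
    show "satisfies S e"
    proof (cases "u = []")
      case True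
      then have "v = []" using Nil_iff[OF e(2)] by simp
      with True show ?thesis using e by (simp add: satisfies_def)
    next
      case False
      then have "v \<noteq> []" using Nil_iff[OF e(2)] by simp
      show ?thesis unfolding satisfies_def
      proof (intro allI impI)
        fix \<phi> :: "nat \<Rightarrow> 'a" assume \<phi>: "\<forall>i. \<phi> i \<in> carrier S"
        then have "(substitute (\<lambda>i. g (\<phi> i)) u, substitute (\<lambda>i. g (\<phi> i)) v) \<in> \<theta>"
          using sub[OF e(2), of "\<lambda>i. g (\<phi> i)"] g by simp
        then have "h (substitute (\<lambda>i. g (\<phi> i)) u) = h (substitute (\<lambda>i. g (\<phi> i)) v)"
          by (simp only: h_iff)
        then show "eval_word S \<phi> (fst e) = eval_word S \<phi> (snd e)"
          by (simp only: eval[OF \<phi> False] eval[OF \<phi> \<open>v \<noteq> []\<close>] e fst_conv snd_conv)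
      qed
    qed
  qed
  show "identities (var \<theta> :: 'a magma set) \<subseteq> \<theta>"
  proof (rule subrelI)
    fix u v assume uv: "(u, v) \<in> identities (var \<theta> :: 'a magma set)"
    show "(u, v) \<in> \<theta>"
    proof (cases "u = []")
      case True
      then show ?thesis using uv by (auto simp: identities_def)
    next
      case False
      then have v: "v \<noteq> []" and sat: "satisfies S (u, v)"
        using uv \<open>S \<in> var \<theta>\<close> by (auto simp: identities_def)
      let ?\<phi> = "\<lambda>i. h [i]"
      have \<phi>: "\<forall>i. ?\<phi> i \<in> carrier S" using hS by simp
      have "(substitute (\<lambda>i. g (?\<phi> i)) w, w) \<in> \<theta>" for w
        using substitute_pointwise[of w "\<lambda>i. g (?\<phi> i)" "\<lambda>i. [i]"] gh by simp
      then have "h (substitute (\<lambda>i. g (?\<phi> i)) w) = h w" for w by (simp only: h_iff)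
      then have ev: "eval_word S ?\<phi> w = h w" if "w \<noteq> []" for w
        by (simp only: eval[OF \<phi> that] \<open>\<And>w. h (substitute (\<lambda>i. g (?\<phi> i)) w) = h w\<close>)
      have "eval_word S ?\<phi> u = eval_word S ?\<phi> v"
        by (rule satisfies_eval[OF sat]) (simp add: hS)
      then have "h u = h v" by (simp only: ev[OF False] ev[OF v])
      then show ?thesis by (simp only: h_iff)
    qed
  qed
qed

lemma var_antimono: "\<Sigma> \<subseteq> \<Sigma>' \<Longrightarrow> var \<Sigma>' \<subseteq> var \<Sigma>"
  by (auto simp: var_def)

lemma ficong_identities_variety:
  assumes "variety W"
  shows "ficong (identities W)"
  by (rule ficong_identities) (use variety_subset_all[OF assms] in \<open>auto simp: var_def\<close>)

lemma variety_var_ficong: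
  assumes "ficong \<theta>"
  shows "variety (var \<theta> :: 'a magma set)"
proof -
  interpret ficong \<theta> by fact
  have "satisfies S (u, v)" if "(u, v) \<in> \<theta>" "u = []" for u v and S :: "'a magma"
  proof -
    have "v = u" using that Nil by simp
    then show ?thesis by (simp add: satisfies_def)
  qed
  then have "(\<forall>e\<in>\<theta>. satisfies S e) \<longleftrightarrow> (\<forall>e\<in>{(u, v) \<in> \<theta>. u \<noteq> []}. satisfies S e)" for S :: "'a magma"
    by blast
  then have "var \<theta> = (var {(u, v) \<in> \<theta>. u \<noteq> []} :: 'a magma set)"
    by (simp only: var_def)
  moreover have "variety (var {(u, v) \<in> \<theta>. u \<noteq> []} :: 'a magma set)"
    using Nil_iff by (intro variety_var) auto
  ultimately show ?thesis by simp
qed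

lemma identities_inject:
  "variety W \<Longrightarrow> variety W' \<Longrightarrow> identities W = identities W' \<longleftrightarrow> W = W'"
  using var_identities by metis

lemma variety_join:
  assumes "variety W" "variety W'"
  shows "variety (W \<squnion>\<^bsub>SEM\<^esub> W')"
  unfolding join_SEM[OF assms]
  by (rule variety_generated) (simp add: variety_subset_all assms)

text \<open>The smallest variety that contains two others satisfies the identities common to both,
  and no more, since these form a fully invariant congruence and hence are the theory of a
  variety.\<close>

lemma identities_join:
  fixes W W' :: "'a magma set"
  assumes inf: "infinite (UNIV :: 'a set)" and W: "variety W" "variety W'"
  shows "identities (W \<squnion>\<^bsub>SEM\<^esub> W') = identities W \<inter> identities W'"
proof
  note fi = ficong_Int[OF ficong_identities_variety[OF W(1)] ficong_identities_variety[OF W(2)]]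
  have "W \<union> W' \<subseteq> generated_variety (W \<union> W')" by (auto simp: generated_variety_def)
  then show "identities (W \<squnion>\<^bsub>SEM\<^esub> W') \<subseteq> identities W \<inter> identities W'"
    by (auto simp: identities_def join_SEM W)
  have "W \<union> W' \<subseteq> var (identities W \<inter> identities W')"
    using var_identities[OF W(1)] var_identities[OF W(2)] by (auto simp: var_def)
  then have "generated_variety (W \<union> W') \<subseteq> var (identities W \<inter> identities W')"
    using variety_var_ficong[OF fi] by (auto simp: generated_variety_def)
  then have "identities (var (identities W \<inter> identities W') :: 'a magma set)
      \<subseteq> identities (generated_variety (W \<union> W'))"
    by (auto simp: identities_def)
  then show "identities W \<inter> identities W' \<subseteq> identities (W \<squnion>\<^bsub>SEM\<^esub> W')"
    using identities_var[OF inf fi] by (simp add: join_SEM W)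
qed

lemma identities_meet:
  fixes W W' :: "'a magma set"
  assumes inf: "infinite (UNIV :: 'a set)" and W: "variety W" "variety W'"
  shows "identities (W \<sqinter>\<^bsub>SEM\<^esub> W') = cjoin (identities W) (identities W')"
proof -
  let ?J = "cjoin (identities W) (identities W')"
  have J: "ficong ?J" using ficong_cjoin ficong_identities_variety W by blast
  have fW: "ficong (identities (W \<inter> W'))" using ficong_identities_variety variety_Int W by blast
  have "identities W \<subseteq> identities (W \<inter> W')" "identities W' \<subseteq> identities (W \<inter> W')"
    by (auto simp: identities_def)
  then have "?J \<subseteq> identities (W \<inter> W')" using cjoin_least fW by blast
  moreover have "var ?J \<subseteq> W \<inter> W'"
    using var_antimono[OF cjoin_upper(1)] var_antimono[OF cjoin_upper(2)]
      var_identities[OF W(1)] var_identities[OF W(2)] by blast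
  then have "identities (W \<inter> W') \<subseteq> identities (var ?J :: 'a magma set)"
    by (auto simp: identities_def)
  ultimately show ?thesis using identities_var[OF inf J] by (auto simp: meet_SEM W)
qed

text \<open>Joins and meets change places under \<open>identities\<close>, but the definition of cancellability
  is symmetric in them.\<close>

lemma cancellable_iff_cancel:
  fixes V :: "'a magma set"
  assumes inf: "infinite (UNIV :: 'a set)" and V: "variety V"
  shows "cancellable SEM V \<longleftrightarrow> cancel (identities V)"
proof
  assume c: "cancellable SEM V"
  show "cancel (identities V)"
    unfolding cancel_def
  proof (intro allI impI)
    fix \<beta> \<gamma>
    assume \<beta>: "ficong \<beta>" and \<gamma>: "ficong \<gamma>" and int: "identities V \<inter> \<beta> = identities V \<inter> \<gamma>"
      and jo: "cjoin (identities V) \<beta> = cjoin (identities V) \<gamma>"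
    let ?B = "var \<beta> :: 'a magma set" and ?C = "var \<gamma> :: 'a magma set"
    note B = variety_var_ficong[OF \<beta>] identities_var[OF inf \<beta>]
      and C = variety_var_ficong[OF \<gamma>] identities_var[OF inf \<gamma>]
    have "V \<squnion>\<^bsub>SEM\<^esub> ?B = V \<squnion>\<^bsub>SEM\<^esub> ?C"
      by (rule identities_inject[THEN iffD1, OF variety_join[OF V B(1)] variety_join[OF V C(1)]])
        (simp only: identities_join[OF inf V B(1)] identities_join[OF inf V C(1)] B(2) C(2) int)
    moreover have "V \<sqinter>\<^bsub>SEM\<^esub> ?B = V \<sqinter>\<^bsub>SEM\<^esub> ?C"
      unfolding meet_SEM[OF V B(1)] meet_SEM[OF V C(1)]
      by (rule identities_inject[THEN iffD1, OF variety_Int[OF V B(1)] variety_Int[OF V C(1)]])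
        (simp only: identities_meet[OF inf V B(1), unfolded meet_SEM[OF V B(1)]]
          identities_meet[OF inf V C(1), unfolded meet_SEM[OF V C(1)]] B(2) C(2) jo)
    ultimately have "?B = ?C"
      using c[unfolded cancellable_def, THEN conjunct2, rule_format, of ?B ?C] B(1) C(1)
      unfolding carrier_SEM by blast
    then have "identities ?B = identities ?C" by (rule arg_cong)
    then show "\<beta> = \<gamma>" by (simp only: B(2) C(2))
  qed
next
  assume c: "cancel (identities V)"
  show "cancellable SEM V"
    unfolding cancellable_def
  proof (intro conjI ballI impI)
    show "V \<in> carrier SEM" using V by simp
    fix B C :: "'a magma set" assume "B \<in> carrier SEM" "C \<in> carrier SEM"
      and eq: "V \<squnion>\<^bsub>SEM\<^esub> B = V \<squnion>\<^bsub>SEM\<^esub> C \<and> V \<sqinter>\<^bsub>SEM\<^esub> B = V \<sqinter>\<^bsub>SEM\<^esub> C"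
    then have B: "variety B" and C: "variety C" by simp_all
    have "identities V \<inter> identities B = identities V \<inter> identities C"
      using identities_join[OF inf V B] identities_join[OF inf V C] eq by (simp only:)
    moreover have "cjoin (identities V) (identities B) = cjoin (identities V) (identities C)"
      using identities_meet[OF inf V B] identities_meet[OF inf V C] eq by (simp only:)
    ultimately have "identities B = identities C"
      using c ficong_identities_variety[OF B] ficong_identities_variety[OF C]
      unfolding cancel_def by blast
    then show "B = C" using identities_inject B C by blast
  qed
qed

section \<open>Expanding a product of distinct letters\<close>

text \<open>A word that is at least as long as a nonempty product \<open>q\<close> of distinct letters is an
  instance of \<open>q\<close>: cut it into as many blocks as \<open>q\<close> has letters. The following lemmas
  provide cuts in which the blocks of one or two letters are prescribed.\<close>

lemma cut_exists:
  assumes "distinct q" "length q \<le> length V" "q = [] \<Longrightarrow> V = []"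
  shows "\<exists>\<sigma>. nonerasing \<sigma> \<and> substitute \<sigma> q = V"
  using assms
proof (induction q arbitrary: V)
  case Nil
  then show ?case by (intro exI[of _ "\<lambda>x. [x]"]) simp
next
  case (Cons x q)
  then obtain v V' where V: "V = v # V'" by (cases V) auto
  show ?case
  proof (cases "q = []")
    case True
    then show ?thesis using V by (intro exI[of _ "replace x V"]) simp
  next
    case False
    then obtain \<sigma> where \<sigma>: "nonerasing \<sigma>" "substitute \<sigma> q = V'"
      using Cons V by auto
    define \<tau> where "\<tau> = \<sigma>(x := [v])"
    have "x \<notin> set q" using Cons.prems(1) by simp
    then have "substitute \<tau> q = V'" using substitute_upd_notin[of x q \<sigma> "[v]"] \<sigma>(2) \<tau>_def by (simp only: not_False_eq_True)
    moreover have "\<tau> x = [v]" by (simp add: \<tau>_def)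
    ultimately have "substitute \<tau> (x # q) = V" using V by simp
    moreover have "nonerasing \<tau>" using \<sigma>(1) by (simp add: \<tau>_def)
    ultimately show ?thesis by blast
  qed
qed

lemma cut_append:
  assumes "distinct (q1 @ q2)" "nonerasing \<sigma>1" "nonerasing \<sigma>2"
  obtains \<sigma> where "nonerasing \<sigma>" "\<And>x. x \<in> set q1 \<Longrightarrow> \<sigma> x = \<sigma>1 x" "\<And>x. x \<in> set q2 \<Longrightarrow> \<sigma> x = \<sigma>2 x"
    "substitute \<sigma> q1 = substitute \<sigma>1 q1" "substitute \<sigma> q2 = substitute \<sigma>2 q2"
proof
  let ?\<sigma> = "\<lambda>x. if x \<in> set q1 then \<sigma>1 x else \<sigma>2 x"
  show "nonerasing ?\<sigma>" using assms by simp
  show "?\<sigma> x = \<sigma>1 x" if "x \<in> set q1" for x using that by simp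
  show "?\<sigma> x = \<sigma>2 x" if "x \<in> set q2" for x using that assms(1) by auto
  show "substitute ?\<sigma> q1 = substitute \<sigma>1 q1" by (rule substitute_cong) simp
  show "substitute ?\<sigma> q2 = substitute \<sigma>2 q2" using assms(1) by (intro substitute_cong) auto
qed

lemma cut_at:
  assumes "distinct (p1 @ x # p2)" "B \<noteq> []"
    "length p1 \<le> length A" "p1 = [] \<Longrightarrow> A = []" "length p2 \<le> length C" "p2 = [] \<Longrightarrow> C = []"
  shows "\<exists>\<sigma>. nonerasing \<sigma> \<and> substitute \<sigma> p1 = A \<and> \<sigma> x = B \<and> substitute \<sigma> p2 = C"
proof -
  obtain \<sigma>1 where \<sigma>1: "nonerasing \<sigma>1" "substitute \<sigma>1 p1 = A"
    using cut_exists[of p1 A] assms by auto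
  obtain \<sigma>2 where \<sigma>2: "nonerasing \<sigma>2" "substitute \<sigma>2 p2 = C"
    using cut_exists[of p2 C] assms by auto
  have \<sigma>2': "nonerasing (\<sigma>2(x := B))" using \<sigma>2(1) assms(2) by simp
  have \<sigma>2x: "substitute (\<sigma>2(x := B)) p2 = C"
    using substitute_upd_notin[of x p2 \<sigma>2 B] \<sigma>2(2) assms(1) by simp
  show ?thesis
  proof (rule cut_append[OF assms(1) \<sigma>1(1) \<sigma>2'])
    fix \<sigma>
    assume ne: "nonerasing \<sigma>" and p1: "substitute \<sigma> p1 = substitute \<sigma>1 p1"
      and x: "\<And>y. y \<in> set (x # p2) \<Longrightarrow> \<sigma> y = (\<sigma>2(x := B)) y"
      and *: "substitute \<sigma> (x # p2) = substitute (\<sigma>2(x := B)) (x # p2)"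
    have xB: "\<sigma> x = B" using x[of x] by simp
    have "B @ substitute \<sigma> p2 = B @ C" using * by (simp only: substitute_simps xB \<sigma>2x fun_upd_same)
    then have "substitute \<sigma> p2 = C" by simp
    then show ?thesis using ne p1[unfolded \<sigma>1(2)] xB by blast
  qed
qed

lemma cut_around:
  assumes "distinct (p1 @ x # p2)" "B \<noteq> []" "length p1 \<le> length A" "length p2 \<le> length C"
  shows "\<exists>\<sigma> A2 C1. nonerasing \<sigma> \<and> substitute \<sigma> (p1 @ x # p2) = A @ B @ C \<and> \<sigma> x = A2 @ B @ C1"
proof -
  let ?A1 = "take (length p1) A" and ?A2 = "drop (length p1) A"
  let ?C1 = "take (length C - length p2) C" and ?C2 = "drop (length C - length p2) C"
  have "\<exists>\<sigma>. nonerasing \<sigma> \<and> substitute \<sigma> p1 = ?A1 \<and> \<sigma> x = ?A2 @ B @ ?C1 \<and> substitute \<sigma> p2 = ?C2"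
    by (rule cut_at[OF assms(1)]) (use assms in auto)
  then obtain \<sigma> where \<sigma>: "nonerasing \<sigma>" "substitute \<sigma> p1 = ?A1" "\<sigma> x = ?A2 @ B @ ?C1" "substitute \<sigma> p2 = ?C2"
    by blast
  have "substitute \<sigma> (p1 @ x # p2) = (?A1 @ ?A2) @ B @ (?C1 @ ?C2)" using \<sigma>(2-4) by simp
  also have "\<dots> = A @ B @ C" by (simp only: append_take_drop_id)
  finally show ?thesis using \<sigma>(1,3) by blast
qed

text \<open>Every letter of \<open>p\<close> occurs in \<open>W\<close> as well, and some letter more often than in \<open>p\<close>.\<close>

lemma length_substitute_less:
  assumes "distinct p" "set W = set p" "length p < length W" "nonerasing \<sigma>"
  shows "length (substitute \<sigma> p) < length (substitute \<sigma> W)"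
proof -
  have "mset p = mset_set (set p)" using assms(1) by (simp add: mset_set_set)
  then have "mset p \<subseteq># mset W"
    using mset_set_set_mset_msubset[of "mset W"] assms(2) by simp
  then obtain M where M: "mset W = mset p + M" using mset_subset_eq_exists_conv by blast
  then have "size (mset W) = size (mset p) + size M" by simp
  then have "M \<noteq> {#}" using assms(3) by auto
  then obtain a M' where "M = add_mset a M'" by (cases M) auto
  then show ?thesis
    using M assms(4) by (simp add: length_substitute_eq)
qed

lemma substitute_rev: "rev (substitute \<sigma> w) = substitute (\<lambda>x. rev (\<sigma> x)) (rev w)"
  by (induction w) auto

lemma split_ends:
  assumes "k1 + k2 + m \<le> length D"
  shows "\<exists>C1 C2 C3. D = C1 @ C2 @ C3 \<and> length C1 = k1 \<and> length C3 = k2 \<and> m \<le> length C2"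
proof (intro exI conjI)
  let ?D = "drop k1 D"
  show "D = take k1 D @ take (length ?D - k2) ?D @ drop (length ?D - k2) ?D"
    by (simp only: append_take_drop_id)
qed (use assms in simp_all)

lemma split_at_count:
  "k < count_list W x \<Longrightarrow> \<exists>A C. W = A @ x # C \<and> count_list A x = k"
proof (induction W arbitrary: k)
  case (Cons a W)
  show ?case
  proof (cases "a = x \<and> k = 0")
    case True
    then show ?thesis by (intro exI[of _ "[]"] exI[of _ W]) simp
  next
    case False
    define k' where "k' = (if a = x then k - 1 else k)"
    have "k' < count_list W x" using Cons.prems False by (auto simp: k'_def split: if_splits)
    then obtain A C where "W = A @ x # C" "count_list A x = k'" using Cons.IH by blast
    then show ?thesis using False by (intro exI[of _ "a # A"] exI[of _ C]) (auto simp: k'_def)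
  qed
qed simp

lemma count_list_append: "count_list (u @ v) x = count_list u x + count_list v x"
  by (induction u) auto

text \<open>A word all of whose factors of length 2 are factors of \<open>p\<close> runs through \<open>p\<close> without
  jumping, so it cannot be longer than \<open>p\<close>. A word that is longer than \<open>p\<close> has two
  neighbouring letters that are not neighbours in \<open>p\<close> in this order.\<close>

lemma successive_letters_short:
  assumes "distinct p" "W \<noteq> []" "set W \<subseteq> set p"
    and succ: "\<And>A a b B. W = A @ a # b # B \<Longrightarrow> \<exists>t. t + 1 < length p \<and> a = p ! t \<and> b = p ! (t + 1)"
  shows "length W \<le> length p"
proof -
  obtain t0 where t0: "t0 < length p" "W ! 0 = p ! t0"
    using assms(2,3) by (metis in_set_conv_nth length_greater_0_conv nth_mem subsetD)
  have "t0 + j < length p \<and> W ! j = p ! (t0 + j)" if "j < length W" for j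
    using that
  proof (induction j)
    case 0
    then show ?case using t0 by simp
  next
    case (Suc j)
    have "W = take j W @ W ! j # W ! Suc j # drop (Suc (Suc j)) W"
      using Suc.prems by (simp add: Cons_nth_drop_Suc)
    then obtain t where t: "t + 1 < length p" "W ! j = p ! t" "W ! Suc j = p ! (t + 1)"
      using succ by blast
    have "t = t0 + j" using Suc t assms(1) nth_eq_iff_index_eq[of p t "t0 + j"] by simp
    then show ?case using t by simp
  qed
  from this[of "length W - 1"] show ?thesis using assms(2) by (cases W) auto
qed

lemma split_two_positions:
  assumes "s < t" "t < length p"
  shows "\<exists>p1 p2 p3. p = p1 @ p ! s # p2 @ p ! t # p3 \<and> length p2 = t - s - 1"
proof -
  let ?q = "drop (s + 1) p"
  have "p = take s p @ p ! s # ?q"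
    using assms by (simp add: Cons_nth_drop_Suc)
  moreover have "?q = take (t - s - 1) ?q @ ?q ! (t - s - 1) # drop (Suc (t - s - 1)) ?q"
    using assms by (intro id_take_nth_drop) simp
  moreover have "?q ! (t - s - 1) = p ! t" using assms by simp
  ultimately have "p = take s p @ p ! s # take (t - s - 1) ?q @ p ! t # drop (Suc (t - s - 1)) ?q"
    by metis
  moreover have "length (take (t - s - 1) ?q) = t - s - 1" using assms by simp
  ultimately show ?thesis by blast
qed

lemma split_middle:
  assumes "k + 2 * n \<le> length D"
  shows "\<exists>E1 M E3. D = E1 @ M @ E3 \<and> n \<le> length E1 \<and> length M = k \<and> n \<le> length E3"
proof (intro exI conjI)
  show "D = take n D @ take k (drop n D) @ drop k (drop n D)"
    by (simp only: append_take_drop_id)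
qed (use assms in simp_all)

lemma cut_at_two:
  assumes d: "distinct (p1 @ x # p2 @ y # p3)" and ne: "X \<noteq> []" "Y \<noteq> []"
    and len: "length P1 = length p1" "length P3 = length p3"
    and mid: "length p2 \<le> length P2" "p2 = [] \<Longrightarrow> P2 = []"
  shows "\<exists>\<sigma>. nonerasing \<sigma> \<and> substitute \<sigma> (p1 @ x # p2 @ y # p3) = P1 @ X @ P2 @ Y @ P3
    \<and> \<sigma> x = X \<and> \<sigma> y = Y"
proof -
  have "\<exists>\<rho>. nonerasing \<rho> \<and> substitute \<rho> p1 = P1"
    by (rule cut_exists) (use d len in auto)
  then obtain \<rho> where \<rho>: "nonerasing \<rho>" "substitute \<rho> p1 = P1" by blast
  have "\<exists>\<tau>. nonerasing \<tau> \<and> substitute \<tau> p2 = P2 \<and> \<tau> y = Y \<and> substitute \<tau> p3 = P3"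
    by (rule cut_at) (use d ne len mid in auto)
  then obtain \<tau> where \<tau>: "nonerasing \<tau>" "substitute \<tau> p2 = P2" "\<tau> y = Y" "substitute \<tau> p3 = P3"
    by blast
  define \<sigma> where "\<sigma> z = (if z \<in> set p1 then \<rho> z else if z = x then X else \<tau> z)" for z
  have "nonerasing \<sigma>" using \<rho>(1) \<tau>(1) ne by (simp add: \<sigma>_def)
  moreover have "\<sigma> x = X" "\<sigma> y = Y" using d \<tau>(3) by (auto simp: \<sigma>_def)
  moreover have "substitute \<sigma> p1 = P1"
    using substitute_cong[of p1 \<sigma> \<rho>] \<rho>(2) by (simp add: \<sigma>_def)
  moreover have "substitute \<sigma> p2 = substitute \<tau> p2"
    by (rule substitute_cong) (use d in \<open>auto simp: \<sigma>_def\<close>)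
  moreover have "substitute \<sigma> p3 = substitute \<tau> p3"
    by (rule substitute_cong) (use d in \<open>auto simp: \<sigma>_def\<close>)
  ultimately show ?thesis using \<tau>(2,4) by (intro exI[of _ \<sigma>]) simp
qed

text \<open>Let \<open>p\<close> be a product of distinct letters and \<open>K\<close> the set of words with the same letters
  that are related to \<open>p\<close>. If a word of \<open>K\<close> contains a block that is an instance of \<open>p\<close>,
  then the same instance of any other word \<open>W\<close> in \<open>K\<close> may take the place of that block
  (\<open>K_window\<close>). As every long block is an instance of \<open>p\<close> in many ways, one longer word in
  \<open>K\<close> produces a great variety of words in \<open>K\<close>. The lemmas of this locale exploit this to
  bring prescribed words into the middle of words of \<open>K\<close>, and finally \<open>p\<close> itself, unless
  the first or the last letter of \<open>p\<close> splits off.\<close>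

locale linear_word = ficong \<beta> for \<beta> +
  fixes p :: word
  assumes distinct_p: "distinct p"
begin

definition K :: "word set" where
  "K = {W. (p, W) \<in> \<beta> \<and> set W = set p}"

lemma K_set: "W \<in> K \<Longrightarrow> set W = set p"
  by (simp add: K_def)

lemma K_related: "W \<in> K \<Longrightarrow> (p, W) \<in> \<beta>"
  by (simp add: K_def)

lemma K_window:
  assumes "G @ substitute \<sigma> p @ H \<in> K" "nonerasing \<sigma>" "W \<in> K"
  shows "G @ substitute \<sigma> W @ H \<in> K"
proof -
  have "(G @ substitute \<sigma> p @ H, G @ substitute \<sigma> W @ H) \<in> \<beta>"
    using assms(2,3) by (intro ctx sub) (auto simp: K_def)
  then show ?thesis using assms by (auto simp: K_def set_substitute intro: trans)
qed

lemma K_cut: "substitute \<sigma> p = V \<Longrightarrow> nonerasing \<sigma> \<Longrightarrow> V \<in> K \<Longrightarrow> W \<in> K \<Longrightarrow> substitute \<sigma> W \<in> K"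
  using K_window[of "[]" \<sigma> "[]" W] by simp

lemma K_long:
  assumes W0: "W0 \<in> K" "length p < length W0"
  shows "\<exists>W\<in>K. M \<le> length W \<and> length p < length W"
proof (induction M)
  case 0
  then show ?case using W0 by blast
next
  case (Suc M)
  then obtain W where W: "W \<in> K" "M \<le> length W" "length p < length W" by blast
  have "p \<noteq> []"
  proof
    assume "p = []"
    moreover have "set W0 = set p" using W0(1) by (simp add: K_def)
    ultimately show False using W0(2) by simp
  qed
  then obtain \<sigma> where \<sigma>: "nonerasing \<sigma>" "substitute \<sigma> p = W"
    using cut_exists[OF distinct_p, of W] W(3) by auto
  have "substitute \<sigma> W \<in> K" by (rule K_cut[OF \<sigma>(2,1) W(1) W(1)])
  moreover have "length W < length (substitute \<sigma> W)"
    using length_substitute_less[OF distinct_p _ W(3) \<sigma>(1)] W(1) \<sigma>(2) by (simp add: K_def)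
  ultimately show ?case using W by (intro bexI[of _ "substitute \<sigma> W"]) auto
qed

text \<open>Take a very long \<open>W\<close> in \<open>K\<close>. Because neither letter splits off, \<open>x\<close> occurs in \<open>W\<close> after
  the first position and \<open>y\<close> before the last one. If \<open>x\<close> occurs only near one end, then
  one replaces \<open>W\<close> by an instance of \<open>W\<close> in which the first letter \<open>c\<close>, or the last letter
  \<open>e\<close>, stands for a long word, and this moves an occurrence of \<open>x\<close> away from the end.\<close>

lemma middle_first:
  assumes p: "p = x # p'" "p' \<noteq> []" "p = p'' @ [y]"
    and noI: "\<And>V. x # V \<in> K \<Longrightarrow> length p' < length V \<Longrightarrow> x \<in> set V"
    and noII: "\<And>V. V @ [y] \<in> K \<Longrightarrow> length p'' < length V \<Longrightarrow> y \<in> set V"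
    and W0: "W0 \<in> K" "length p < length W0"
  shows "\<exists>A B. length p \<le> length A \<and> length p \<le> length B \<and> A @ [x] @ B \<in> K"
proof -
  define n where "n = length p"
  have n: "length p' = n - 1" "length p'' = n - 1" "n \<ge> 2"
  proof -
    show "length p' = n - 1" using p(1) by (simp add: n_def)
    show "length p'' = n - 1" using p(3) by (simp add: n_def)
    show "n \<ge> 2" using p(1,2) by (cases p') (auto simp: n_def)
  qed
  have px: "p'' \<noteq> []" using n by auto
  obtain W where W: "W \<in> K" "5 * n \<le> length W" using K_long[OF W0, of "5 * n"] by blast
  have setW: "set W = set p" using W(1) by (simp add: K_def)
  obtain c W1 where W1: "W = c # W1" using W(2) n by (cases W) auto
  have "x \<in> set W1"
  proof (cases "c = x")
    case True
    then show ?thesis using noI[of W1] W W1 n by auto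
  next
    case False
    then show ?thesis using setW W1 p(1) by auto
  qed
  then obtain A0 B0 where "W1 = A0 @ x # B0" by (auto simp: in_set_conv_decomp)
  then have W_x: "W = c # A0 @ x # B0" using W1 by simp
  obtain W2 e where W2: "W = W2 @ [e]" using W1 by (metis list.distinct(1) rev_exhaust)
  have "y \<in> set W2"
  proof (cases "e = y")
    case True
    then show ?thesis using noII[of W2] W W2 n by auto
  next
    case False
    then show ?thesis using setW W2 p(3) by auto
  qed
  then obtain A1 B1 where "W2 = A1 @ y # B1" by (auto simp: in_set_conv_decomp)
  then have W_y: "W = A1 @ y # B1 @ [e]" using W2 by simp
  have lenW: "length W = length A0 + length B0 + 2" using W_x by simp
  consider "n \<le> length A0 + 1" "n \<le> length B0" | "length A0 + 1 < n" | "length B0 < n" by linarith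
  then show ?thesis
  proof cases
    case 1
    then show ?thesis using W(1) W_x by (intro exI[of _ "c # A0"] exI[of _ B0]) (auto simp: n_def)
  next
    case 2
    then have B0: "3 * n \<le> length B0" using lenW W(2) n(3) by linarith
    show ?thesis
    proof (cases "c = x")
      case True
      define P Q where "P = take (length W - (n - 1)) W" and "Q = drop (length W - (n - 1)) W"
      have PQ: "W = P @ Q" "length Q = n - 1" "4 * n \<le> length P"
        using W(2) n by (auto simp: P_def Q_def)
      have "P \<noteq> []" using PQ(3) n(3) by auto
      then obtain P0 where P0: "P = x # P0" using W_x True PQ(1) by (cases P) simp_all
      have "distinct ([] @ x # p')" using distinct_p p(1) by simp
      then have "\<exists>\<sigma>. nonerasing \<sigma> \<and> substitute \<sigma> [] = [] \<and> \<sigma> x = P \<and> substitute \<sigma> p' = Q"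
        by (rule cut_at) (use P0 PQ n p(2) in auto)
      then obtain \<sigma> where \<sigma>: "nonerasing \<sigma>" "\<sigma> x = P" "substitute \<sigma> p' = Q"
        by blast
      have "substitute \<sigma> p = W" using \<sigma>(2,3) p(1) PQ(1) by simp
      then have "substitute \<sigma> W \<in> K" by (rule K_cut[OF _ \<sigma>(1) W(1) W(1)])
      then have "(P @ substitute \<sigma> A0) @ [x] @ (P0 @ substitute \<sigma> B0) \<in> K"
        using W_x True \<sigma>(2) P0 by simp
      moreover have "n \<le> length (P @ substitute \<sigma> A0)" "n \<le> length (P0 @ substitute \<sigma> B0)"
        using PQ P0 n by auto
      ultimately show ?thesis unfolding n_def by blast
    next
      case False
      then have "c \<in> set p'" using setW W1 p(1) by auto
      then obtain p1 p2 where p': "p' = p1 @ c # p2" by (auto simp: in_set_conv_decomp)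
      have len: "length p1 < n" "length p2 < n" using p' p(1) n by auto
      have "length p1 + length p2 + n \<le> length B0" using len B0 n(3) by linarith
      then obtain C1 C2 C3 where C: "B0 = C1 @ C2 @ C3" "length C1 = length p1" "length C3 = length p2"
        "n \<le> length C2"
        using split_ends by meson
      have "distinct (p1 @ c # p2)" using distinct_p p(1) p' by simp
      then have "\<exists>\<tau>. nonerasing \<tau> \<and> substitute \<tau> p1 = C1 \<and> \<tau> c = C2 \<and> substitute \<tau> p2 = C3"
        by (rule cut_at) (use C n in auto)
      then obtain \<tau> where \<tau>: "nonerasing \<tau>" "substitute \<tau> p1 = C1" "\<tau> c = C2" "substitute \<tau> p2 = C3"
        by blast
      define \<sigma> where "\<sigma> = \<tau>(x := c # A0 @ [x])"
      have "substitute \<sigma> p' = substitute \<tau> p'"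
        using distinct_p p(1) by (intro substitute_cong) (auto simp: \<sigma>_def)
      then have sp: "substitute \<sigma> p = W" using \<tau> p' C p(1) W_x by (simp add: \<sigma>_def)
      have ne: "nonerasing \<sigma>" using \<tau>(1) by (simp add: \<sigma>_def)
      have "substitute \<sigma> W \<in> K" by (rule K_cut[OF sp ne W(1) W(1)])
      then have "(C2 @ substitute \<sigma> A0 @ c # A0) @ [x] @ substitute \<sigma> B0 \<in> K"
        using W_x False \<tau>(3) by (simp add: \<sigma>_def)
      moreover have "n \<le> length (substitute \<sigma> B0)"
        using length_substitute_ge[OF ne, of B0] B0 by linarith
      moreover have "n \<le> length (C2 @ substitute \<sigma> A0 @ c # A0)" using C by simp
      ultimately show ?thesis unfolding n_def by blast
    qed
  next
    case 3
    then have A0: "3 * n \<le> length A0" using lenW W(2) n(3) by linarith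
    have dist: "distinct (p'' @ y # [])" using distinct_p p(3) by simp
    show ?thesis
    proof (cases "e = y")
      case True
      define P Q where "P = take (n - 1) W" and "Q = drop (n - 1) W"
      have PQ: "W = P @ Q" "length P = n - 1" "4 * n \<le> length Q"
        using W(2) n by (auto simp: P_def Q_def)
      define R where "R = drop (n - 1) (c # A0)"
      have "n - 1 - length (c # A0) = 0" using A0 by simp
      then have "drop (n - 1) ((c # A0) @ x # B0) = drop (n - 1) (c # A0) @ x # B0"
        by (simp only: drop_append drop_0)
      then have R: "Q = R @ x # B0" unfolding Q_def R_def W_x by (simp only: append_Cons)
      have "length R = length A0 + 1 - (n - 1)" by (simp add: R_def)
      then have Rn: "n \<le> length R" using A0 n(3) by linarith
      have "\<exists>\<sigma>. nonerasing \<sigma> \<and> substitute \<sigma> p'' = P \<and> \<sigma> y = Q \<and> substitute \<sigma> [] = []"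
        by (rule cut_at[OF dist]) (use R PQ(2) n px in auto)
      then obtain \<sigma> where \<sigma>: "nonerasing \<sigma>" "substitute \<sigma> p'' = P" "\<sigma> y = Q"
        by blast
      have "substitute \<sigma> p = W" using \<sigma>(2,3) p(3) PQ(1) by simp
      then have "substitute \<sigma> W \<in> K" by (rule K_cut[OF _ \<sigma>(1) W(1) W(1)])
      then have "(substitute \<sigma> A1 @ R) @ [x] @ (B0 @ substitute \<sigma> B1 @ Q) \<in> K"
        using W_y True \<sigma>(3) R by simp
      moreover have "n \<le> length (substitute \<sigma> A1 @ R)" "n \<le> length (B0 @ substitute \<sigma> B1 @ Q)"
        using Rn PQ n by auto
      ultimately show ?thesis unfolding n_def by blast
    next
      case False
      then have "e \<in> set p''" using setW W2 p(3) by auto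
      then obtain p1 p2 where p'': "p'' = p1 @ e # p2" by (auto simp: in_set_conv_decomp)
      have len: "length p1 + length p2 < n" using p'' p(3) n by auto
      define R D where "R = drop (length A0 + 1 - n) (c # A0)" and "D = take (length A0 + 1 - n) (c # A0)"
      have R: "c # A0 = D @ R" "length R = n" "2 * n \<le> length D"
        unfolding R_def D_def using A0 n(3) by (simp_all only: append_take_drop_id length_take length_drop length_Cons)
      have "length p1 + length p2 + n \<le> length D" using len R(3) n(3) by linarith
      then obtain C1 C2 C3 where C: "D = C1 @ C2 @ C3" "length C1 = length p1" "length C3 = length p2"
        "n \<le> length C2"
        using split_ends by meson
      have "distinct (p1 @ e # p2)" using distinct_p p(3) p'' by simp
      then have "\<exists>\<tau>. nonerasing \<tau> \<and> substitute \<tau> p1 = C1 \<and> \<tau> e = C2 \<and> substitute \<tau> p2 = C3"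
        by (rule cut_at) (use C n in auto)
      then obtain \<tau> where \<tau>: "nonerasing \<tau>" "substitute \<tau> p1 = C1" "\<tau> e = C2" "substitute \<tau> p2 = C3"
        by blast
      define \<sigma> where "\<sigma> = \<tau>(y := R @ x # B0)"
      have "substitute \<sigma> p'' = substitute \<tau> p''"
        using dist by (intro substitute_cong) (auto simp: \<sigma>_def)
      then have "substitute \<sigma> p = D @ R @ x # B0" using \<tau> p'' C p(3) by (simp add: \<sigma>_def)
      then have sp: "substitute \<sigma> p = W" using R(1) W_x by (metis append.assoc append_Cons)
      have ne: "nonerasing \<sigma>" using \<tau>(1) by (simp add: \<sigma>_def)
      have "substitute \<sigma> W \<in> K" by (rule K_cut[OF sp ne W(1) W(1)])
      then have "(substitute \<sigma> A1 @ R) @ [x] @ (B0 @ substitute \<sigma> B1 @ C2) \<in> K"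
        using W_y False \<tau>(3) by (simp add: \<sigma>_def)
      moreover have "n \<le> length (substitute \<sigma> A1 @ R)" "n \<le> length (B0 @ substitute \<sigma> B1 @ C2)"
        using R C by auto
      ultimately show ?thesis unfolding n_def by blast
    qed
  qed
qed

text \<open>Some letter \<open>z\<close> occurs often in a long word of \<open>K\<close>. A word of \<open>K\<close> with \<open>x\<close> in the middle
  can be cut so that \<open>x\<close> lies in the block of \<open>z\<close>; then \<open>x\<close> occurs in the corresponding
  instance of the long word as often as \<open>z\<close> does in the long word.\<close>

lemma many:
  assumes W0: "W0 \<in> K" "length p < length W0"
    and AB: "length p \<le> length A" "length p \<le> length B" "A @ [x] @ B \<in> K"
  shows "\<exists>W\<in>K. N \<le> count_list W x"
proof -
  obtain W where W: "W \<in> K" "length p * N \<le> length W" "length p < length W"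
    using K_long[OF W0] by blast
  have "\<exists>z\<in>set p. N \<le> count_list W z"
  proof (rule ccontr)
    assume "\<not> ?thesis"
    then have less: "count_list W z \<le> N - 1" "0 < N" if "z \<in> set p" for z
      using that by (auto simp: not_le)
    have "length W = (\<Sum>z\<in>set p. count_list W z)"
      using sum_count_set[of W "set p"] W(1) by (simp add: K_def)
    also have "\<dots> \<le> (\<Sum>z\<in>set p. N - 1)" by (intro sum_mono less)
    also have "\<dots> = length p * (N - 1)" using distinct_p by (simp add: distinct_card)
    finally have le: "length W \<le> length p * (N - 1)" .
    have "p \<noteq> []" using le W(3) by auto
    then have "0 < N" "0 < length p" using less(2)[of "hd p"] by auto
    then have "length p * (N - 1) < length p * N" by simp
    then show False using le W(2) by linarith
  qed
  then obtain z where z: "z \<in> set p" "N \<le> count_list W z" by blast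
  then obtain p1 p2 where p: "p = p1 @ z # p2" by (auto simp: in_set_conv_decomp)
  have "\<exists>\<sigma> A2 C1. nonerasing \<sigma> \<and> substitute \<sigma> (p1 @ z # p2) = A @ [x] @ B \<and> \<sigma> z = A2 @ [x] @ C1"
    by (rule cut_around) (use distinct_p p AB in auto)
  then obtain \<sigma> A2 C1 where \<sigma>: "nonerasing \<sigma>" "substitute \<sigma> (p1 @ z # p2) = A @ [x] @ B"
    "\<sigma> z = A2 @ [x] @ C1" by blast
  have "count_list W z \<le> count_list (substitute \<sigma> W) x"
    by (rule count_list_substitute_ge) (simp add: \<sigma>(3) count_list_append)
  moreover have "substitute \<sigma> W \<in> K"
    by (rule K_cut[OF _ \<sigma>(1) AB(3) W(1)]) (simp only: p \<sigma>(2))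
  ultimately show ?thesis using z by (intro bexI[of _ "substitute \<sigma> W"]) auto
qed

text \<open>Cut the given word so that both \<open>v\<close> and the letter \<open>c\<close> lie in the block of \<open>z\<close>, where
  \<open>z\<close> is the first or the last letter of \<open>p\<close>. In the same instance of a word in which \<open>z\<close>
  occurs very often, choose \<open>v\<close> from one such block and \<open>c\<close> from another one far away.\<close>

lemma spread:
  assumes W: "Y @ v @ U \<in> K" "length p \<le> length Y" "length p \<le> length U" and c: "c \<in> set p"
    and p: "p = x # p'" "p' \<noteq> []" "p = p'' @ [y]"
    and manyx: "\<And>N. \<exists>W\<in>K. N \<le> count_list W x" and manyy: "\<And>N. \<exists>W\<in>K. N \<le> count_list W y"
  shows "\<exists>D0 D1 D2. D0 @ v @ D1 @ [c] @ D2 \<in> K \<and> M \<le> length D0 \<and> M \<le> length D1 \<and> M \<le> length D2"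
    and "\<exists>D0 D1 D2. D0 @ [c] @ D1 @ v @ D2 \<in> K \<and> M \<le> length D0 \<and> M \<le> length D1 \<and> M \<le> length D2"
proof -
  define n where "n = length p"
  have n: "length p' = n - 1" "length p'' = n - 1" "n \<ge> 2"
  proof -
    show "length p' = n - 1" using p(1) by (simp add: n_def)
    show "length p'' = n - 1" using p(3) by (simp add: n_def)
    show "n \<ge> 2" using p(1,2) by (cases p') (auto simp: n_def)
  qed
  have px: "p'' \<noteq> []" using n by auto
  define W where "W = Y @ v @ U"
  have lW: "2 * n \<le> length W" using W n by (simp add: W_def n_def)
  have "c \<in> set W" using W(1) c by (simp add: K_def W_def)
  \<comment> \<open>a block of \<open>W\<close> that contains both \<open>v\<close> and \<open>c\<close> and is the image of the first or the
    last letter\<close>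
  have "\<exists>z \<sigma> S1 S2 T1 T2. (z = x \<or> z = y) \<and> nonerasing \<sigma> \<and> substitute \<sigma> p = W
      \<and> \<sigma> z = S1 @ v @ S2 \<and> \<sigma> z = T1 @ [c] @ T2"
  proof (cases "c \<in> set (take (length W - (n - 1)) W)")
    case True
    define P Q where "P = take (length W - (n - 1)) W" and "Q = drop (length W - (n - 1)) W"
    have PQ: "W = P @ Q" "length Q = n - 1" using lW n by (auto simp: P_def Q_def)
    have P: "P = Y @ v @ take (length U - (n - 1)) U"
      using W(3) n by (simp add: P_def W_def n_def)
    obtain T1 T2 where T: "P = T1 @ [c] @ T2"
      using True by (auto simp: P_def in_set_conv_decomp)
    have "P \<noteq> []" using T by simp
    have "distinct ([] @ x # p')" using distinct_p p(1) by simp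
    then have "\<exists>\<sigma>. nonerasing \<sigma> \<and> substitute \<sigma> [] = [] \<and> \<sigma> x = P \<and> substitute \<sigma> p' = Q"
      by (rule cut_at) (use \<open>P \<noteq> []\<close> PQ(2) n p(2) in auto)
    then obtain \<sigma> where \<sigma>: "nonerasing \<sigma>" "\<sigma> x = P" "substitute \<sigma> p' = Q"
      by blast
    have "substitute \<sigma> p = W" using \<sigma>(2,3) p(1) PQ(1) by simp
    then show ?thesis using \<sigma>(1,2) P T by blast
  next
    case False
    define P Q where "P = take (n - 1) W" and "Q = drop (n - 1) W"
    have PQ: "W = P @ Q" "length P = n - 1" using lW n by (auto simp: P_def Q_def)
    have "set W = set (take (length W - (n - 1)) W) \<union> set (drop (length W - (n - 1)) W)"
      by (metis append_take_drop_id set_append)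
    then have cW: "c \<in> set (drop (length W - (n - 1)) W)" using False \<open>c \<in> set W\<close> by blast
    have "n - 1 \<le> length W - (n - 1)" using lW n(3) by linarith
    then have "set (drop (length W - (n - 1)) W) \<subseteq> set (drop (n - 1) W)"
      by (rule set_drop_subset_set_drop)
    then have cQ: "c \<in> set Q" using cW by (auto simp: Q_def)
    have Q: "Q = drop (n - 1) Y @ v @ U"
      using W(2) n by (simp add: Q_def W_def n_def)
    obtain T1 T2 where T: "Q = T1 @ [c] @ T2"
      using cQ by (auto simp: in_set_conv_decomp)
    have "Q \<noteq> []" using T by simp
    have "distinct (p'' @ y # [])" using distinct_p p(3) by simp
    then have "\<exists>\<sigma>. nonerasing \<sigma> \<and> substitute \<sigma> p'' = P \<and> \<sigma> y = Q \<and> substitute \<sigma> [] = []"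
      by (rule cut_at) (use \<open>Q \<noteq> []\<close> PQ(2) n px in auto)
    then obtain \<sigma> where \<sigma>: "nonerasing \<sigma>" "substitute \<sigma> p'' = P" "\<sigma> y = Q"
      by blast
    have "substitute \<sigma> p = W" using \<sigma>(2,3) p(3) PQ(1) by simp
    then show ?thesis using \<sigma>(1,3) Q T by blast
  qed
  then obtain z \<sigma> S1 S2 T1 T2 where z: "z = x \<or> z = y" and \<sigma>: "nonerasing \<sigma>" "substitute \<sigma> p = W"
    and S: "\<sigma> z = S1 @ v @ S2" and T: "\<sigma> z = T1 @ [c] @ T2" by blast
  obtain R where R: "R \<in> K" "3 * M + 2 \<le> count_list R z"
    using z manyx[of "3 * M + 2"] manyy[of "3 * M + 2"] by blast
  have less: "M < count_list R z" using R(2) by linarith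
  then obtain A R' where A: "R = A @ z # R'" "count_list A z = M" using split_at_count[OF less] by blast
  then have R': "2 * M + 1 \<le> count_list R' z" using R(2) by (simp add: count_list_append)
  have less: "M < count_list R' z" using R' by linarith
  then obtain B C where B: "R' = B @ z # C" "count_list B z = M" using split_at_count[OF less] by blast
  then have C: "M \<le> count_list C z" using R' by (simp add: count_list_append)
  have len: "count_list D z \<le> length (substitute \<sigma> D)" for D
    using count_le_length[of D z] length_substitute_ge[OF \<sigma>(1), of D] by linarith
  have sub: "substitute \<sigma> A @ \<sigma> z @ substitute \<sigma> B @ \<sigma> z @ substitute \<sigma> C \<in> K"
    using K_cut[OF \<sigma>(2,1) _ R(1)] W(1) A(1) B(1) by (simp add: W_def)
  have M: "M \<le> length (substitute \<sigma> A)" "M \<le> length (substitute \<sigma> B)" "M \<le> length (substitute \<sigma> C)"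
    using len[of A] len[of B] len[of C] A B C by simp_all
  have "substitute \<sigma> A @ (S1 @ v @ S2) @ substitute \<sigma> B @ (T1 @ [c] @ T2) @ substitute \<sigma> C \<in> K"
    using sub by (simp only: S[symmetric] T[symmetric])
  then have "(substitute \<sigma> A @ S1) @ v @ (S2 @ substitute \<sigma> B @ T1) @ [c] @ (T2 @ substitute \<sigma> C) \<in> K"
    by (simp only: append.assoc)
  then show "\<exists>D0 D1 D2. D0 @ v @ D1 @ [c] @ D2 \<in> K \<and> M \<le> length D0 \<and> M \<le> length D1 \<and> M \<le> length D2"
    using M by (intro exI conjI) (assumption, simp_all)
  have "substitute \<sigma> A @ (T1 @ [c] @ T2) @ substitute \<sigma> B @ (S1 @ v @ S2) @ substitute \<sigma> C \<in> K"
    using sub by (simp only: S[symmetric] T[symmetric])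
  then have "(substitute \<sigma> A @ T1) @ [c] @ (T2 @ substitute \<sigma> B @ S1) @ v @ (S2 @ substitute \<sigma> C) \<in> K"
    by (simp only: append.assoc)
  then show "\<exists>D0 D1 D2. D0 @ [c] @ D1 @ v @ D2 \<in> K \<and> M \<le> length D0 \<and> M \<le> length D1 \<and> M \<le> length D2"
    using M by (intro exI conjI) (assumption, simp_all)
qed

text \<open>\<open>W\<close> contains letters \<open>a b\<close> in succession that are not in succession in \<open>p\<close>. Hence the
  blocks of \<open>a\<close> and \<open>b\<close> in some word of \<open>K\<close> need not be adjacent in this order, and the
  word can be cut so that the block of \<open>a\<close> ends with \<open>v\<close> and that of \<open>b\<close> begins with \<open>c\<close>.
  The instance of \<open>W\<close> then contains \<open>v c\<close>. The cases are those of \<open>a = b\<close>, of \<open>b\<close> before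
  \<open>a\<close> in \<open>p\<close>, and of \<open>a\<close> before \<open>b\<close> with other letters in between.\<close>

lemma extend:
  assumes W: "W \<in> K" "length p < length W"
    and sp1: "\<And>M. \<exists>D0 D1 D2. D0 @ v @ D1 @ [c] @ D2 \<in> K \<and> M \<le> length D0 \<and> M \<le> length D1 \<and> M \<le> length D2"
    and sp2: "\<And>M. \<exists>D0 D1 D2. D0 @ [c] @ D1 @ v @ D2 \<in> K \<and> M \<le> length D0 \<and> M \<le> length D1 \<and> M \<le> length D2"
  shows "\<exists>Y U. Y @ (v @ [c]) @ U \<in> K \<and> length p \<le> length Y \<and> length p \<le> length U"
proof -
  define n where "n = length p"
  have "\<not> (\<forall>A a b B. W = A @ a # b # B \<longrightarrow> (\<exists>t. t + 1 < length p \<and> a = p ! t \<and> b = p ! (t + 1)))"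
  proof
    assume "\<forall>A a b B. W = A @ a # b # B \<longrightarrow> (\<exists>t. t + 1 < length p \<and> a = p ! t \<and> b = p ! (t + 1))"
    moreover have "W \<noteq> []" using W(2) by auto
    moreover have "set W \<subseteq> set p" using W(1) by (simp add: K_def)
    ultimately have "length W \<le> length p"
      using successive_letters_short[OF distinct_p, of W] by blast
    then show False using W(2) by simp
  qed
  then obtain A a b B where AB: "W = A @ a # b # B"
    and nosucc: "\<not> (\<exists>t. t + 1 < length p \<and> a = p ! t \<and> b = p ! (t + 1))" by blast
  have "a \<in> set p" "b \<in> set p" using W(1) AB by (auto simp: K_def)
  then obtain s t where st: "s < n" "p ! s = a" "t < n" "p ! t = b"
    by (auto simp: in_set_conv_nth n_def)
  have ts: "t \<noteq> s + 1" using nosucc st by (auto simp: n_def)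
  consider "t = s" | "t < s" | "s < t" "s + 1 < t" using ts by linarith
  then show ?thesis
  proof cases
    case 1
    then have ab: "a = b" using st by simp
    obtain p1 p2 where p: "p = p1 @ a # p2" using \<open>a \<in> set p\<close> by (auto simp: in_set_conv_decomp)
    obtain D0 D1 D2 where D: "D0 @ [c] @ D1 @ v @ D2 \<in> K" "n \<le> length D0" "n \<le> length D1" "n \<le> length D2"
      using sp2[of n] by blast
    have "0 + length p1 + 0 \<le> length D0" "length p2 + 0 + 0 \<le> length D2" using D p by (simp_all add: n_def)
    then obtain G1 G2 P1 P2 H1 H2 where
      G: "D0 = G1 @ G2 @ P1" "length P1 = length p1" and H: "D2 = P2 @ H1 @ H2" "length P2 = length p2"
      using split_ends by meson
    have "\<exists>\<sigma>. nonerasing \<sigma> \<and> substitute \<sigma> p1 = P1 \<and> \<sigma> a = [c] @ D1 @ v \<and> substitute \<sigma> p2 = P2"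
      by (rule cut_at) (use distinct_p p G H in auto)
    then obtain \<sigma> where \<sigma>: "nonerasing \<sigma>" "substitute \<sigma> p1 = P1" "\<sigma> a = [c] @ D1 @ v" "substitute \<sigma> p2 = P2"
      by blast
    have "substitute \<sigma> p = P1 @ ([c] @ D1 @ v) @ P2" using \<sigma>(2-4) by (simp add: p)
    then have "(G1 @ G2) @ substitute \<sigma> p @ (H1 @ H2) \<in> K" using D(1) G(1) H(1) by simp
    from K_window[OF this \<sigma>(1) W(1)]
    have "(G1 @ G2 @ substitute \<sigma> A @ [c] @ D1) @ (v @ [c]) @ (D1 @ v @ substitute \<sigma> B @ H1 @ H2) \<in> K"
      using \<sigma>(3) ab by (simp add: AB)
    moreover have "n \<le> length (G1 @ G2 @ substitute \<sigma> A @ [c] @ D1)"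
      "n \<le> length (D1 @ v @ substitute \<sigma> B @ H1 @ H2)" using D(3) by simp_all
    ultimately show ?thesis unfolding n_def by blast
  next
    case 2
    obtain p1 p2 p3 where p: "p = p1 @ b # p2 @ a # p3"
      using split_two_positions[OF 2, of p] st(1) unfolding n_def st(2,4) by blast
    obtain D0 D1 D2 where D: "D0 @ [c] @ D1 @ v @ D2 \<in> K" "3 * n \<le> length D0" "3 * n \<le> length D1" "3 * n \<le> length D2"
      using sp2[of "3 * n"] by blast
    have len: "length p1 + length p2 + length p3 + 2 = n" using p by (simp add: n_def)
    have "0 + length p1 + 0 \<le> length D0" "length p3 + 0 + 0 \<le> length D2" "length p2 + 2 * n \<le> length D1"
      using D len by linarith+
    then obtain G1 G2 P1 P3 H1 H2 E1 P2 E3 where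
      G: "D0 = G1 @ G2 @ P1" "length P1 = length p1" and H: "D2 = P3 @ H1 @ H2" "length P3 = length p3"
      and E: "D1 = E1 @ P2 @ E3" "n \<le> length E1" "length P2 = length p2" "n \<le> length E3"
      using split_ends split_middle by meson
    \<comment> \<open>the image of \<open>b\<close> starts with \<open>c\<close>, and that of \<open>a\<close> ends with \<open>v\<close>\<close>
    have "\<exists>\<sigma>. nonerasing \<sigma> \<and> substitute \<sigma> (p1 @ b # p2 @ a # p3) = P1 @ ([c] @ E1) @ P2 @ (E3 @ v) @ P3
      \<and> \<sigma> b = [c] @ E1 \<and> \<sigma> a = E3 @ v"
      by (rule cut_at_two) (use distinct_p p G(2) H(2) E len in auto)
    then obtain \<sigma> where \<sigma>: "nonerasing \<sigma>" "substitute \<sigma> p = P1 @ ([c] @ E1) @ P2 @ (E3 @ v) @ P3"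
      "\<sigma> b = [c] @ E1" "\<sigma> a = E3 @ v" unfolding p[symmetric] by blast
    have "(G1 @ G2) @ substitute \<sigma> p @ (H1 @ H2) \<in> K" using D(1) G(1) H(1) E(1) \<sigma>(2) by simp
    from K_window[OF this \<sigma>(1) W(1)]
    have "(G1 @ G2 @ substitute \<sigma> A @ E3) @ (v @ [c]) @ (E1 @ substitute \<sigma> B @ H1 @ H2) \<in> K"
      using \<sigma>(3,4) by (simp add: AB)
    moreover have "n \<le> length (G1 @ G2 @ substitute \<sigma> A @ E3)"
      "n \<le> length (E1 @ substitute \<sigma> B @ H1 @ H2)" using E by simp_all
    ultimately show ?thesis unfolding n_def by blast
  next
    case 3
    obtain p1 p2 p3 where p: "p = p1 @ a # p2 @ b # p3" and p2: "length p2 = t - s - 1"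
      using split_two_positions[OF 3(1), of p] st(3) unfolding n_def st(2,4) by blast
    obtain D0 D1 D2 where D: "D0 @ v @ D1 @ [c] @ D2 \<in> K" "3 * n \<le> length D0" "3 * n \<le> length D1" "3 * n \<le> length D2"
      using sp1[of "3 * n"] by blast
    have len: "length p1 + length p2 + length p3 + 2 = n" using p by (simp add: n_def)
    have "length p1 + 0 + n \<le> length D0" "0 + length p3 + n \<le> length D2"
      using D len by linarith+
    then obtain P1 E0 E1 F0 E3 P3 where
      G: "D0 = P1 @ E0 @ E1" "length P1 = length p1" "length E1 = 0" "n \<le> length E0"
      and H: "D2 = F0 @ E3 @ P3" "length F0 = 0" "length P3 = length p3" "n \<le> length E3"
      using split_ends by meson
    have D1: "length p2 \<le> length D1" "p2 \<noteq> []" using D(3) len p2 3 by auto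
    have "\<exists>\<sigma>. nonerasing \<sigma> \<and> substitute \<sigma> (p1 @ a # p2 @ b # p3) = P1 @ (E0 @ v) @ D1 @ ([c] @ E3) @ P3
      \<and> \<sigma> a = E0 @ v \<and> \<sigma> b = [c] @ E3"
      by (rule cut_at_two) (use distinct_p p G H D1 len in auto)
    then obtain \<sigma> where \<sigma>: "nonerasing \<sigma>" "substitute \<sigma> p = P1 @ (E0 @ v) @ D1 @ ([c] @ E3) @ P3"
      "\<sigma> a = E0 @ v" "\<sigma> b = [c] @ E3" unfolding p[symmetric] by blast
    have "[] @ substitute \<sigma> p @ [] \<in> K" using D(1) G H \<sigma>(2) by simp
    from K_window[OF this \<sigma>(1) W(1)]
    have "(substitute \<sigma> A @ E0) @ (v @ [c]) @ (E3 @ substitute \<sigma> B) \<in> K"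
      using \<sigma>(3,4) by (simp add: AB)
    moreover have "n \<le> length (substitute \<sigma> A @ E0)" "n \<le> length (E3 @ substitute \<sigma> B)"
      using G H by simp_all
    ultimately show ?thesis unfolding n_def by blast
  qed
qed

end

definition reversed :: "(word \<times> word) set \<Rightarrow> (word \<times> word) set" where
  "reversed \<beta> = {(u, v). (rev u, rev v) \<in> \<beta>}"

lemma ficong_reversed:
  assumes "ficong \<beta>"
  shows "ficong (reversed \<beta>)"
proof -
  interpret ficong \<beta> by fact
  show ?thesis
  proof
    show "(a @ u @ b, a @ v @ b) \<in> reversed \<beta>" if "(u, v) \<in> reversed \<beta>" for u v a b
      using that ctx[of "rev u" "rev v" "rev b" "rev a"] by (simp add: reversed_def)
    show "(substitute \<sigma> u, substitute \<sigma> v) \<in> reversed \<beta>"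
      if "(u, v) \<in> reversed \<beta>" "nonerasing \<sigma>" for u v \<sigma>
      using that sub[of "rev u" "rev v" "\<lambda>x. rev (\<sigma> x)"] by (simp add: reversed_def substitute_rev)
    show "v = []" if "([], v) \<in> reversed \<beta>" for v
      using that Nil[of "rev v"] by (simp add: reversed_def)
  qed (auto simp: reversed_def intro: sym trans)
qed

context linear_word
begin

lemma reversed_linear_word: "linear_word (reversed \<beta>) (rev p)"
  using ficong_reversed[OF ficong_axioms] distinct_p
  by (simp add: linear_word_def linear_word_axioms_def)

lemma reversed_K: "W \<in> linear_word.K (reversed \<beta>) (rev p) \<longleftrightarrow> rev W \<in> K"
  unfolding linear_word.K_def[OF reversed_linear_word] K_def by (simp add: reversed_def)

lemma middle_last:
  assumes p: "p = x # p'" "p' \<noteq> []" "p = p'' @ [y]"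
    and noI: "\<And>V. x # V \<in> K \<Longrightarrow> length p' < length V \<Longrightarrow> x \<in> set V"
    and noII: "\<And>V. V @ [y] \<in> K \<Longrightarrow> length p'' < length V \<Longrightarrow> y \<in> set V"
    and W0: "W0 \<in> K" "length p < length W0"
  shows "\<exists>A B. length p \<le> length A \<and> length p \<le> length B \<and> A @ [y] @ B \<in> K"
proof -
  interpret R: linear_word "reversed \<beta>" "rev p" by (rule reversed_linear_word)
  have "length p' = length p''" using p by (metis length_Cons length_append_singleton nat.inject)
  then have "p'' \<noteq> []" using p(2) by auto
  have "\<exists>A B. length (rev p) \<le> length A \<and> length (rev p) \<le> length B \<and> A @ [y] @ B \<in> R.K"
  proof (rule R.middle_first)
    show "rev p = y # rev p''" using p(3) by simp
    show "rev p'' \<noteq> []" using \<open>p'' \<noteq> []\<close> by simp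
    show "rev p = rev p' @ [x]" using p(1) by simp
    show "y \<in> set V" if "y # V \<in> R.K" "length (rev p'') < length V" for V
      using noII[of "rev V"] that by (simp add: reversed_K)
    show "x \<in> set V" if "V @ [x] \<in> R.K" "length (rev p') < length V" for V
      using noI[of "rev V"] that by (simp add: reversed_K)
    show "rev W0 \<in> R.K" "length (rev p) < length (rev W0)" using W0 by (simp_all add: reversed_K)
  qed
  then obtain A B where "length p \<le> length A" "length p \<le> length B" "rev B @ [y] @ rev A \<in> K"
    by (auto simp: reversed_K)
  then show ?thesis by (intro exI[of _ "rev B"] exI[of _ "rev A"]) simp
qed

text \<open>The letters of \<open>p\<close> are assembled one after the other, with \<open>spread\<close> providing what
  \<open>extend\<close> needs.\<close>

lemma product_inside:
  assumes p: "p = x # p'" "p' \<noteq> []" "p = p'' @ [y]"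
    and noI: "\<And>V. x # V \<in> K \<Longrightarrow> length p' < length V \<Longrightarrow> x \<in> set V"
    and noII: "\<And>V. V @ [y] \<in> K \<Longrightarrow> length p'' < length V \<Longrightarrow> y \<in> set V"
    and W0: "W0 \<in> K" "length p < length W0"
  shows "\<exists>Y U. Y \<noteq> [] \<and> U \<noteq> [] \<and> Y @ p @ U \<in> K"
proof -
  obtain A B where AB: "length p \<le> length A" "length p \<le> length B" "A @ [x] @ B \<in> K"
    using middle_first[OF assms] by blast
  obtain A' B' where AB': "length p \<le> length A'" "length p \<le> length B'" "A' @ [y] @ B' \<in> K"
    using middle_last[OF assms] by blast
  note manyx = many[OF W0 AB] and manyy = many[OF W0 AB']
  have "\<exists>Y U. Y @ take (Suc i) p @ U \<in> K \<and> length p \<le> length Y \<and> length p \<le> length U"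
    if "i < length p" for i
    using that
  proof (induction i)
    case 0
    then show ?case using AB p(1) by auto
  next
    case (Suc i)
    then obtain Y U where YU: "Y @ take (Suc i) p @ U \<in> K" "length p \<le> length Y" "length p \<le> length U"
      by auto
    have c: "p ! Suc i \<in> set p" using Suc.prems by simp
    note sp = spread[OF YU c p manyx manyy]
    have "\<exists>Y U. Y @ (take (Suc i) p @ [p ! Suc i]) @ U \<in> K \<and> length p \<le> length Y \<and> length p \<le> length U"
      by (rule extend[OF W0 sp])
    then show ?case using take_Suc_conv_app_nth[OF Suc.prems] by simp
  qed
  from this[of "length p - 1"] obtain Y U where YU: "Y @ p @ U \<in> K" "length p \<le> length Y" "length p \<le> length U"
    using p(1) by auto
  have "length p > 0" using p(1) by simp
  then have "Y \<noteq> []" "U \<noteq> []" using YU(2,3) by auto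
  then show ?thesis using YU(1) by blast
qed

lemma trichotomy:
  assumes W0: "W0 \<in> K" "length p < length W0"
  shows "(\<exists>x p' V. p = x # p' \<and> x # V \<in> K \<and> length p' < length V \<and> x \<notin> set V) \<or>
    (\<exists>p'' y V. p = p'' @ [y] \<and> V @ [y] \<in> K \<and> length p'' < length V \<and> y \<notin> set V) \<or>
    (\<exists>Y U. Y \<noteq> [] \<and> U \<noteq> [] \<and> Y @ p @ U \<in> K)"
proof -
  have "p \<noteq> []"
  proof
    assume "p = []"
    moreover have "set W0 = set p" using W0(1) by (simp add: K_def)
    ultimately show False using W0(2) by simp
  qed
  then obtain x p' where p: "p = x # p'" by (cases p) auto
  show ?thesis
  proof (cases "p' = []")
    case True
    obtain W where W: "W \<in> K" "3 \<le> length W" using K_long[OF W0, of 3] by blast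
    have "set W = {x}" using K_set[OF W(1)] p True by simp
    then have "W = replicate (length W) x" by (metis replicate_eqI singletonD)
    also have "length W = Suc (Suc (Suc (length W - 3)))" using W(2) by simp
    finally have "W = [x] @ p @ replicate (Suc (length W - 3)) x" using p True by simp
    then show ?thesis using W(1) by (metis list.distinct(1) replicate_Suc)
  next
    case False
    obtain p'' y where py: "p = p'' @ [y]" using \<open>p \<noteq> []\<close> by (metis rev_exhaust)
    show ?thesis
      using product_inside[OF p False py _ _ W0] p py by blast
  qed
qed

text \<open>Iterating \<open>p \<approx> Y p U\<close> gives \<open>p \<approx> Y\<^sup>k p U\<^sup>k\<close>, and the lengths
  of the two sides of \<open>p \<approx> Y p U\<close> show that \<open>Y\<^sup>k\<close> is related to \<open>Y\<^sup>k\<close>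
  times another power of \<open>Y\<close>; this power is absorbed by \<open>p\<close>. On the right \<open>U\<close> plays the
  same part.\<close>

lemma both_sided:
  assumes YU: "Y \<noteq> []" "U \<noteq> []" "Y @ p @ U \<in> K"
  shows "(\<exists>g. g \<noteq> [] \<and> (p, g @ p) \<in> \<beta>) \<and> (\<exists>g. g \<noteq> [] \<and> (p, p @ g) \<in> \<beta>)"
proof -
  have pump: "(p, word_power Y n @ p @ word_power U n) \<in> \<beta>" for n
  proof (induction n)
    case (Suc n)
    have "(p, Y @ p @ U) \<in> \<beta>" using YU(3) by (simp add: K_def)
    then have "(word_power Y n @ p @ word_power U n, word_power Y n @ (Y @ p @ U) @ word_power U n) \<in> \<beta>"
      by (rule ctx)
    moreover have "word_power Y n @ (Y @ p @ U) @ word_power U n = word_power Y (Suc n) @ p @ word_power U (Suc n)"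
      by (simp only: word_power_Suc_right append.assoc) (simp flip: word_power_Suc_right)
    ultimately show ?case using Suc trans by metis
  qed simp
  define k d where "k = length p" and "d = length Y + length U"
  have per: "(word_power t k, word_power t (k + d)) \<in> \<beta>" for t
  proof -
    have "(word_power t (length p), word_power t (length (Y @ p @ U))) \<in> \<beta>"
      using YU(3) by (intro power_of_length) (simp add: K_def)
    moreover have "length (Y @ p @ U) = k + d" by (simp add: k_def d_def)
    ultimately show ?thesis by (simp only: k_def[symmetric])
  qed
  have dk: "word_power t (k + d) = word_power t d @ word_power t k" "word_power t (k + d) = word_power t k @ word_power t d" for t
    by (metis add.commute word_power_add) (rule word_power_add)
  have d: "d \<noteq> 0" using YU by (simp add: d_def)
  have "(p, word_power Y d @ p) \<in> \<beta>"
  proof -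
    have "(word_power Y k @ p @ word_power U k, word_power Y (k + d) @ p @ word_power U k) \<in> \<beta>"
      using right[OF per] by blast
    also have "word_power Y (k + d) @ p @ word_power U k = word_power Y d @ (word_power Y k @ p @ word_power U k)"
      by (simp only: dk(1) append.assoc)
    also have "(\<dots>, word_power Y d @ p) \<in> \<beta>"
      by (rule left[OF sym[OF pump]])
    finally show ?thesis using trans[OF pump] by blast
  qed
  moreover have "(p, p @ word_power U d) \<in> \<beta>"
  proof -
    have "(word_power Y k @ p @ word_power U k, word_power Y k @ p @ word_power U (k + d)) \<in> \<beta>"
      using left[OF left[OF per]] by blast
    also have "word_power Y k @ p @ word_power U (k + d) = (word_power Y k @ p @ word_power U k) @ word_power U d"
      by (simp only: dk(2) append.assoc)
    also have "(\<dots>, p @ word_power U d) \<in> \<beta>"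
      by (rule right[OF sym[OF pump]])
    finally show ?thesis using trans[OF pump] by blast
  qed
  moreover have "word_power Y d \<noteq> []" "word_power U d \<noteq> []" using YU d by (simp_all add: word_power_eq_Nil)
  ultimately show ?thesis by blast
qed

end

text \<open>The pairs that become related when multiplied on the right by any word. By full
  invariance it is enough to multiply by one letter that does not occur in them
  (\<open>right_quotientI\<close>), so the quotient removes the last letter of \<open>p\<close> when that letter
  splits off.\<close>

definition right_quotient :: "(word \<times> word) set \<Rightarrow> (word \<times> word) set" where
  "right_quotient \<beta> = {(u, v). (u = [] \<longleftrightarrow> v = []) \<and> (\<forall>z. z \<noteq> [] \<longrightarrow> (u @ z, v @ z) \<in> \<beta>)}"

lemma ficong_right_quotient:
  assumes "ficong \<beta>"
  shows "ficong (right_quotient \<beta>)"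
proof -
  interpret ficong \<beta> by fact
  show ?thesis
  proof
    show "(a @ u @ b, a @ v @ b) \<in> right_quotient \<beta>" if uv: "(u, v) \<in> right_quotient \<beta>" for u v a b
    proof -
      have "(a @ u @ b @ z, a @ v @ b @ z) \<in> \<beta>" if "z \<noteq> []" for z
        using uv that left[of "u @ b @ z" "v @ b @ z" a] by (simp add: right_quotient_def)
      then show ?thesis using uv by (auto simp: right_quotient_def)
    qed
    show "(substitute \<sigma> u, substitute \<sigma> v) \<in> right_quotient \<beta>"
      if uv: "(u, v) \<in> right_quotient \<beta>" and \<sigma>: "nonerasing \<sigma>" for u v \<sigma>
    proof -
      have "(substitute \<sigma> u @ z, substitute \<sigma> v @ z) \<in> \<beta>" if z: "z \<noteq> []" for z
      proof -
        obtain f where f: "f \<notin> set u \<union> set v"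
          using ex_new_if_finite[of "set u \<union> set v"] by auto
        have "(u @ [f], v @ [f]) \<in> \<beta>" using uv by (simp add: right_quotient_def)
        moreover have "nonerasing (\<sigma>(f := z))" using \<sigma> z by simp
        ultimately have *: "(substitute (\<sigma>(f := z)) (u @ [f]), substitute (\<sigma>(f := z)) (v @ [f])) \<in> \<beta>"
          by (rule sub)
        have "f \<notin> set u" "f \<notin> set v" using f by auto
        with * show ?thesis
          by (simp only: substitute_simps substitute_upd_notin fun_upd_same append_Nil2 not_False_eq_True)
      qed
      then show ?thesis using uv \<sigma> by (auto simp: right_quotient_def)
    qed
  qed (auto simp: right_quotient_def intro: sym trans)
qed

lemma right_quotientD: "(u, v) \<in> right_quotient \<beta> \<Longrightarrow> z \<noteq> [] \<Longrightarrow> (u @ z, v @ z) \<in> \<beta>"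
  by (simp add: right_quotient_def)

lemma right_quotientI:
  assumes "ficong \<beta>" "(u @ [y], v @ [y]) \<in> \<beta>" "y \<notin> set u" "y \<notin> set v" "u = [] \<longleftrightarrow> v = []"
  shows "(u, v) \<in> right_quotient \<beta>"
proof -
  interpret ficong \<beta> by fact
  have "(u @ z, v @ z) \<in> \<beta>" if "z \<noteq> []" for z
  proof -
    have "nonerasing (replace y z)" using that by simp
    then have "(substitute (replace y z) (u @ [y]), substitute (replace y z) (v @ [y])) \<in> \<beta>"
      by (rule sub[OF assms(2)])
    then show ?thesis
      by (simp only: substitute_simps substitute_upd_notin[OF assms(3)] substitute_upd_notin[OF assms(4)]
          substitute_id fun_upd_same append_Nil2)
  qed
  then show ?thesis using assms(5) by (simp add: right_quotient_def)
qed

definition peels_left :: "(word \<times> word) set \<Rightarrow> word \<Rightarrow> bool" where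
  "peels_left \<beta> p \<longleftrightarrow>
     (\<exists>x p' V. p = x # p' \<and> (p, x # V) \<in> \<beta> \<and> set V = set p' \<and> length p' < length V)"

definition peels_right :: "(word \<times> word) set \<Rightarrow> word \<Rightarrow> bool" where
  "peels_right \<beta> p \<longleftrightarrow>
     (\<exists>p' y V. p = p' @ [y] \<and> (p, V @ [y]) \<in> \<beta> \<and> set V = set p' \<and> length p' < length V)"

text \<open>By \<open>trichotomy\<close>, the first letter splits off, or \<open>p\<close> is absorbed on both sides, or else
  the last letter splits off. In the last case the claim for the shorter word and the
  right quotient can be multiplied by the last letter again.\<close>

lemma left_absorbs_or_peels:
  assumes "ficong \<beta>" "distinct p" "(p, W) \<in> \<beta>" "set W = set p" "length p < length W"
  shows "(\<exists>g. g \<noteq> [] \<and> (p, g @ p) \<in> \<beta>) \<or> peels_left \<beta> p"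
  using assms
proof (induction "length p" arbitrary: \<beta> p W rule: less_induct)
  case less
  interpret linear_word \<beta> p
    using less.prems by (simp add: linear_word_def linear_word_axioms_def)
  have WK: "W \<in> K" using less.prems by (simp add: K_def)
  consider (I) x p' V where "p = x # p'" "x # V \<in> K" "length p' < length V" "x \<notin> set V"
    | (II) p'' y V where "p = p'' @ [y]" "V @ [y] \<in> K" "length p'' < length V" "y \<notin> set V"
    | (III) Y U where "Y \<noteq> []" "U \<noteq> []" "Y @ p @ U \<in> K"
    using trichotomy[OF WK less.prems(5)] by blast
  then show ?case
  proof cases
    case I
    have "insert x (set V) = insert x (set p')" using K_set[OF I(2)] I(1) by simp
    moreover have "x \<notin> set p'" using less.prems(2) I(1) by simp
    ultimately have "set V = set p'" using I(4) by (metis insert_eq_iff)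
    then have "peels_left \<beta> p" using I(1,3) K_related[OF I(2)] unfolding peels_left_def by blast
    then show ?thesis ..
  next
    case II
    have y: "y \<notin> set p''" using less.prems(2) II(1) by simp
    have "insert y (set V) = insert y (set p'')" using K_set[OF II(2)] II(1) by simp
    then have V: "set V = set p''" using II(4) y by (metis insert_eq_iff)
    have "(p'' @ [y], V @ [y]) \<in> \<beta>" using K_related[OF II(2)] II(1) by simp
    then have "(p'', V) \<in> right_quotient \<beta>"
      using right_quotientI[OF ficong_axioms _ y II(4)] V by fastforce
    moreover have "distinct p''" using less.prems(2) II(1) by simp
    moreover have "length p'' < length p" using II(1) by simp
    ultimately consider (L) g where "g \<noteq> []" "(p'', g @ p'') \<in> right_quotient \<beta>"
      | (P) "peels_left (right_quotient \<beta>) p''"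
      using less.hyps[of p'' "right_quotient \<beta>" V] ficong_right_quotient[OF ficong_axioms] V II(3) by blast
    then show ?thesis
    proof cases
      case L
      then have "(p'' @ [y], (g @ p'') @ [y]) \<in> \<beta>" by (intro right_quotientD) auto
      then show ?thesis using L(1) II(1) by auto
    next
      case P
      then obtain x p1 V1 where P: "p'' = x # p1" "(p'', x # V1) \<in> right_quotient \<beta>" "set V1 = set p1"
        "length p1 < length V1" unfolding peels_left_def by blast
      have "(p'' @ [y], (x # V1) @ [y]) \<in> \<beta>" using P(2) by (intro right_quotientD) auto
      then have "(p, x # (V1 @ [y])) \<in> \<beta>" using II(1) by simp
      moreover have "p = x # (p1 @ [y])" using II(1) P(1) by simp
      moreover have "set (V1 @ [y]) = set (p1 @ [y])" "length (p1 @ [y]) < length (V1 @ [y])"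
        using P(3,4) by simp_all
      ultimately have "peels_left \<beta> p" unfolding peels_left_def by blast
      then show ?thesis ..
    qed
  next
    case III
    then show ?thesis using both_sided by blast
  qed
qed

lemma peels_left_reversed: "peels_left (reversed \<beta>) (rev p) \<Longrightarrow> peels_right \<beta> p"
proof -
  assume "peels_left (reversed \<beta>) (rev p)"
  then obtain x p' V where P: "rev p = x # p'" "(rev p, x # V) \<in> reversed \<beta>" "set V = set p'"
    "length p' < length V" unfolding peels_left_def by blast
  have "p = rev p' @ [x]" using P(1) by (metis rev.simps(2) rev_rev_ident)
  moreover have "(p, rev V @ [x]) \<in> \<beta>" using P(2) by (simp add: reversed_def)
  moreover have "set (rev V) = set (rev p')" "length (rev p') < length (rev V)" using P by simp_all
  ultimately show ?thesis unfolding peels_right_def by blast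
qed

lemma right_absorbs_or_peels:
  assumes "ficong \<beta>" "distinct p" "(p, W) \<in> \<beta>" "set W = set p" "length p < length W"
  shows "(\<exists>g. g \<noteq> [] \<and> (p, p @ g) \<in> \<beta>) \<or> peels_right \<beta> p"
proof -
  have "(\<exists>g. g \<noteq> [] \<and> (rev p, g @ rev p) \<in> reversed \<beta>) \<or> peels_left (reversed \<beta>) (rev p)"
    by (rule left_absorbs_or_peels[of _ _ "rev W"]) (use assms ficong_reversed in \<open>auto simp: reversed_def\<close>)
  then show ?thesis
  proof
    assume "\<exists>g. g \<noteq> [] \<and> (rev p, g @ rev p) \<in> reversed \<beta>"
    then obtain g where "g \<noteq> []" "(p, p @ rev g) \<in> \<beta>" by (auto simp: reversed_def)
    then show ?thesis by (metis rev_is_Nil_conv)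
  qed (use peels_left_reversed in blast)
qed

section \<open>Two congruences that agree on an ideal\<close>

text \<open>What the right quotient and its mirror image have in common, where \<open>f x\<close> is the
  multiplication by the letter \<open>x\<close> on the respective side.\<close>

definition letter_quotient ::
    "(nat \<Rightarrow> word \<Rightarrow> word) \<Rightarrow> (word \<times> word) set \<Rightarrow> (word \<times> word) set \<Rightarrow> bool" where
  "letter_quotient f \<beta> \<beta>' \<longleftrightarrow> ficong \<beta>' \<and>
     (\<forall>u v x. x \<notin> set u \<longrightarrow> x \<notin> set v \<longrightarrow> (u = [] \<longleftrightarrow> v = []) \<longrightarrow> (f x u, f x v) \<in> \<beta> \<longrightarrow> (u, v) \<in> \<beta>') \<and>
     (\<forall>u v x. (u, v) \<in> \<beta>' \<longrightarrow> (f x u, f x v) \<in> \<beta>)"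

lemma right_letter_quotient:
  assumes "ficong \<beta>"
  shows "letter_quotient (\<lambda>x w. w @ [x]) \<beta> (right_quotient \<beta>)"
  unfolding letter_quotient_def
  using ficong_right_quotient[OF assms] right_quotientI[OF assms] right_quotientD by blast

lemma left_letter_quotient:
  assumes "ficong \<beta>"
  shows "letter_quotient (#) \<beta> (reversed (right_quotient (reversed \<beta>)))"
  unfolding letter_quotient_def
proof (intro conjI allI impI)
  let ?r = "right_quotient (reversed \<beta>)"
  note fr = ficong_reversed[OF assms]
  show "ficong (reversed ?r)"
    by (rule ficong_reversed[OF ficong_right_quotient[OF fr]])
  show "(u, v) \<in> reversed ?r"
    if "x \<notin> set u" "x \<notin> set v" "u = [] \<longleftrightarrow> v = []" "(x # u, x # v) \<in> \<beta>" for u v x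
  proof -
    have "(rev u @ [x], rev v @ [x]) \<in> reversed \<beta>" using that(4) by (simp add: reversed_def)
    then have "(rev u, rev v) \<in> ?r"
      by (rule right_quotientI[OF fr]) (use that in auto)
    then show ?thesis by (simp add: reversed_def[of ?r])
  qed
  show "(x # u, x # v) \<in> \<beta>" if "(u, v) \<in> reversed ?r" for u v x
  proof -
    have "(rev u @ [x], rev v @ [x]) \<in> reversed \<beta>"
      by (rule right_quotientD) (use that in \<open>auto simp: reversed_def[of ?r]\<close>)
    then show ?thesis by (simp add: reversed_def)
  qed
qed

lemma longer_word:
  assumes "ficong \<beta>" "distinct p" "(p, W) \<in> \<beta>" "set W = set p" "length p < length W"
  shows "\<exists>V. (p, V) \<in> \<beta> \<and> set V = set p \<and> length p < length V \<and> 3 \<le> length V"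
proof -
  interpret linear_word \<beta> p
    using assms by (simp add: linear_word_def linear_word_axioms_def)
  have "W \<in> K" using assms by (simp add: K_def)
  from K_long[OF this assms(5), of 3] show ?thesis using K_set K_related by blast
qed

lemma not_distinct_longer: "set V = set p \<Longrightarrow> length p < length V \<Longrightarrow> \<not> distinct V"
  by (metis card_length distinct_card not_le)

lemma absorb_power:
  assumes "ficong \<beta>" "(p, g @ p) \<in> \<beta>"
  shows "(p, word_power g n @ p) \<in> \<beta>"
proof -
  interpret ficong \<beta> by fact
  show ?thesis
  proof (induction n)
    case (Suc n)
    have "(g @ p, g @ (word_power g n @ p)) \<in> \<beta>" by (rule left[OF Suc])
    then show ?case using trans[OF assms(2)] by simp
  qed simp
qed

lemma absorb_power_right:
  assumes "ficong \<beta>" "(p, p @ g) \<in> \<beta>"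
  shows "(p, p @ word_power g n) \<in> \<beta>"
proof -
  interpret ficong \<beta> by fact
  show ?thesis
  proof (induction n)
    case (Suc n)
    have "(p @ g, (p @ word_power g n) @ g) \<in> \<beta>" by (rule right[OF Suc])
    then show ?case using trans[OF assms(2)] by (simp only: word_power_Suc_right append.assoc)
  qed simp
qed

lemma (in verbal_ideal) cube:
  assumes nonlinear: "\<And>w. \<not> distinct w \<Longrightarrow> 3 \<le> length w \<Longrightarrow> w \<in> Z" and "t \<noteq> []"
  shows "word_power t 3 \<in> Z"
proof -
  obtain a t' where t: "t = a # t'" using assms(2) by (cases t) auto
  have "word_power t 3 = a # t' @ a # t' @ t" by (simp add: numeral_3_eq_3 t)
  moreover have "\<not> distinct (a # t' @ a # t' @ t)" by simp
  moreover have "3 \<le> length (word_power t 3)" using t by simp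
  ultimately show ?thesis using nonlinear by metis
qed

text \<open>If \<open>p\<close> is absorbed on the left by one of the congruences, then \<open>q\<close> and \<open>r\<close> absorb
  elements of \<open>Z\<close> on the left by both, as they are instances of \<open>p\<close> and the congruences
  agree on \<open>Z\<close>; the same holds on the right. From \<open>r \<approx> h r\<close> and \<open>q \<approx> q j\<close>
  with \<open>h\<close> and \<open>j\<close> in \<open>Z\<close> one gets \<open>r \<approx> h q\<close> and \<open>q \<approx> r j\<close>, since products
  with elements of \<open>Z\<close> may use both congruences; so
  \<open>q \<approx> r j \<approx> h q j \<approx> h q \<approx> r\<close>. Otherwise,
  \<open>left_absorbs_or_peels\<close> and its mirror image show that the same letter splits off on the
  same side in both congruences. The quotients by this letter agree on \<open>Z\<close> as well, so the
  induction hypothesis applies to them and the shorter product.\<close>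

lemma confluence:
  assumes Z: "verbal_ideal Z" and nonlinear: "\<And>w. \<not> distinct w \<Longrightarrow> 3 \<le> length w \<Longrightarrow> w \<in> Z"
    and "ficong \<beta>" "ficong \<gamma>" "\<And>u v. u \<in> Z \<Longrightarrow> v \<in> Z \<Longrightarrow> (u, v) \<in> \<beta> \<longleftrightarrow> (u, v) \<in> \<gamma>"
    and "distinct p" "(p, q) \<in> \<beta>" "q \<in> Z" "set q = set p" "length p < length q"
    and "(p, r) \<in> \<gamma>" "r \<in> Z" "set r = set p" "length p < length r"
  shows "(q, r) \<in> \<beta>"
  using assms(3-)
proof (induction "length p" arbitrary: \<beta> \<gamma> p q r rule: less_induct)
  case less
  interpret \<beta>: ficong \<beta> by fact
  interpret \<gamma>: ficong \<gamma> by fact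
  interpret Z: verbal_ideal Z by fact
  note agree = less.prems(3)
  note d = less.prems(4) and q = less.prems(5-8) and r = less.prems(9-12)
  have p: "p \<noteq> []"
  proof
    assume "p = []"
    then show False using q(3,4) by simp
  qed
  have cut: "\<exists>\<xi>. nonerasing \<xi> \<and> substitute \<xi> p = w" if "length p < length w" for w
    using cut_exists[OF d, of w] that p by simp
  have left_absorb: "\<exists>h\<in>Z. (w, h @ w) \<in> \<beta>"
    if sided: "(\<exists>g. g \<noteq> [] \<and> (p, g @ p) \<in> \<beta>) \<or> (\<exists>g. g \<noteq> [] \<and> (p, g @ p) \<in> \<gamma>)"
      and w: "w \<in> Z" "length p < length w" for w
  proof -
    obtain \<xi> where \<xi>: "nonerasing \<xi>" "substitute \<xi> p = w" using cut w(2) by blast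
    have "\<exists>g. g \<noteq> [] \<and> ((p, word_power g 3 @ p) \<in> \<beta> \<or> (p, word_power g 3 @ p) \<in> \<gamma>)"
      using sided absorb_power[OF \<beta>.ficong_axioms] absorb_power[OF \<gamma>.ficong_axioms] by blast
    then obtain g where g: "g \<noteq> []" "(p, word_power g 3 @ p) \<in> \<beta> \<or> (p, word_power g 3 @ p) \<in> \<gamma>" by blast
    define h where "h = word_power (substitute \<xi> g) 3"
    have h: "h \<in> Z" unfolding h_def by (rule Z.cube[OF nonlinear]) (use g(1) \<xi>(1) in simp_all)
    have hw: "substitute \<xi> (word_power g 3 @ p) = h @ w" using \<xi>(2) by (simp add: h_def substitute_power)
    have "(w, h @ w) \<in> \<beta> \<or> (w, h @ w) \<in> \<gamma>"
      using g(2) \<beta>.sub[OF _ \<xi>(1), of p "word_power g 3 @ p"] \<gamma>.sub[OF _ \<xi>(1), of p "word_power g 3 @ p"]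
      unfolding hw \<xi>(2) by blast
    then show ?thesis using agree[OF w(1) Z.right[OF h]] h by blast
  qed
  have right_absorb: "\<exists>h\<in>Z. (w, w @ h) \<in> \<beta>"
    if sided: "(\<exists>g. g \<noteq> [] \<and> (p, p @ g) \<in> \<beta>) \<or> (\<exists>g. g \<noteq> [] \<and> (p, p @ g) \<in> \<gamma>)"
      and w: "w \<in> Z" "length p < length w" for w
  proof -
    obtain \<xi> where \<xi>: "nonerasing \<xi>" "substitute \<xi> p = w" using cut w(2) by blast
    have "\<exists>g. g \<noteq> [] \<and> ((p, p @ word_power g 3) \<in> \<beta> \<or> (p, p @ word_power g 3) \<in> \<gamma>)"
      using sided absorb_power_right[OF \<beta>.ficong_axioms] absorb_power_right[OF \<gamma>.ficong_axioms] by blast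
    then obtain g where g: "g \<noteq> []" "(p, p @ word_power g 3) \<in> \<beta> \<or> (p, p @ word_power g 3) \<in> \<gamma>" by blast
    define h where "h = word_power (substitute \<xi> g) 3"
    have h: "h \<in> Z" unfolding h_def by (rule Z.cube[OF nonlinear]) (use g(1) \<xi>(1) in simp_all)
    have hw: "substitute \<xi> (p @ word_power g 3) = w @ h" using \<xi>(2) by (simp add: h_def substitute_power)
    have "(w, w @ h) \<in> \<beta> \<or> (w, w @ h) \<in> \<gamma>"
      using g(2) \<beta>.sub[OF _ \<xi>(1), of p "p @ word_power g 3"] \<gamma>.sub[OF _ \<xi>(1), of p "p @ word_power g 3"]
      unfolding hw \<xi>(2) by blast
    then show ?thesis using agree[OF w(1) Z.left[OF h]] h by blast
  qed
  \<comment> \<open>a letter that splits off on the same side in both congruences is cancelled\<close>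
  have peel: "(q, r) \<in> \<beta>"
    if Q: "letter_quotient f \<beta> \<beta>'" "letter_quotient f \<gamma> \<gamma>'"
      and f: "\<And>w x. w \<in> Z \<Longrightarrow> f x w \<in> Z"
      and p': "p = f x p'" "distinct p'" "x \<notin> set p'" "length p' < length p"
      and V: "(p, f x V) \<in> \<beta>" "set V = set p'" "length p' < length V"
      and V': "(p, f x V') \<in> \<gamma>" "set V' = set p'" "length p' < length V'"
    for f \<beta>' \<gamma>' x p' V V'
  proof -
    have \<beta>': "ficong \<beta>'" and \<gamma>': "ficong \<gamma>'" using Q by (simp_all add: letter_quotient_def)
    have \<beta>'I: "(u, v) \<in> \<beta>'" if "x \<notin> set u" "x \<notin> set v" "u = [] \<longleftrightarrow> v = []" "(f x u, f x v) \<in> \<beta>" for u v x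
      using Q(1) that unfolding letter_quotient_def by blast
    have \<gamma>'I: "(u, v) \<in> \<gamma>'" if "x \<notin> set u" "x \<notin> set v" "u = [] \<longleftrightarrow> v = []" "(f x u, f x v) \<in> \<gamma>" for u v x
      using Q(2) that unfolding letter_quotient_def by blast
    have \<beta>'D: "(f x u, f x v) \<in> \<beta>" if "(u, v) \<in> \<beta>'" for u v x
      using Q(1) that unfolding letter_quotient_def by blast
    have \<gamma>'D: "(f x u, f x v) \<in> \<gamma>" if "(u, v) \<in> \<gamma>'" for u v x
      using Q(2) that unfolding letter_quotient_def by blast
    have agree': "(u, v) \<in> \<beta>' \<longleftrightarrow> (u, v) \<in> \<gamma>'" if uv: "u \<in> Z" "v \<in> Z" for u v
    proof -
      obtain z where z: "z \<notin> set u \<union> set v"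
        using ex_new_if_finite[of "set u \<union> set v"] by auto
      have ne: "u \<noteq> []" "v \<noteq> []" using uv Z.nonempty by auto
      have "(f z u, f z v) \<in> \<beta> \<longleftrightarrow> (f z u, f z v) \<in> \<gamma>" by (rule agree) (use f uv in auto)
      then show ?thesis using \<beta>'I[of z u v] \<gamma>'I[of z u v] \<beta>'D[of u v z] \<gamma>'D[of u v z] z ne by blast
    qed
    have "V \<noteq> []" "V' \<noteq> []" "p' \<noteq> []" using V(2,3) V'(3) by auto
    then have "(p', V) \<in> \<beta>'" "(p', V') \<in> \<gamma>'"
      using \<beta>'I[of x p' V] \<gamma>'I[of x p' V'] p'(1,3) V V' by auto
    then obtain U U' where
      U: "(p', U) \<in> \<beta>'" "set U = set p'" "length p' < length U" "3 \<le> length U" and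
      U': "(p', U') \<in> \<gamma>'" "set U' = set p'" "length p' < length U'" "3 \<le> length U'"
      using longer_word[OF \<beta>' p'(2) _ V(2,3)] longer_word[OF \<gamma>' p'(2) _ V'(2,3)] by blast
    have Z: "U \<in> Z" "U' \<in> Z"
      using nonlinear not_distinct_longer U U' by blast+
    have "(U, U') \<in> \<beta>'"
      by (rule less.hyps[OF p'(4) \<beta>' \<gamma>' agree' p'(2) U(1) Z(1) U(2,3) U'(1) Z(2) U'(2,3)])
    then have "(f x U, f x U') \<in> \<beta>" by (rule \<beta>'D)
    moreover have "(p, f x U) \<in> \<beta>" using \<beta>'D[OF U(1)] p'(1) by simp
    moreover have "(f x U', r) \<in> \<gamma>"
      using \<gamma>'D[OF U'(1), of x] p'(1) \<gamma>.trans[OF \<gamma>.sym r(1)] by simp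
    then have "(f x U', r) \<in> \<beta>" using agree[OF f[OF Z(2)] r(2)] by blast
    ultimately show ?thesis using q(1) \<beta>.sym \<beta>.trans by blast
  qed
  consider (LR) "(\<exists>g. g \<noteq> [] \<and> (p, g @ p) \<in> \<beta>) \<or> (\<exists>g. g \<noteq> [] \<and> (p, g @ p) \<in> \<gamma>)"
      "(\<exists>g. g \<noteq> [] \<and> (p, p @ g) \<in> \<beta>) \<or> (\<exists>g. g \<noteq> [] \<and> (p, p @ g) \<in> \<gamma>)"
    | (I) "peels_left \<beta> p" "peels_left \<gamma> p"
    | (II) "peels_right \<beta> p" "peels_right \<gamma> p"
    using left_absorbs_or_peels[OF \<beta>.ficong_axioms d q(1,3,4)] left_absorbs_or_peels[OF \<gamma>.ficong_axioms d r(1,3,4)]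
      right_absorbs_or_peels[OF \<beta>.ficong_axioms d q(1,3,4)] right_absorbs_or_peels[OF \<gamma>.ficong_axioms d r(1,3,4)]
    by blast
  then show ?case
  proof cases
    case LR
    obtain h where h: "h \<in> Z" "(r, h @ r) \<in> \<beta>" using left_absorb[OF LR(1) r(2,4)] by blast
    obtain j where j: "j \<in> Z" "(q, q @ j) \<in> \<beta>" using right_absorb[OF LR(2) q(2,4)] by blast
    have "(h @ r, h @ p) \<in> \<beta>"
      using agree[OF Z.right[OF h(1)] Z.right[OF h(1)]] \<gamma>.left[OF \<gamma>.sym[OF r(1)]] by blast
    then have rhq: "(r, h @ q) \<in> \<beta>"
      using \<beta>.trans[OF h(2)] \<beta>.trans \<beta>.left[OF q(1)] by blast
    have "(p @ j, r @ j) \<in> \<beta>"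
      using agree[OF Z.left[OF j(1)] Z.left[OF j(1)]] \<gamma>.right[OF r(1)] by blast
    then have "(q, r @ j) \<in> \<beta>"
      using \<beta>.trans[OF j(2)] \<beta>.trans \<beta>.right[OF \<beta>.sym[OF q(1)]] by blast
    moreover have "(r @ j, (h @ q) @ j) \<in> \<beta>" by (rule \<beta>.right[OF rhq])
    moreover have "(h @ (q @ j), h @ q) \<in> \<beta>" by (rule \<beta>.left[OF \<beta>.sym[OF j(2)]])
    ultimately show ?thesis using rhq \<beta>.sym \<beta>.trans by (metis append.assoc)
  next
    case I
    then obtain x p' V V' where V: "p = x # p'" "(p, x # V) \<in> \<beta>" "set V = set p'" "length p' < length V"
      and V': "(p, x # V') \<in> \<gamma>" "set V' = set p'" "length p' < length V'"
      unfolding peels_left_def by auto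
    have "x \<notin> set p'" "distinct p'" "length p' < length p" using d V(1) by auto
    moreover have "x # w \<in> Z" if "w \<in> Z" for x w using Z.left[OF that, of "[x]"] by simp
    ultimately show ?thesis
      using peel[OF left_letter_quotient[OF \<beta>.ficong_axioms] left_letter_quotient[OF \<gamma>.ficong_axioms]] V V' by blast
  next
    case II
    then obtain x p' V V' where V: "p = p' @ [x]" "(p, V @ [x]) \<in> \<beta>" "set V = set p'" "length p' < length V"
      and V': "(p, V' @ [x]) \<in> \<gamma>" "set V' = set p'" "length p' < length V'"
      unfolding peels_right_def by auto
    have "x \<notin> set p'" "distinct p'" "length p' < length p" using d V(1) by auto
    moreover have "w @ [x] \<in> Z" if "w \<in> Z" for x w by (rule Z.right[OF that])
    ultimately show ?thesis
      using peel[OF right_letter_quotient[OF \<beta>.ficong_axioms] right_letter_quotient[OF \<gamma>.ficong_axioms]] V V' by blast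
  qed
qed

section \<open>Semilattices are cancellable\<close>

text \<open>In an identity with a letter \<open>x\<close> that occurs on one side only, substitute \<open>t\<close> for \<open>x\<close>
  and \<open>u\<close> for the other letters.\<close>

lemma power_with_more_letters:
  assumes "ficong \<gamma>" "(a, b) \<in> \<gamma>" "set a \<noteq> set b"
  shows "\<exists>L. L \<noteq> 0 \<and> (\<forall>u t. u \<noteq> [] \<longrightarrow> t \<noteq> [] \<longrightarrow> (\<exists>w. (word_power u L, w) \<in> \<gamma> \<and> set w = set u \<union> set t))"
proof -
  interpret ficong \<gamma> by fact
  have "\<exists>a b x. (a, b) \<in> \<gamma> \<and> x \<in> set a \<and> x \<notin> set b"
    using assms(2,3) sym by blast
  then obtain a b x where ab: "(a, b) \<in> \<gamma>" "x \<in> set a" "x \<notin> set b" by blast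
  have "\<exists>w. (word_power u (Suc (length b)), w) \<in> \<gamma> \<and> set w = set u \<union> set t" if ut: "u \<noteq> []" "t \<noteq> []" for u t
  proof -
    define \<sigma> where "\<sigma> z = (if z = x then t else u)" for z
    have "substitute \<sigma> b = substitute (\<lambda>_. u) b"
      by (rule substitute_cong) (use ab(3) in \<open>auto simp: \<sigma>_def\<close>)
    then have b: "substitute \<sigma> b @ u = word_power u (Suc (length b))"
      by (simp only: substitute_const word_power_Suc_right)
    have "(substitute \<sigma> b @ u, substitute \<sigma> a @ u) \<in> \<gamma>"
      by (rule right[OF sub[OF sym[OF ab(1)]]]) (use ut in \<open>simp add: \<sigma>_def\<close>)
    moreover have "set (substitute \<sigma> a @ u) = set u \<union> set t"
      using ab(2) by (auto simp: set_substitute \<sigma>_def split: if_splits)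
    ultimately show ?thesis unfolding b by blast
  qed
  then show ?thesis by blast
qed

text \<open>This is why semilattices do no harm: agreement on the pairs with the same letters is
  enough. If \<open>\<beta>\<close> relates \<open>p\<close> and \<open>q\<close> with different letters, then \<open>p\<close> is related by
  \<open>\<beta>\<close> to a word in which some letters may be replaced arbitrarily. Replacing them by
  a word that \<open>\<gamma>\<close> relates to one with more letters leads from \<open>p\<close>, in both
  congruences, to a word with the letters of \<open>p\<close> and \<open>q\<close>. After both sides have been
  enlarged in this way they have the same letters.\<close>

lemma agree_of_agree_same_letters:
  assumes Z: "verbal_ideal Z" and "ficong \<beta>" "ficong \<gamma>"
    and agree: "\<And>u v. u \<in> Z \<Longrightarrow> v \<in> Z \<Longrightarrow> set u = set v \<Longrightarrow> (u, v) \<in> \<beta> \<longleftrightarrow> (u, v) \<in> \<gamma>"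
    and \<gamma>: "\<not> \<gamma> \<subseteq> same_letters" and uv: "u \<in> Z" "v \<in> Z" "(u, v) \<in> \<beta>"
  shows "(u, v) \<in> \<gamma>"
proof (cases "set u = set v")
  case True
  then show ?thesis using agree uv by blast
next
  case False
  interpret \<beta>: ficong \<beta> by fact
  interpret \<gamma>: ficong \<gamma> by fact
  interpret Z: verbal_ideal Z by fact
  obtain a b where "(a, b) \<in> \<gamma>" "set a \<noteq> set b" using \<gamma> by (auto simp: same_letters_def)
  then obtain L where L: "L \<noteq> 0"
    "\<And>u t. u \<noteq> [] \<Longrightarrow> t \<noteq> [] \<Longrightarrow> \<exists>w. (word_power u L, w) \<in> \<gamma> \<and> set w = set u \<union> set t"
    using power_with_more_letters[OF \<gamma>.ficong_axioms] by blast
  have enlarge: "\<exists>p'\<in>Z. (p, p') \<in> \<beta> \<and> (p, p') \<in> \<gamma> \<and> set p' = set p \<union> set q"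
    if pq: "p \<in> Z" "q \<in> Z" "(p, q) \<in> \<beta>" "set p \<noteq> set q" for p q
  proof -
    \<comment> \<open>\<open>p\<close> is related to a word in which certain letters may be replaced arbitrarily\<close>
    have "\<exists>g D x. g \<in> Z \<and> set g - D \<union> {x} = set p \<and> D \<inter> set g \<noteq> {} \<and>
      (\<forall>t. t \<noteq> [] \<longrightarrow> (p, substitute (\<lambda>z. if z \<in> D then t else [z]) g) \<in> \<beta>)"
    proof (cases "set p \<subseteq> set q")
      case True
      let ?D = "set q - set p"
      obtain x where x: "x \<in> set p" using pq(1) Z.nonempty by (cases p) auto
      have "(p, substitute (\<lambda>z. if z \<in> ?D then t else [z]) q) \<in> \<beta>" if t: "t \<noteq> []" for t
      proof -
        have "substitute (\<lambda>z. if z \<in> ?D then t else [z]) p = substitute (\<lambda>z. [z]) p"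
          by (rule substitute_cong) simp
        then show ?thesis using \<beta>.sub[OF pq(3), of "\<lambda>z. if z \<in> ?D then t else [z]"] t by simp
      qed
      moreover have "set q - ?D \<union> {x} = set p" "?D \<inter> set q \<noteq> {}" using True x pq(4) by auto
      ultimately show ?thesis using pq(2) by blast
    next
      case False
      then obtain x where x: "x \<in> set p" "x \<notin> set q" by blast
      have "(p, substitute (\<lambda>z. if z \<in> {x} then t else [z]) p) \<in> \<beta>" if t: "t \<noteq> []" for t
      proof -
        have "substitute (\<lambda>z. if z \<in> {x} then t else [z]) q = substitute (\<lambda>z. [z]) q"
          by (rule substitute_cong) (use x in auto)
        then have "(substitute (\<lambda>z. if z \<in> {x} then t else [z]) p, q) \<in> \<beta>"
          using \<beta>.sub[OF pq(3), of "\<lambda>z. if z \<in> {x} then t else [z]"] t by simp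
        then show ?thesis using \<beta>.trans[OF pq(3)] \<beta>.sym by blast
      qed
      moreover have "set p - {x} \<union> {x} = set p" "{x} \<inter> set p \<noteq> {}" using x by auto
      ultimately show ?thesis using pq(1) by blast
    qed
    then obtain g D x where g: "g \<in> Z" "set g - D \<union> {x} = set p" "D \<inter> set g \<noteq> {}"
      and \<beta>g: "\<And>t. t \<noteq> [] \<Longrightarrow> (p, substitute (\<lambda>z. if z \<in> D then t else [z]) g) \<in> \<beta>" by blast
    let ?\<sigma> = "\<lambda>t z. if z \<in> D then t else [z]"
    have set_\<sigma>: "set (substitute (?\<sigma> t) g) = (set g - D) \<union> set t" for t
      using g(3) by (auto simp: set_substitute split: if_splits)
    have "q \<noteq> []" using pq(2) Z.nonempty by auto
    then obtain w where w: "(word_power [x] L, w) \<in> \<gamma>" "set w = {x} \<union> set q"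
      using L(2)[of "[x]" q] by auto
    have xL: "word_power [x] L \<noteq> []" "set (word_power [x] L) = {x}"
      using L(1) by (simp_all add: word_power_eq_Nil set_power)
    have "w \<noteq> []" using w(2) by auto
    let ?p1 = "substitute (?\<sigma> (word_power [x] L)) g" and ?p2 = "substitute (?\<sigma> w) g"
    have Z12: "?p1 \<in> Z" "?p2 \<in> Z" using Z.sub[OF g(1)] xL(1) \<open>w \<noteq> []\<close> by simp_all
    have "set ?p1 = set p" using set_\<sigma>[of "word_power [x] L"] g(2) xL(2) by simp
    then have "(p, ?p1) \<in> \<gamma>" using agree[OF pq(1) Z12(1)] \<beta>g[OF xL(1)] by simp
    moreover have "(?p1, ?p2) \<in> \<gamma>" by (rule \<gamma>.substitute_pointwise) (use w(1) in auto)
    ultimately have "(p, ?p2) \<in> \<gamma>" by (rule \<gamma>.trans)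
    moreover have "set ?p2 = set p \<union> set q" using set_\<sigma>[of w] g(2) w(2) by auto
    ultimately show ?thesis using \<beta>g[OF \<open>w \<noteq> []\<close>] Z12(2) by blast
  qed
  obtain u' where u': "u' \<in> Z" "(u, u') \<in> \<beta>" "(u, u') \<in> \<gamma>" "set u' = set u \<union> set v"
    using enlarge[OF uv False] by blast
  obtain v' where v': "v' \<in> Z" "(v, v') \<in> \<beta>" "(v, v') \<in> \<gamma>" "set v' = set v \<union> set u"
    using enlarge[OF uv(2,1) \<beta>.sym[OF uv(3)] False[symmetric]] by blast
  have "(u', v') \<in> \<beta>" by (rule \<beta>.trans[OF \<beta>.sym[OF u'(2)] \<beta>.trans[OF uv(3) v'(2)]])
  then have "(u', v') \<in> \<gamma>" using agree[OF u'(1) v'(1)] u'(4) v'(4) by blast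
  then show ?thesis by (rule \<gamma>.trans[OF u'(3) \<gamma>.trans[OF _ \<gamma>.sym[OF v'(3)]]])
qed

section \<open>Sufficiency\<close>

lemma rename_to:
  assumes "distinct p" "length p = length v"
  shows "\<exists>f. map f p = v"
proof
  show "map (\<lambda>x. the (map_of (zip p v) x)) p = v"
    using assms by (intro nth_equalityI) (auto simp: map_of_zip_nth)
qed

lemma rtrancl_exit:
  assumes "(p, q) \<in> R\<^sup>*" "p \<in> S" "q \<notin> S"
  shows "\<exists>p'\<in>S. \<exists>r. r \<notin> S \<and> (p', r) \<in> R"
  using assms by (induction rule: rtrancl_induct) blast+

text \<open>All words that one of the congruences of the classification can relate to a given
  nonzero \<open>p\<close>.\<close>

definition orbit :: "word \<Rightarrow> word set" where
  "orbit p = {v. v = p \<or> distinct p \<and> distinct v \<and> set v = set p}"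

lemma orbit_rename:
  assumes "v \<in> orbit p"
  shows "\<exists>f. map f v = p"
proof (cases "v = p")
  case True
  then show ?thesis by (metis map_ident)
next
  case False
  then have "distinct v" "length v = length p" using assms by (auto simp: orbit_def distinct_card[symmetric])
  then show ?thesis by (rule rename_to)
qed

lemma orbit_sym: "v \<in> orbit p \<Longrightarrow> orbit v = orbit p"
  by (auto simp: orbit_def)

lemma nonlinear_short:
  assumes "\<not> distinct w" "length w < 3"
  shows "\<exists>a. w = [a, a]"
  using assms by (cases w rule: list.exhaust; cases "tl w" rule: list.exhaust; cases "tl (tl w)") auto

lemma distinct_one_letter: "distinct p \<Longrightarrow> set p = {a} \<Longrightarrow> p = [a]"
  by (cases p rule: list.exhaust; cases "tl p" rule: list.exhaust) auto

text \<open>The common shape of the congruences of the classification, in which \<open>Q k\<close> says that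
  linear words of length \<open>k\<close> may be rearranged.\<close>

locale special = ficong \<Theta> + Z: verbal_ideal Z for \<Theta> Z +
  fixes Q :: "nat \<Rightarrow> bool"
  assumes nonlinear: "\<not> distinct w \<Longrightarrow> 3 \<le> length w \<Longrightarrow> w \<in> Z"
    and inside: "(\<forall>u\<in>Z. \<forall>v\<in>Z. (u, v) \<in> \<Theta>) \<or>
      (\<Theta> \<subseteq> same_letters \<and> (\<forall>u\<in>Z. \<forall>v\<in>Z. set u = set v \<longrightarrow> (u, v) \<in> \<Theta>))"
    and outside: "u \<notin> Z \<Longrightarrow> u \<noteq> [] \<Longrightarrow>
      (u, v) \<in> \<Theta> \<longleftrightarrow> u = v \<or> distinct u \<and> distinct v \<and> set u = set v \<and> Q (length u)"
begin

lemma orbit_outside: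
  assumes "p \<notin> Z" "v \<in> orbit p"
  shows "v \<notin> Z"
  using orbit_rename[OF assms(2)] Z.rename assms(1) by blast

lemma agree_on_ideal:
  assumes "ficong \<beta>" "ficong \<gamma>" "\<Theta> \<inter> \<beta> = \<Theta> \<inter> \<gamma>" "cjoin \<Theta> \<beta> = cjoin \<Theta> \<gamma>"
    and uv: "u \<in> Z" "v \<in> Z" "(u, v) \<in> \<beta>"
  shows "(u, v) \<in> \<gamma>"
  using inside
proof
  assume "\<forall>u\<in>Z. \<forall>v\<in>Z. (u, v) \<in> \<Theta>"
  then show ?thesis using assms by blast
next
  assume SL: "\<Theta> \<subseteq> same_letters \<and> (\<forall>u\<in>Z. \<forall>v\<in>Z. set u = set v \<longrightarrow> (u, v) \<in> \<Theta>)"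
  then have agree: "(u, v) \<in> \<beta> \<longleftrightarrow> (u, v) \<in> \<gamma>" if "u \<in> Z" "v \<in> Z" "set u = set v" for u v
    using assms(3) that by blast
  show ?thesis
  proof (cases "\<gamma> \<subseteq> same_letters")
    case True
    then have "cjoin \<Theta> \<gamma> \<subseteq> same_letters" using SL by (intro cjoin_least ficong_same_letters) auto
    then have "(u, v) \<in> same_letters" using assms(4) cjoin_upper(2) uv(3) by blast
    then show ?thesis using agree uv by (simp add: same_letters_def)
  next
    case False
    show ?thesis
      by (rule agree_of_agree_same_letters[OF Z.verbal_ideal_axioms assms(1,2) agree False uv])
  qed
qed

text \<open>A letter that occurs in only one of \<open>p\<close> and \<open>r\<close> may be replaced by its cube, which lies
  in \<open>Z\<close>. If \<open>p\<close> and \<open>r\<close> have the same letters and are not in \<open>Z\<close>, they can only be \<open>a\<close>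
  and \<open>aa\<close>, and then \<open>a\<close> is related to \<open>aaa\<close>.\<close>

lemma exit_to_ideal:
  assumes "ficong \<gamma>" and p: "p \<notin> Z" "p \<noteq> []" and r: "(p, r) \<in> \<gamma>" "r \<notin> orbit p"
  shows "\<exists>z\<in>Z. (p, z) \<in> \<gamma>"
proof -
  interpret \<gamma>: ficong \<gamma> by fact
  have cube: "substitute (replace x [x, x, x]) w \<in> Z" if x: "x \<in> set w" for x w
  proof -
    obtain A B where "w = A @ x # B" using split_list[OF x] by blast
    then have "substitute (replace x [x, x, x]) w =
        substitute (replace x [x, x, x]) A @ [x, x, x] @ substitute (replace x [x, x, x]) B" by simp
    then show ?thesis using Z.mult[OF nonlinear[of "[x, x, x]"]] by simp
  qed
  have ne: "nonerasing (replace x [x, x, x])" for x by simp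
  have fix_notin: "substitute (replace x [x, x, x]) w = w" if "x \<notin> set w" for x w
    using substitute_upd_notin[OF that, of "\<lambda>y. [y]"] by (simp only: substitute_id)
  consider x where "x \<in> set p" "x \<notin> set r" | x where "x \<in> set r" "x \<notin> set p" | "set r = set p" by blast
  then show ?thesis
  proof cases
    case 1
    have "(substitute (replace x [x, x, x]) p, r) \<in> \<gamma>"
      using \<gamma>.sub[OF r(1) ne[of x]] fix_notin[OF 1(2)] by (simp only:)
    then show ?thesis using \<gamma>.trans[OF r(1)] \<gamma>.sym cube[OF 1(1)] by blast
  next
    case 2
    have "(p, substitute (replace x [x, x, x]) r) \<in> \<gamma>"
      using \<gamma>.sub[OF r(1) ne[of x]] fix_notin[OF 2(2)] by (simp only:)
    then show ?thesis using cube[OF 2(1)] by blast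
  next
    case 3
    show ?thesis
    proof (cases "r \<in> Z")
      case False
      have "\<exists>a. {p, r} = {[a], [a, a]}"
      proof (cases "distinct p")
        case True
        then have "\<not> distinct r" using r(2) 3 by (auto simp: orbit_def)
        then obtain a where a: "r = [a, a]" using nonlinear[of r] False nonlinear_short[of r] by fastforce
        then have "p = [a]" using 3 by (intro distinct_one_letter True) simp
        then show ?thesis using a by blast
      next
        case False
        then obtain a where a: "p = [a, a]" using nonlinear[of p] p(1) nonlinear_short[of p] by fastforce
        have "r \<noteq> [b, b]" for b
        proof
          assume rb: "r = [b, b]"
          then have "b = a" using 3 a by simp
          then show False using rb a r(2) by (simp add: orbit_def)
        qed
        then have "distinct r" using nonlinear[of r] \<open>r \<notin> Z\<close> nonlinear_short[of r] by fastforce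
        then have "r = [a]" using 3 a by (intro distinct_one_letter) simp_all
        then show ?thesis using a by blast
      qed
      then obtain a where a: "{p, r} = {[a], [a, a]}" by blast
      then have 1: "([a], [a, a]) \<in> \<gamma>" using r(1) \<gamma>.sym by (auto simp: doubleton_eq_iff)
      have "([a, a], [a, a, a]) \<in> \<gamma>" using \<gamma>.left[OF 1, of "[a]"] by simp
      then have "(w, [a, a, a]) \<in> \<gamma>" if "w \<in> {[a], [a, a]}" for w using that 1 \<gamma>.trans by blast
      moreover have "[a, a, a] \<in> Z" by (rule nonlinear) auto
      ultimately show ?thesis using a by blast
    qed (use r(1) in blast)
  qed
qed

text \<open>A path from \<open>p\<close> to \<open>q\<close> in the union of \<open>\<Theta>\<close> and \<open>\<gamma>\<close> has to leave the orbit
  of \<open>p\<close>. The steps of \<open>\<Theta>\<close> stay in the orbit, so the exit is a step of \<open>\<gamma>\<close>,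
  from some rearrangement of \<open>p\<close>; renaming the letters gives such a step from \<open>p\<close>.\<close>

lemma reaches_ideal:
  assumes "ficong \<beta>" "ficong \<gamma>" "\<Theta> \<inter> \<beta> = \<Theta> \<inter> \<gamma>" "cjoin \<Theta> \<beta> = cjoin \<Theta> \<gamma>"
    and p: "p \<notin> Z" "p \<noteq> []" and q: "(p, q) \<in> cjoin \<Theta> \<gamma>" "q \<notin> orbit p"
  shows "\<exists>z\<in>Z. (p, z) \<in> \<gamma>"
proof -
  interpret \<gamma>: ficong \<gamma> by fact
  have "p \<in> orbit p" by (simp add: orbit_def)
  then obtain p' r where p': "p' \<in> orbit p" and r: "r \<notin> orbit p" "(p', r) \<in> \<Theta> \<union> \<gamma>"
    using rtrancl_exit[OF q(1)[unfolded cjoin_def] _ q(2)] by blast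
  have p'Z: "p' \<notin> Z" "p' \<noteq> []" using orbit_outside[OF p(1) p'] p' p(2) by (auto simp: orbit_def)
  have o: "orbit p' = orbit p" by (rule orbit_sym[OF p'])
  have "(p', r) \<notin> \<Theta>"
  proof
    assume "(p', r) \<in> \<Theta>"
    then have "r \<in> orbit p'" using outside[OF p'Z] by (auto simp: orbit_def)
    then show False using r(1) o by simp
  qed
  then obtain z where z: "z \<in> Z" "(p', z) \<in> \<gamma>"
    using exit_to_ideal[OF assms(2) p'Z, of r] r o by blast
  obtain f where "map f p' = p" using orbit_rename[OF p'] by blast
  then show ?thesis using \<gamma>.rename[OF z(2), of f] Z.rename[OF z(1), of f] by auto
qed

text \<open>Brings the word \<open>q\<close>, which may have any letters, into the form that \<open>confluence\<close>
  requires: extra letters are renamed to letters of \<open>p\<close>, and if a letter of \<open>p\<close> is missing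
  it may be doubled in \<open>p\<close>.\<close>

lemma linear_long_related:
  assumes "ficong \<beta>" and p: "p \<notin> Z" "p \<noteq> []" "distinct p" and q: "(p, q) \<in> \<beta>" "q \<in> Z"
  shows "\<exists>W\<in>Z. (p, W) \<in> \<beta> \<and> set W = set p \<and> length p < length W"
proof -
  interpret \<beta>: ficong \<beta> by fact
  have "\<exists>W. (p, W) \<in> \<beta> \<and> set W = set p \<and> length p < length W"
  proof (cases "set p \<subseteq> set q")
    case True
    obtain x where x: "x \<in> set p" using p(2) by (cases p) auto
    define f where "f y = (if y \<in> set p then y else x)" for y
    have fp: "map f p = p" by (rule map_idI) (simp add: f_def)
    have "(p, map f q) \<in> \<beta>" using \<beta>.rename[OF q(1), of f] fp by simp
    moreover have "set (map f q) = set p" using True x by (auto simp: f_def)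
    moreover have "length p < length q"
    proof (rule ccontr)
      assume "\<not> ?thesis"
      then have "length q \<le> card (set p)" using distinct_card[OF p(3)] by simp
      moreover have "card (set p) \<le> card (set q)" using True by (intro card_mono) auto
      moreover have "card (set q) \<le> length q" by (rule card_length)
      ultimately have "distinct q" "card (set p) = card (set q)" by (auto intro: card_distinct)
      then have "q \<in> orbit p"
        using card_subset_eq[OF _ True] p(3) by (simp add: orbit_def)
      then show False using orbit_outside[OF p(1)] q(2) by blast
    qed
    ultimately show ?thesis by (intro exI[of _ "map f q"]) simp
  next
    case False
    then obtain x where x: "x \<in> set p" "x \<notin> set q" by blast
    have "nonerasing (replace x [x, x])" by simp
    then have "(substitute (replace x [x, x]) p, substitute (replace x [x, x]) q) \<in> \<beta>"
      by (rule \<beta>.sub[OF q(1)])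
    then have "(substitute (replace x [x, x]) p, q) \<in> \<beta>"
      by (simp only: substitute_upd_notin[OF x(2)] substitute_id)
    then have "(p, substitute (replace x [x, x]) p) \<in> \<beta>" using \<beta>.trans[OF q(1)] \<beta>.sym by blast
    moreover obtain A B where AB: "p = A @ x # B" using x(1) by (auto simp: in_set_conv_decomp)
    have "x \<notin> set A" "x \<notin> set B" using p(3) AB by auto
    then have "substitute (replace x [x, x]) p = A @ [x, x] @ B"
      unfolding AB by (simp only: substitute_simps substitute_upd_notin substitute_id fun_upd_same not_False_eq_True)
    ultimately show ?thesis using AB by (intro exI[of _ "A @ [x, x] @ B"]) auto
  qed
  then obtain W where W: "(p, W) \<in> \<beta>" "set W = set p" "length p < length W" by blast
  obtain V where "(p, V) \<in> \<beta>" "set V = set p" "length p < length V" "3 \<le> length V"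
    using longer_word[OF assms(1) p(3) W] by blast
  then show ?thesis using nonlinear[of V] not_distinct_longer by blast
qed

text \<open>Both congruences take \<open>p\<close> into \<open>Z\<close>, and by \<open>confluence\<close> to a common element of \<open>Z\<close>. The
  only nonlinear \<open>p\<close> outside \<open>Z\<close> are the words \<open>aa\<close>, for which powers of \<open>a\<close> serve the
  same purpose.\<close>

lemma into_ideal:
  assumes \<beta>: "ficong \<beta>" and \<gamma>: "ficong \<gamma>" and int: "\<Theta> \<inter> \<beta> = \<Theta> \<inter> \<gamma>" and jo: "cjoin \<Theta> \<beta> = cjoin \<Theta> \<gamma>"
    and p: "p \<notin> Z" and q: "(p, q) \<in> \<beta>" "q \<in> Z"
  shows "(p, q) \<in> \<gamma>"
proof -
  interpret \<beta>: ficong \<beta> by fact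
  interpret \<gamma>: ficong \<gamma> by fact
  have agree: "(u, v) \<in> \<beta> \<longleftrightarrow> (u, v) \<in> \<gamma>" if "u \<in> Z" "v \<in> Z" for u v
    using agree_on_ideal[OF \<beta> \<gamma> int jo that] agree_on_ideal[OF \<gamma> \<beta> int[symmetric] jo[symmetric] that] by blast
  have pne: "p \<noteq> []" using q Z.nonempty \<beta>.Nil by blast
  have "q \<notin> orbit p" using orbit_outside[OF p] q(2) by blast
  moreover have "(p, q) \<in> cjoin \<Theta> \<gamma>" using q(1) jo cjoin_upper(2) by blast
  ultimately obtain z where z: "z \<in> Z" "(p, z) \<in> \<gamma>"
    using reaches_ideal[OF \<beta> \<gamma> int jo p pne] by blast
  have "\<exists>s\<in>Z. (p, s) \<in> \<beta> \<and> (p, s) \<in> \<gamma>"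
  proof (cases "distinct p")
    case True
    obtain W where W: "W \<in> Z" "(p, W) \<in> \<beta>" "set W = set p" "length p < length W"
      using linear_long_related[OF \<beta> p pne True q] by blast
    obtain W' where W': "W' \<in> Z" "(p, W') \<in> \<gamma>" "set W' = set p" "length p < length W'"
      using linear_long_related[OF \<gamma> p pne True z(2,1)] by blast
    have "(W, W') \<in> \<beta>"
      by (rule confluence[OF Z.verbal_ideal_axioms nonlinear \<beta> \<gamma> agree True W(2,1,3,4) W'(2,1,3,4)])
    then show ?thesis using W' \<beta>.trans[OF W(2)] by blast
  next
    case False
    then obtain a where a: "p = [a, a]" using nonlinear[of p] p nonlinear_short[of p] by fastforce
    have long: "\<exists>k. (p, replicate (k + 3) a) \<in> \<delta>" if "ficong \<delta>" "(p, w) \<in> \<delta>" "w \<in> Z" for \<delta> w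
    proof -
      interpret \<delta>: ficong \<delta> by fact
      have 1: "(p, replicate (length w) a) \<in> \<delta>" using \<delta>.all_to_letter[OF that(2), of a] a by (simp add: numeral_2_eq_2)
      have "3 \<le> length w"
      proof (rule ccontr)
        assume "\<not> ?thesis"
        moreover have "w \<noteq> []" using that(3) Z.nonempty by auto
        then have "0 < length w" by simp
        ultimately have "length w = 1 \<or> length w = 2" by linarith
        moreover have "replicate (length w) a \<in> Z" using Z.rename[OF that(3), of "\<lambda>_. a"] by (simp add: map_replicate_const)
        ultimately have "[a] \<in> Z \<or> p \<in> Z" using a by (auto simp: numeral_2_eq_2)
        then show False using p Z.left[of "[a]" "[a]"] a by auto
      qed
      then have "length w = (length w - 3) + 3" by simp
      then show ?thesis using 1 by metis
    qed
    let ?r = "\<lambda>n. replicate n a"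
    obtain k where k: "(p, ?r (k + 3)) \<in> \<beta>" using long[OF \<beta> q] by blast
    obtain l where l: "(p, ?r (l + 3)) \<in> \<gamma>" using long[OF \<gamma> z(2,1)] by blast
    have rZ: "?r (n + 3) \<in> Z" for n by (rule nonlinear) (auto simp: numeral_3_eq_3)
    have pr: "?r (n + 1) @ p = ?r (n + 3)" for n
      by (simp add: a numeral_3_eq_3 replicate_app_Cons_same)
    have e: "?r (m + 1) @ ?r (n + 3) = ?r ((m + n + 1) + 3)" for m n
      by (simp only: replicate_add[symmetric]) (simp add: ac_simps)
    have "(?r (l + 1) @ p, ?r (l + 1) @ ?r (k + 3)) \<in> \<beta>" by (rule \<beta>.left[OF k])
    then have 1: "(?r (l + 3), ?r ((l + k + 1) + 3)) \<in> \<beta>"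
      by (simp only: pr e)
    have "(?r (k + 1) @ p, ?r (k + 1) @ ?r (l + 3)) \<in> \<gamma>" by (rule \<gamma>.left[OF l])
    then have "(?r (k + 3), ?r ((l + k + 1) + 3)) \<in> \<gamma>"
      by (simp only: pr e add.commute[of k l])
    then have "(?r (k + 3), ?r ((l + k + 1) + 3)) \<in> \<beta>" using agree rZ by blast
    then have "(p, ?r (l + 3)) \<in> \<beta>" using k 1 \<beta>.trans \<beta>.sym by blast
    then show ?thesis using l rZ by blast
  qed
  then obtain s where s: "s \<in> Z" "(p, s) \<in> \<beta>" "(p, s) \<in> \<gamma>" by blast
  have "(s, q) \<in> \<beta>" by (rule \<beta>.trans[OF \<beta>.sym[OF s(2)] q(1)])
  then have "(s, q) \<in> \<gamma>" using agree s(1) q(2) by blast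
  then show ?thesis by (rule \<gamma>.trans[OF s(3)])
qed

lemma included:
  assumes \<beta>: "ficong \<beta>" and \<gamma>: "ficong \<gamma>" and int: "\<Theta> \<inter> \<beta> = \<Theta> \<inter> \<gamma>" and jo: "cjoin \<Theta> \<beta> = cjoin \<Theta> \<gamma>"
  shows "\<beta> \<subseteq> \<gamma>"
proof (rule subrelI)
  interpret \<beta>: ficong \<beta> by fact
  interpret \<gamma>: ficong \<gamma> by fact
  note into = into_ideal[OF \<beta> \<gamma> int jo]
  note into' = into_ideal[OF \<gamma> \<beta> int[symmetric] jo[symmetric]]
  fix p q assume pq: "(p, q) \<in> \<beta>"
  consider "p = []" | "p \<in> Z" "q \<in> Z" | "p \<in> Z" "q \<notin> Z" | "p \<notin> Z" "q \<in> Z" | "p \<notin> Z" "q \<notin> Z" "p \<noteq> []" by blast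
  then show "(p, q) \<in> \<gamma>"
  proof cases
    case 1
    then show ?thesis using pq \<beta>.Nil by auto
  next
    case 2
    then show ?thesis using agree_on_ideal[OF \<beta> \<gamma> int jo] pq by blast
  next
    case 3
    then show ?thesis using into \<beta>.sym[OF pq] \<gamma>.sym by blast
  next
    case 4
    then show ?thesis using into pq by blast
  next
    case 5
    show ?thesis
    proof (cases "\<exists>z\<in>Z. (p, z) \<in> \<beta>")
      case True
      then obtain z where z: "z \<in> Z" "(p, z) \<in> \<beta>" by blast
      then have "(p, z) \<in> \<gamma>" "(q, z) \<in> \<gamma>" using into 5 \<beta>.trans[OF \<beta>.sym[OF pq]] by blast+
      then show ?thesis using \<gamma>.trans \<gamma>.sym by blast
    next
      case False
      then have q: "q \<in> orbit p" using exit_to_ideal[OF \<beta> 5(1,3) pq] by blast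
      show ?thesis
      proof (cases "(p, q) \<in> \<Theta>")
        case True
        then show ?thesis using pq int by blast
      next
        case notrel: False
        then have noQ: "\<not> Q (length p)" "distinct p"
          using outside[OF 5(1,3), of q] q by (auto simp: orbit_def)
        \<comment> \<open>the class of \<open>p\<close> in the join does not leave the orbit, where \<open>\<Theta>\<close> is trivial\<close>
        have stay: "(p, r) \<in> cjoin \<Theta> \<gamma> \<Longrightarrow> r \<in> orbit p" for r
        proof (rule ccontr)
          assume "(p, r) \<in> cjoin \<Theta> \<gamma>" "r \<notin> orbit p"
          then obtain z where "z \<in> Z" "(p, z) \<in> \<gamma>"
            using reaches_ideal[OF \<beta> \<gamma> int jo 5(1,3)] by blast
          then show False using into' 5(1) False by blast
        qed
        have "(p, r) \<in> \<gamma>" if "(p, r) \<in> (\<Theta> \<union> \<gamma>)\<^sup>*" for r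
          using that
        proof (induction rule: rtrancl_induct)
          case (step r s)
          have r: "r \<in> orbit p" using stay step.hyps(1) by (simp add: cjoin_def)
          have "(r, s) \<in> \<gamma>"
          proof (cases "(r, s) \<in> \<Theta>")
            case True
            have "r \<notin> Z" "r \<noteq> []" using orbit_outside[OF 5(1) r] r 5(3) by (auto simp: orbit_def)
            moreover have "length r = length p"
              using r by (auto simp: orbit_def distinct_card[symmetric])
            ultimately have "r = s" using outside[of r s] True noQ by simp
            then show ?thesis by simp
          qed (use step.hyps(2) in blast)
          then show ?case by (rule \<gamma>.trans[OF step.IH])
        qed simp
        moreover have "(p, q) \<in> (\<Theta> \<union> \<gamma>)\<^sup>*" using pq jo cjoin_upper(2) unfolding cjoin_def by blast
        ultimately show ?thesis by blast
      qed
    qed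
  qed
qed

theorem cancel: "cancel \<Theta>"
  unfolding cancel_def
proof (intro allI impI)
  fix \<beta> \<gamma> assume *: "ficong \<beta>" "ficong \<gamma>" "\<Theta> \<inter> \<beta> = \<Theta> \<inter> \<gamma>" "cjoin \<Theta> \<beta> = cjoin \<Theta> \<gamma>"
  show "\<beta> = \<gamma>"
    using included[OF *] included[OF *(2,1) *(3)[symmetric] *(4)[symmetric]] by blast
qed

end

section \<open>Necessity: separating identities\<close>

text \<open>The order of words in which \<open>w\<close> is above \<open>u\<close> iff \<open>w\<close> belongs to every verbal ideal that
  contains \<open>u\<close>.\<close>

definition occurs :: "word \<Rightarrow> word \<Rightarrow> bool" where
  "occurs u w \<longleftrightarrow> (\<exists>a \<sigma> b. nonerasing \<sigma> \<and> w = a @ substitute \<sigma> u @ b)"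

lemma occursI: "nonerasing \<sigma> \<Longrightarrow> w = a @ substitute \<sigma> u @ b \<Longrightarrow> occurs u w"
  unfolding occurs_def by (intro exI conjI)

lemma occurs_refl: "occurs w w"
  by (rule occursI[of "\<lambda>x. [x]" _ "[]" _ "[]"]) simp_all

lemma occurs_context: "occurs w (a @ w @ b)"
  by (rule occursI[of "\<lambda>x. [x]" _ a _ b]) simp_all

lemma occurs_substitute: "nonerasing \<sigma> \<Longrightarrow> occurs w (substitute \<sigma> w)"
  by (rule occursI[of \<sigma> _ "[]" _ "[]"]) simp_all

lemma occurs_map: "occurs w (map f w)"
  using occurs_substitute[of "\<lambda>x. [f x]" w] by (simp add: substitute_letters)

lemma occurs_trans:
  assumes "occurs u v" "occurs v w"
  shows "occurs u w"
proof -
  obtain a \<sigma> b where 1: "nonerasing \<sigma>" "v = a @ substitute \<sigma> u @ b" using assms(1) by (auto simp: occurs_def)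
  obtain c \<tau> d where 2: "nonerasing \<tau>" "w = c @ substitute \<tau> v @ d" using assms(2) by (auto simp: occurs_def)
  have "w = (c @ substitute \<tau> a) @ substitute (\<lambda>x. substitute \<tau> (\<sigma> x)) u @ (substitute \<tau> b @ d)"
    by (simp add: 1(2) 2(2) substitute_substitute)
  moreover have "nonerasing (\<lambda>x. substitute \<tau> (\<sigma> x))" using 1(1) 2(1) by simp
  ultimately show ?thesis by (intro occursI)
qed

lemma occurs_length: "occurs u w \<Longrightarrow> length u \<le> length w"
  unfolding occurs_def by (auto simp: length_substitute_ge trans_le_add1 trans_le_add2)

lemma (in verbal_ideal) occurs: "w \<in> Z \<Longrightarrow> occurs w v \<Longrightarrow> v \<in> Z"
  using mult sub unfolding occurs_def by blast

lemma nonlinear_pattern: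
  assumes xy: "x \<noteq> y" and w: "\<not> distinct w" "3 \<le> length w"
  shows "\<exists>u\<in>{[x, x, y], [x, y, x], [y, x, x]}. occurs u w"
proof -
  obtain a s b z where w': "w = a @ [z] @ s @ [z] @ b" using not_distinct_decomp[OF w(1)] by blast
  have pattern: "occurs u v" if "t \<noteq> []" "v = c @ substitute (\<lambda>i. if i = x then [z] else t) u @ d" for t c d u v
    by (rule occursI[OF _ that(2)]) (simp add: that(1))
  consider "s \<noteq> []" | "s = []" "b \<noteq> []" | "s = []" "b = []" "a \<noteq> []"
    using w' w(2) by (cases "s = []"; cases "b = []"; cases "a = []") auto
  then show ?thesis
  proof cases
    case 1
    then have "occurs [x, y, x] w" by (rule pattern[of s _ a _ b]) (use w' xy in simp)
    then show ?thesis by blast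
  next
    case 2
    have "occurs [x, x, y] w" by (rule pattern[OF 2(2), of _ a _ "[]"]) (use w' xy 2 in simp)
    then show ?thesis by blast
  next
    case 3
    have "occurs [y, x, x] w" by (rule pattern[OF 3(3), of _ "[]" _ "[]"]) (use w' xy 3 in simp)
    then show ?thesis by blast
  qed
qed

lemma length_substitute_eq_iff:
  assumes "nonerasing \<sigma>"
  shows "length (substitute \<sigma> w) = length w \<longleftrightarrow> (\<forall>x\<in>set w. length (\<sigma> x) = 1)"
proof (induction w)
  case (Cons x w)
  have "1 \<le> length (\<sigma> x)" "length w \<le> length (substitute \<sigma> w)"
    using assms length_substitute_ge[OF assms, of w] by (simp_all add: Suc_leI)
  then have "length (substitute \<sigma> (x # w)) = length (x # w) \<longleftrightarrow>
      length (\<sigma> x) = 1 \<and> length (substitute \<sigma> w) = length w"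
    by (simp only: substitute_simps length_append length_Cons) linarith
  then show ?case using Cons by simp
qed simp

lemma substitute_letterwise:
  assumes "\<forall>x\<in>set w. length (\<sigma> x) = 1"
  shows "substitute \<sigma> w = map (\<lambda>x. hd (\<sigma> x)) w"
proof -
  have "substitute \<sigma> w = substitute (\<lambda>x. [hd (\<sigma> x)]) w"
  proof (rule substitute_cong)
    fix x assume "x \<in> set w"
    then have "length (\<sigma> x) = Suc 0" using assms by simp
    then show "\<sigma> x = [hd (\<sigma> x)]" by (cases "\<sigma> x") auto
  qed
  then show ?thesis by (simp add: substitute_letters)
qed

lemma occurs_same_length:
  assumes "occurs u w" "length u = length w"
  shows "\<exists>f. w = map f u"
proof -
  obtain a \<sigma> b where 1: "nonerasing \<sigma>" "w = a @ substitute \<sigma> u @ b" using assms(1) by (auto simp: occurs_def)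
  have "length u \<le> length (substitute \<sigma> u)" by (rule length_substitute_ge[OF 1(1)])
  then have "a = []" "b = []" "length (substitute \<sigma> u) = length u" using 1(2) assms(2) by simp_all
  then have "w = map (\<lambda>x. hd (\<sigma> x)) u"
    using substitute_letterwise[of u \<sigma>] length_substitute_eq_iff[OF 1(1)] 1(2) by simp
  then show ?thesis by blast
qed

lemma inverse_renaming:
  assumes "inj_on \<rho> (set w)"
  shows "map (inv_into (set w) \<rho>) (map \<rho> w) = w"
  using assms by (induction w) (simp_all add: map_idI)

text \<open>The fully invariant congruence that collapses the ideal \<open>I\<close> and identifies \<open>u\<close> with \<open>v\<close>,
  provided that the proper consequences of \<open>u\<close> and \<open>v\<close> all lie in \<open>I\<close>.\<close>

definition merge :: "word set \<Rightarrow> word \<Rightarrow> word \<Rightarrow> (word \<times> word) set" where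
  "merge I u v = Id \<union> I \<times> I \<union> {(map \<rho> u, map \<rho> v) | \<rho>. inj_on \<rho> (set u)}
    \<union> {(map \<rho> v, map \<rho> u) | \<rho>. inj_on \<rho> (set u)}"

lemma ficong_merge:
  assumes "verbal_ideal I" and set_v: "set v = set u" and notin: "u \<notin> I" "v \<notin> I"
    and clash: "\<And>\<rho> \<rho>' :: nat \<Rightarrow> nat. inj_on \<rho> (set u) \<Longrightarrow> map \<rho> u = map \<rho>' v \<Longrightarrow> map \<rho> v = map \<rho>' u"
    and u_max: "\<And>w. occurs u w \<Longrightarrow> w \<notin> I \<Longrightarrow> \<exists>f. inj_on f (set u) \<and> w = map f u"
    and v_max: "\<And>w. occurs v w \<Longrightarrow> w \<notin> I \<Longrightarrow> \<exists>f. inj_on f (set u) \<and> w = map f v"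
  shows "ficong (merge I u v)"
proof -
  interpret I: verbal_ideal I by fact
  have ren_u: "map \<rho> u \<notin> I" if "inj_on \<rho> (set u)" for \<rho>
    using I.rename[of "map \<rho> u" "inv_into (set u) \<rho>"] inverse_renaming[of \<rho> u] that notin(1) by metis
  have ren_v: "map \<rho> v \<notin> I" if "inj_on \<rho> (set u)" for \<rho>
    using I.rename[of "map \<rho> v" "inv_into (set v) \<rho>"] inverse_renaming[of \<rho> v] that notin(2) set_v by metis
  have ne: "u = [] \<longleftrightarrow> v = []" using set_v by auto
  have same: "map \<rho> u = map \<rho>' u \<longleftrightarrow> map \<rho> v = map \<rho>' v" for \<rho> \<rho>' :: "nat \<Rightarrow> nat"
    using set_v by simp
  have sym': "(y, x) \<in> merge I u v" if "(x, y) \<in> merge I u v" for x y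
    using that unfolding merge_def by blast
  show ?thesis
  proof
    show "(w, w) \<in> merge I u v" for w by (simp add: merge_def)
    show "(y, x) \<in> merge I u v" if "(x, y) \<in> merge I u v" for x y by (rule sym'[OF that])
    show "v' = []" if "([], v') \<in> merge I u v" for v'
      using that I.nonempty ne by (auto simp: merge_def)
    show "(x, z) \<in> merge I u v" if xy: "(x, y) \<in> merge I u v" and yz: "(y, z) \<in> merge I u v" for x y z
    proof -
      consider "x = y" | "x \<in> I" "y \<in> I" | \<rho> where "inj_on \<rho> (set u)" "x = map \<rho> u" "y = map \<rho> v"
        | \<rho> where "inj_on \<rho> (set u)" "x = map \<rho> v" "y = map \<rho> u"
        using xy unfolding merge_def by blast
      then show ?thesis
      proof cases
        case 1
        then show ?thesis using yz by simp
      next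
        case 2
        then have "z \<in> I" using yz ren_u ren_v unfolding merge_def by blast
        then show ?thesis using 2 by (simp add: merge_def)
      next
        case 3
        consider "z = y" | "y \<in> I" | \<rho>' where "inj_on \<rho>' (set u)" "y = map \<rho>' u" "z = map \<rho>' v"
          | \<rho>' where "inj_on \<rho>' (set u)" "y = map \<rho>' v" "z = map \<rho>' u"
          using yz unfolding merge_def by blast
        then show ?thesis
        proof cases
          case 1
          then show ?thesis using xy by simp
        next
          case 2
          then show ?thesis using 3 ren_v by blast
        next
          case (3 \<rho>')
          then have "x = z" using clash[of \<rho>' \<rho>] \<open>x = map \<rho> u\<close> \<open>y = map \<rho> v\<close> by simp
          then show ?thesis by (simp add: merge_def)
        next
          case (4 \<rho>')
          then have "x = z" using same[of \<rho> \<rho>'] 3 by simp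
          then show ?thesis by (simp add: merge_def)
        qed
      next
        case 4
        consider "z = y" | "y \<in> I" | \<rho>' where "inj_on \<rho>' (set u)" "y = map \<rho>' u" "z = map \<rho>' v"
          | \<rho>' where "inj_on \<rho>' (set u)" "y = map \<rho>' v" "z = map \<rho>' u"
          using yz unfolding merge_def by blast
        then show ?thesis
        proof cases
          case 1
          then show ?thesis using xy by simp
        next
          case 2
          then show ?thesis using 4 ren_u by blast
        next
          case (3 \<rho>')
          then have "x = z" using same[of \<rho> \<rho>'] 4 by simp
          then show ?thesis by (simp add: merge_def)
        next
          case (4 \<rho>')
          then have "x = z" using clash[of \<rho> \<rho>'] \<open>inj_on \<rho> (set u)\<close> \<open>x = map \<rho> v\<close> \<open>y = map \<rho> u\<close> by simp
          then show ?thesis by (simp add: merge_def)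
        qed
      qed
    qed
    show "(a @ x @ b, a @ y @ b) \<in> merge I u v" if xy: "(x, y) \<in> merge I u v" for x y a b
    proof (cases "a = [] \<and> b = []")
      case True
      then show ?thesis using xy by simp
    next
      case False
      have inI: "a @ map \<rho> u @ b \<in> I" "a @ map \<rho> v @ b \<in> I" for \<rho>
      proof -
        have "occurs u (a @ map \<rho> u @ b)" "occurs v (a @ map \<rho> v @ b)"
          using occurs_trans[OF occurs_map occurs_context] by blast+
        moreover have "a @ map \<rho> u @ b \<noteq> map f u" "a @ map \<rho> v @ b \<noteq> map f v" for f
          using False by (metis add_is_0 add.commute add_diff_cancel_left' diff_self_eq_0 length_0_conv length_append length_map add.left_commute)+
        ultimately show "a @ map \<rho> u @ b \<in> I" "a @ map \<rho> v @ b \<in> I" using u_max v_max by blast+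
      qed
      show ?thesis
        using xy inI I.mult[of x a b] I.mult[of y a b] unfolding merge_def by blast
    qed
    show "(substitute \<sigma> x, substitute \<sigma> y) \<in> merge I u v"
      if xy: "(x, y) \<in> merge I u v" and \<sigma>: "nonerasing \<sigma>" for x y \<sigma>
    proof -
      have key: "(substitute \<sigma> (map \<rho> u), substitute \<sigma> (map \<rho> v)) \<in> merge I u v" for \<rho>
      proof -
        define \<tau> where "\<tau> x = \<sigma> (\<rho> x)" for x
        have \<tau>: "substitute \<sigma> (map \<rho> w) = substitute \<tau> w" for w
          by (induction w) (simp_all add: \<tau>_def)
        have ne\<tau>: "nonerasing \<tau>" using \<sigma> by (simp add: \<tau>_def)
        let ?f = "\<lambda>x. hd (\<tau> x)"
        show ?thesis
        proof (cases "(\<forall>x\<in>set u. length (\<tau> x) = 1) \<and> inj_on ?f (set u)")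
          case True
          then have "substitute \<tau> u = map ?f u" "substitute \<tau> v = map ?f v"
            using set_v by (intro substitute_letterwise; simp)+
          then show ?thesis using True unfolding \<tau> merge_def by blast
        next
          case False
          have "substitute \<tau> w \<in> I" if w: "set w = set u" "occurs w (substitute \<tau> w)"
            "substitute \<tau> w \<notin> I \<Longrightarrow> \<exists>f. inj_on f (set u) \<and> substitute \<tau> w = map f w" for w
          proof (rule ccontr)
            assume "substitute \<tau> w \<notin> I"
            then obtain f where f: "inj_on f (set u)" "substitute \<tau> w = map f w" using w(3) by blast
            then have "length (substitute \<tau> w) = length w" by simp
            then have 1: "\<forall>x\<in>set w. length (\<tau> x) = 1" using length_substitute_eq_iff[OF ne\<tau>] by simp
            then have "map ?f w = map f w" using f(2) substitute_letterwise[of w \<tau>] by simp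
            then have "inj_on ?f (set u)" using f(1) w(1) inj_on_cong[of "set u" ?f f] by simp
            then show False using False 1 w(1) by blast
          qed
          from this[of u] this[of v] have "substitute \<tau> u \<in> I" "substitute \<tau> v \<in> I"
            using occurs_substitute[OF ne\<tau>] u_max v_max set_v by blast+
          then show ?thesis unfolding \<tau> merge_def by blast
        qed
      qed
      show ?thesis
        using xy key sym'[OF key] I.sub[of x \<sigma>] I.sub[of y \<sigma>] \<sigma> unfolding merge_def by blast
    qed
  qed
qed

locale cancellable_congruence = ficong \<Theta> for \<Theta> +
  assumes cancel: "cancel \<Theta>"
begin

lemma cancelD:
  assumes "ficong \<beta>" "ficong \<gamma>" "\<Theta> \<inter> \<beta> = \<Theta> \<inter> \<gamma>" "\<beta> \<subseteq> cjoin \<Theta> \<gamma>" "\<gamma> \<subseteq> cjoin \<Theta> \<beta>"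
  shows "\<beta> = \<gamma>"
proof -
  have "cjoin \<Theta> \<beta> = cjoin \<Theta> \<gamma>"
    using cjoin_least[OF ficong_cjoin[OF ficong_axioms assms(2)] cjoin_upper(1) assms(4)]
      cjoin_least[OF ficong_cjoin[OF ficong_axioms assms(1)] cjoin_upper(1) assms(5)] by blast
  then show ?thesis using cancel assms(1-3) unfolding cancel_def by blast
qed

text \<open>Cancellable elements of a lattice are modular: the two sides have the same meet and join
  with \<open>\<Theta>\<close>.\<close>

lemma modular:
  assumes \<beta>: "ficong \<beta>" and \<gamma>: "ficong \<gamma>" and le: "\<beta> \<subseteq> \<gamma>"
    and uv: "(u, v) \<in> cjoin \<Theta> \<beta>" "(u, v) \<in> \<gamma>"
  shows "(u, v) \<in> cjoin \<beta> (\<Theta> \<inter> \<gamma>)"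
proof -
  note f = ficong_Int[OF ficong_axioms \<gamma>] and J = ficong_cjoin[OF ficong_axioms \<beta>]
  have sub: "cjoin \<beta> (\<Theta> \<inter> \<gamma>) \<subseteq> cjoin \<Theta> \<beta> \<inter> \<gamma>"
    using cjoin_least[OF ficong_Int[OF J \<gamma>], of \<beta> "\<Theta> \<inter> \<gamma>"] cjoin_upper[of \<beta> \<Theta>] cjoin_upper[of \<Theta> \<beta>] le by blast
  have "cjoin \<beta> (\<Theta> \<inter> \<gamma>) = cjoin \<Theta> \<beta> \<inter> \<gamma>"
  proof (rule cancelD)
    show "ficong (cjoin \<beta> (\<Theta> \<inter> \<gamma>))" by (rule ficong_cjoin[OF \<beta> f])
    show "ficong (cjoin \<Theta> \<beta> \<inter> \<gamma>)" by (rule ficong_Int[OF J \<gamma>])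
    show "\<Theta> \<inter> cjoin \<beta> (\<Theta> \<inter> \<gamma>) = \<Theta> \<inter> (cjoin \<Theta> \<beta> \<inter> \<gamma>)"
      using sub cjoin_upper(2)[of "\<Theta> \<inter> \<gamma>" \<beta>] by blast
    show "cjoin \<beta> (\<Theta> \<inter> \<gamma>) \<subseteq> cjoin \<Theta> (cjoin \<Theta> \<beta> \<inter> \<gamma>)" using sub cjoin_upper(2) by blast
    have "cjoin \<Theta> \<beta> \<subseteq> cjoin \<Theta> (cjoin \<beta> (\<Theta> \<inter> \<gamma>))"
    proof (rule cjoin_least[OF _ cjoin_upper(1)])
      show "ficong (cjoin \<Theta> (cjoin \<beta> (\<Theta> \<inter> \<gamma>)))" by (rule ficong_cjoin[OF ficong_axioms ficong_cjoin[OF \<beta> f]])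
      show "\<beta> \<subseteq> cjoin \<Theta> (cjoin \<beta> (\<Theta> \<inter> \<gamma>))" using cjoin_upper(1)[of \<beta>] cjoin_upper(2) by blast
    qed
    then show "cjoin \<Theta> \<beta> \<inter> \<gamma> \<subseteq> cjoin \<Theta> (cjoin \<beta> (\<Theta> \<inter> \<gamma>))" by blast
  qed
  then show ?thesis using uv by blast
qed

text \<open>Let \<open>I\<close> consist of the words below none of \<open>u\<close>, \<open>v\<close>, \<open>v'\<close> in the order of occurrence.
  Collapse \<open>I\<close>, and merge \<open>u\<close> with \<open>v\<close>, or alternatively with \<open>v'\<close>. Since \<open>\<Theta>\<close>
  relates \<open>v\<close> and \<open>v'\<close> but not \<open>u\<close> and \<open>v\<close>, the two congruences have the same join and the
  same intersection with \<open>\<Theta>\<close>; but they are different.\<close>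

lemma incomparable_impossible:
  assumes sets: "set v = set u" "set v' = set v" and len: "length v' = length v"
    and rel: "(v, v') \<in> \<Theta>" "v \<noteq> v'" "(u, v) \<notin> \<Theta>" and ne: "u \<noteq> []"
    and nocc: "\<not> occurs u v" "\<not> occurs v u" "\<not> occurs u v'" "\<not> occurs v' u"
  shows False
proof -
  define I where "I = {w. w \<noteq> [] \<and> \<not> occurs w u \<and> \<not> occurs w v \<and> \<not> occurs w v'}"
  have I: "verbal_ideal I"
  proof
    show "a @ w @ b \<in> I" if "w \<in> I" for w a b
      using that occurs_trans[OF occurs_context[of w a b]] by (auto simp: I_def)
    show "substitute \<sigma> w \<in> I" if "w \<in> I" "nonerasing \<sigma>" for w \<sigma>
      using that occurs_trans[OF occurs_substitute[of \<sigma> w]] by (auto simp: I_def)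
  qed (simp add: I_def)
  have renamed: "\<exists>f. inj_on f (set u) \<and> w = map f x" if x: "set x = set u" "occurs x w" "occurs w y" "set y = set u" "length y = length x" for x w y
  proof -
    have "length x = length w" "length w = length y"
      using occurs_length[OF x(2)] occurs_length[OF x(3)] x(5) by simp_all
    then obtain f g where f: "w = map f x" and g: "y = map g w"
      using occurs_same_length[OF x(2)] occurs_same_length[OF x(3)] by blast
    have "set u = (\<lambda>z. g (f z)) ` set u" using f g x(1,4) by (metis image_image set_map)
    then have "inj_on (\<lambda>z. g (f z)) (set u)" by (intro eq_card_imp_inj_on) simp_all
    then have "inj_on f (set u)" by (auto simp: inj_on_def)
    then show ?thesis using f by blast
  qed
  have u_max: "\<exists>f. inj_on f (set u) \<and> w = map f u" if "occurs u w" "w \<notin> I" for w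
  proof -
    have "w \<noteq> []" using occurs_length[OF that(1)] ne by auto
    then have "occurs w u" using that nocc occurs_trans[OF that(1)] by (auto simp: I_def)
    then show ?thesis using renamed[of u w u] that(1) by simp
  qed
  have v_max: "\<exists>f. inj_on f (set u) \<and> w = map f x" if "x = v \<or> x = v'" "occurs x w" "w \<notin> I" for w x
  proof -
    have "x \<noteq> []" using that(1) sets ne by auto
    then have "w \<noteq> []" using occurs_length[OF that(2)] by auto
    then have "occurs w v \<or> occurs w v'" using that nocc occurs_trans[OF that(2)] by (auto simp: I_def)
    then show ?thesis using renamed[OF _ that(2), of v] renamed[OF _ that(2), of v'] that(1) sets len by auto
  qed
  have notin: "u \<notin> I" "v \<notin> I" "v' \<notin> I" by (auto simp: I_def occurs_refl)
  have clash: "map \<rho> u \<noteq> map \<rho>' x" if "x = v \<or> x = v'" "inj_on \<rho> (set u)" for x and \<rho> \<rho>' :: "nat \<Rightarrow> nat"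
  proof
    assume "map \<rho> u = map \<rho>' x"
    then have "u = map (inv_into (set u) \<rho>) (map \<rho>' x)" using inverse_renaming[OF that(2)] by simp
    moreover have "occurs x (map (inv_into (set u) \<rho>) (map \<rho>' x))"
      by (rule occurs_trans[OF occurs_map occurs_map])
    ultimately show False using nocc(2,4) that(1) by metis
  qed
  have fm: "ficong (merge I u v)"
    by (rule ficong_merge[OF I sets(1) notin(1,2) _ u_max v_max]) (use clash in auto)
  have fm': "ficong (merge I u v')"
    by (rule ficong_merge[OF I _ notin(1,3) _ u_max v_max]) (use sets clash in auto)
  have notrel: "(map \<rho> u, map \<rho> x) \<notin> \<Theta>" if "inj_on \<rho> (set u)" "x = v \<or> x = v'" for \<rho> x
  proof
    assume "(map \<rho> u, map \<rho> x) \<in> \<Theta>"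
    then have "(map (inv_into (set u) \<rho>) (map \<rho> u), map (inv_into (set u) \<rho>) (map \<rho> x)) \<in> \<Theta>" by (rule rename)
    moreover have "set x = set u" using that(2) sets by auto
    ultimately have "(u, x) \<in> \<Theta>" using inverse_renaming[of \<rho> u] inverse_renaming[of \<rho> x] that(1) by simp
    then show False using that(2) rel(1,3) sym trans by blast
  qed
  have int: "\<Theta> \<inter> merge I u x = \<Theta> \<inter> (Id \<union> I \<times> I)" if "x = v \<or> x = v'" for x
    using notrel[OF _ that] sym unfolding merge_def by blast
  have ren: "(map \<rho> v, map \<rho> v') \<in> \<Theta>" for \<rho> using rename[OF rel(1)] .
  have up: "merge I u x \<subseteq> cjoin \<Theta> (merge I u y)" if xy: "(x = v \<and> y = v') \<or> (x = v' \<and> y = v)" for x y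
  proof -
    let ?J = "cjoin \<Theta> (merge I u y)"
    interpret J: ficong ?J using xy fm fm' ficong_cjoin[OF ficong_axioms] by blast
    have "(map \<rho> u, map \<rho> x) \<in> ?J" if "inj_on \<rho> (set u)" for \<rho>
    proof -
      have "(map \<rho> u, map \<rho> y) \<in> merge I u y" using that unfolding merge_def by blast
      moreover have "(map \<rho> y, map \<rho> x) \<in> \<Theta>" using ren[of \<rho>] sym xy by blast
      ultimately show ?thesis
        by (intro J.trans[OF subsetD[OF cjoin_upper(2)] subsetD[OF cjoin_upper(1)]])
    qed
    moreover have "Id \<union> I \<times> I \<subseteq> ?J" using cjoin_upper(2)[of "merge I u y" \<Theta>] unfolding merge_def by blast
    ultimately show ?thesis using J.sym unfolding merge_def[of I u x] by blast
  qed
  have "merge I u v = merge I u v'"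
    by (rule cancelD[OF fm fm']) (use int up in simp_all)
  moreover have "(u, v) \<in> merge I u v"
  proof -
    have "(map id u, map id v) \<in> merge I u v" unfolding merge_def using inj_on_id by blast
    then show ?thesis by simp
  qed
  ultimately have "(u, v) \<in> merge I u v'" by simp
  then consider "u = v" | "u \<in> I" | \<rho> where "u = map \<rho> u" "v = map \<rho> v'" | \<rho> where "u = map \<rho> v'"
    unfolding merge_def by blast
  then show False
  proof cases
    case 1
    then show False using nocc(1) occurs_refl by simp
  next
    case 2
    then show False using notin by blast
  next
    case 3
    then have "\<rho> z = z" if "z \<in> set v'" for z using that sets by (metis map_eq_conv map_ident)
    then have "v = v'" using 3(2) by (simp add: map_idI)
    then show False using rel(2) by blast
  next
    case 4
    then show False using nocc(4) occurs_map by metis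
  qed
qed

end

section \<open>Necessity: the ideal of zero words\<close>

text \<open>The larger of two congruences that collapse the words longer than \<open>k\<close>; it also
  identifies words of length \<open>k\<close> with the same letters.\<close>

definition content_at :: "nat \<Rightarrow> (word \<times> word) set" where
  "content_at k = {(u, v). u = v \<or> k < length u \<and> k < length v \<or>
     length u = k \<and> length v = k \<and> set u = set v}"

definition longer_than :: "nat \<Rightarrow> (word \<times> word) set" where
  "longer_than k = {(u, v). u = v \<or> k < length u \<and> k < length v}"

lemma ficong_longer_than: "ficong (longer_than k)"
proof
  show "(substitute \<sigma> u, substitute \<sigma> v) \<in> longer_than k"
    if "(u, v) \<in> longer_than k" "nonerasing \<sigma>" for u v \<sigma>
    using that length_substitute_ge[OF that(2), of u] length_substitute_ge[OF that(2), of v]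
    by (auto simp: longer_than_def)
qed (auto simp: longer_than_def)

lemma ficong_content_at: "ficong (content_at k)"
proof
  show "(substitute \<sigma> u, substitute \<sigma> v) \<in> content_at k"
    if uv: "(u, v) \<in> content_at k" and \<sigma>: "nonerasing \<sigma>" for u v \<sigma>
  proof -
    note ge = length_substitute_ge[OF \<sigma>, of u] length_substitute_ge[OF \<sigma>, of v]
    consider "u = v" | "k < length u" "k < length v" | "length u = k" "length v = k" "set u = set v"
      using uv by (auto simp: content_at_def)
    then show ?thesis
    proof cases
      case 3
      then have "length (substitute \<sigma> u) = k \<longleftrightarrow> length (substitute \<sigma> v) = k"
        using length_substitute_eq_iff[OF \<sigma>, of u] length_substitute_eq_iff[OF \<sigma>, of v] by simp
      then show ?thesis using 3 ge set_substitute[of \<sigma> u] set_substitute[of \<sigma> v]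
        unfolding content_at_def by fastforce
    qed (use ge in \<open>auto simp: content_at_def\<close>)
  qed
  show "(a @ u @ b, a @ v @ b) \<in> content_at k" if "(u, v) \<in> content_at k" for u v a b
    using that by (auto simp: content_at_def)
  show "(w, w) \<in> content_at k" for w by (simp add: content_at_def)
  show "(v, u) \<in> content_at k" if "(u, v) \<in> content_at k" for u v
    using that unfolding content_at_def mem_Collect_eq case_prod_conv by (elim disjE conjE) simp_all
  show "(u, w) \<in> content_at k" if "(u, v) \<in> content_at k" "(v, w) \<in> content_at k" for u v w
    using that unfolding content_at_def mem_Collect_eq case_prod_conv by (elim disjE conjE) simp_all
  show "v = []" if "([], v) \<in> content_at k" for v
    using that unfolding content_at_def mem_Collect_eq case_prod_conv by (elim disjE conjE) simp_all
qed

lemma length_substitute_double: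
  "length (substitute (replace x [x, x]) w) = length w + count_list w x"
  by (induction w) auto

lemma count_list_two_letters:
  assumes "set q = {0, 1}" "set (map f q) = {0, 1::nat}"
  shows "count_list (map f q) 0 = count_list q 0 \<or> count_list (map f q) 0 = count_list q 1"
proof -
  have img: "f ` {0, 1} = {0, 1}" using assms by (metis set_map)
  then have ne: "f 0 \<noteq> f 1" "f 0 = 0 \<or> f 1 = 0" by (auto simp: doubleton_eq_iff)
  then have inj: "inj_on f (set q)" using assms(1) by (auto simp: inj_on_def)
  have "f 0 = 0 \<or> f 1 = 0" by (rule ne(2))
  then show ?thesis
    using count_list_inj_map[OF inj, of 0] count_list_inj_map[OF inj, of 1] assms(1) by auto
qed

context cancellable_congruence
begin

text \<open>\<open>p\<close> and \<open>q\<close> are related in the join of \<open>\<Theta>\<close> and \<open>longer_than (length p)\<close>, via \<open>p'\<close>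
  and \<open>q'\<close>. By modularity \<open>\<Theta>\<close> itself must connect them within their length.\<close>

lemma collapse:
  assumes p: "(p, p') \<in> \<Theta>" "length p < length p'" and q: "(q, q') \<in> \<Theta>" "length q < length q'"
    and pq: "length p = length q" "set p = set q"
  shows "(p, q) \<in> \<Theta>"
proof -
  let ?k = "length p"
  let ?\<beta> = "longer_than ?k" and ?\<gamma> = "content_at ?k"
  have "(p', q') \<in> ?\<beta>" using p(2) q(2) pq(1) by (simp add: longer_than_def)
  then have "(p, q) \<in> cjoin \<Theta> ?\<beta>"
    using p(1) sym[OF q(1)] unfolding cjoin_def
    by (meson UnI1 UnI2 converse_rtrancl_into_rtrancl r_into_rtrancl)
  moreover have "(p, q) \<in> ?\<gamma>" using pq by (simp add: content_at_def)
  moreover have "?\<beta> \<subseteq> ?\<gamma>" by (auto simp: longer_than_def content_at_def)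
  ultimately have "(p, q) \<in> cjoin ?\<beta> (\<Theta> \<inter> ?\<gamma>)"
    using modular[OF ficong_longer_than ficong_content_at] by blast
  then have "(p, q) \<in> (?\<beta> \<union> \<Theta> \<inter> ?\<gamma>)\<^sup>*" by (simp add: cjoin_def)
  then have "length q = ?k \<and> (p, q) \<in> \<Theta>"
  proof (induction rule: rtrancl_induct)
    case (step y z)
    then consider "y = z" | "(y, z) \<in> \<Theta>" "length z = ?k"
      by (auto simp: longer_than_def content_at_def)
    then show ?case using step.IH trans by cases auto
  qed simp
  then show ?thesis by blast
qed

text \<open>Suppose that all identities of \<open>\<Theta>\<close> are balanced, and let \<open>u \<approx> v\<close> be a
  nontrivial one in two letters. Appending powers of the letters, one much longer than the
  other, gives \<open>p \<approx> p'\<close>, and also \<open>q\<close> of the same length with slightly different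
  numbers of occurrences. Even if the letters are exchanged, the numbers of \<open>q\<close> are not
  those of \<open>p\<close>, so \<open>q\<close> is incomparable with \<open>p\<close> and \<open>p'\<close>, and balance keeps \<open>q\<close> apart from
  them.\<close>

lemma unbalanced:
  assumes "\<Theta> \<noteq> Id"
  shows "\<exists>u v. (u, v) \<in> \<Theta> \<and> mset u \<noteq> mset v"
proof (rule ccontr)
  assume "\<not> ?thesis"
  then have bal: "mset u = mset v" if "(u, v) \<in> \<Theta>" for u v using that by blast
  obtain u0 v0 where uv0: "(u0, v0) \<in> \<Theta>" "u0 \<noteq> v0" using assms refl by fast
  have "length u0 = length v0" using bal[OF uv0(1)] by (metis size_mset)
  then obtain i where i: "i < length u0" "u0 ! i \<noteq> v0 ! i" using uv0(2) nth_equalityI by blast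
  define f where "f z = (if z = u0 ! i then 0 else 1 :: nat)" for z
  define u v where "u = map f u0" and "v = map f v0"
  have uv: "(u, v) \<in> \<Theta>" using rename[OF uv0(1)] by (simp add: u_def v_def)
  have "u ! i = 0" "v ! i = 1" using i \<open>length u0 = length v0\<close> by (simp_all add: u_def v_def f_def)
  then have "u \<noteq> v" by auto
  have set01: "set u \<subseteq> {0, 1}" "set v \<subseteq> {0, 1}" by (auto simp: u_def v_def f_def)
  define k where "k = Suc (length u)"
  define p p' q where "p = u @ replicate k 0 @ replicate (3 * k + 1) 1"
    and "p' = v @ replicate k 0 @ replicate (3 * k + 1) 1"
    and "q = u @ replicate (k + 1) 0 @ replicate (3 * k) 1"
  have count_rep: "count_list (replicate n a) b = (if a = b then n else 0)" for n and a b :: nat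
    by (induction n) auto
  have le: "count_list u 0 < k" "count_list u 1 < k"
    using count_le_length[of u 0] count_le_length[of u 1] by (simp_all add: k_def)
  have cp: "count_list p 0 = count_list u 0 + k" "count_list p 1 = count_list u 1 + 3 * k + 1"
    by (simp_all add: p_def count_list_append count_rep)
  have cq: "count_list q 0 = count_list u 0 + k + 1" "count_list q 1 = count_list u 1 + 3 * k"
    by (simp_all add: q_def count_list_append count_rep)
  have "count_list u z = count_list v z" for z using bal[OF uv] by (metis count_mset)
  then have cp': "count_list p' z = count_list p z" for z by (simp add: p_def p'_def count_list_append)
  have k0: "k \<noteq> 0" by (simp add: k_def)
  have sets: "set p = {0, 1}" "set p' = {0, 1}" "set q = {0, 1}"
    using set01 k0 by (auto simp: p_def p'_def q_def set_replicate_conv_if)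
  have lens: "length p = length q" "length p' = length q" "length p' = length p"
    using bal[OF uv] by (auto simp: p_def p'_def q_def dest: mset_eq_length)
  have nocc: "\<not> occurs q r" "\<not> occurs r q"
    if r: "set r = {0, 1}" "length r = length q" "\<And>z. count_list r z = count_list p z" for r
  proof -
    show "\<not> occurs q r"
    proof
      assume "occurs q r"
      then obtain g where "r = map g q" using occurs_same_length[of q r] r(2) by auto
      then show False using count_list_two_letters[of q g] sets(3) r cp cq le by auto
    qed
    show "\<not> occurs r q"
    proof
      assume "occurs r q"
      then obtain g where "q = map g r" using occurs_same_length[of r q] r(2) by auto
      then show False using count_list_two_letters[of r g] sets(3) r cp cq le by auto
    qed
  qed
  have pp': "(p, p') \<in> \<Theta>" unfolding p_def p'_def by (rule right[OF uv])
  have "(q, p) \<notin> \<Theta>"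
  proof
    assume "(q, p) \<in> \<Theta>"
    then have "count_list q 0 = count_list p 0" using bal by (metis count_mset)
    then show False using cp cq by simp
  qed
  moreover have "p \<noteq> p'" using \<open>u \<noteq> v\<close> by (simp add: p_def p'_def)
  moreover have "q \<noteq> []" using k0 by (simp add: q_def)
  ultimately show False
    using incomparable_impossible[of p q p'] sets lens pp' nocc[of p] nocc[of p'] cp' by simp
qed

text \<open>Doubling a letter whose numbers of occurrences differ makes the lengths differ.\<close>

lemma periodic:
  assumes "\<Theta> \<noteq> Id"
  shows "\<exists>n m. 0 < n \<and> n < m \<and> (\<forall>t. (word_power t n, word_power t m) \<in> \<Theta>)"
proof -
  obtain u v where uv: "(u, v) \<in> \<Theta>" "mset u \<noteq> mset v" using unbalanced[OF assms] by blast
  have "\<exists>u v. (u, v) \<in> \<Theta> \<and> length u \<noteq> length v"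
  proof (cases "length u = length v")
    case True
    have "\<exists>x. count_list u x \<noteq> count_list v x"
      using uv(2) by (metis count_mset multiset_eqI)
    then obtain x where "count_list u x \<noteq> count_list v x" by blast
    then have "length (substitute (replace x [x, x]) u) \<noteq> length (substitute (replace x [x, x]) v)"
      using True by (simp only: length_substitute_double)
    moreover have "nonerasing (replace x [x, x])" by simp
    ultimately show ?thesis using sub[OF uv(1)] by blast
  qed (use uv in blast)
  then obtain u v where uv: "(u, v) \<in> \<Theta>" "length u < length v"
    using sym by (metis nat_neq_iff)
  have "u \<noteq> []" using uv Nil by auto
  then show ?thesis using uv power_of_length[OF uv(1)] by (intro exI[of _ "length u"] exI[of _ "length v"]) simp
qed

end

definition power_ideal :: "nat \<Rightarrow> word set" where
  "power_ideal N = {w. \<exists>a t b. t \<noteq> [] \<and> w = a @ word_power t N @ b}"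

lemma power_idealI: "t \<noteq> [] \<Longrightarrow> a @ word_power t N @ b \<in> power_ideal N"
  by (auto simp: power_ideal_def)

lemma power_ideal_antimono:
  assumes "n \<le> N"
  shows "power_ideal N \<subseteq> power_ideal n"
proof
  fix w assume "w \<in> power_ideal N"
  then obtain a t b where w: "t \<noteq> []" "w = a @ word_power t N @ b" by (auto simp: power_ideal_def)
  have "word_power t N = word_power t n @ word_power t (N - n)" using word_power_add[of t n "N - n"] assms by simp
  then have "w = a @ word_power t n @ (word_power t (N - n) @ b)" using w by simp
  then show "w \<in> power_ideal n" using power_idealI[OF w(1)] by metis
qed

context cancellable_congruence
begin

lemma collapse_power_ideal:
  assumes per: "\<And>t. (word_power t n, word_power t m) \<in> \<Theta>" "n < m"
    and pq: "p \<in> power_ideal n" "q \<in> power_ideal n" "length p = length q" "set p = set q"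
  shows "(p, q) \<in> \<Theta>"
proof -
  have longer: "\<exists>w'. (w, w') \<in> \<Theta> \<and> length w < length w'" if wn: "w \<in> power_ideal n" for w
  proof -
    obtain a t b where w: "t \<noteq> []" "w = a @ word_power t n @ b" using wn by (auto simp: power_ideal_def)
    have "(w, a @ word_power t m @ b) \<in> \<Theta>" unfolding w(2) by (rule ctx[OF per(1)])
    moreover have "length w < length (a @ word_power t m @ b)" using w per(2) by simp
    ultimately show ?thesis by blast
  qed
  show ?thesis using longer[OF pq(1)] longer[OF pq(2)] collapse pq(3,4) by blast
qed

text \<open>Both \<open>(x y)\<^sup>k\<close> and \<open>x\<^sup>2\<^sup>k\<^sup>-\<^sup>1 y\<close> contain \<open>n\<close>-th powers, so
  they are related by \<open>collapse\<close>. With \<open>xx\<close> for \<open>y\<close> this becomes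
  \<open>x\<^sup>3\<^sup>k \<approx> x\<^sup>2\<^sup>k\<^sup>+\<^sup>1\<close>. The law for \<open>k = n\<close>,
  multiplied by \<open>x\<^sup>3\<close>, and the law for \<open>k = n + 1\<close> have the same left side, and
  their right sides are successive powers.\<close>

lemma aperiodic:
  assumes "\<Theta> \<noteq> Id"
  shows "\<exists>N. 0 < N \<and> (\<forall>t. (word_power t N, word_power t (Suc N)) \<in> \<Theta>)"
proof -
  obtain n m where nm: "0 < n" "n < m" and per: "\<And>t. (word_power t n, word_power t m) \<in> \<Theta>"
    using periodic[OF assms] by blast
  have step: "(replicate (3 * k) 0, replicate (2 * k + 1) 0) \<in> \<Theta>" if k: "n \<le> k" for k
  proof -
    have "(word_power [0, 1] k, replicate (2 * k - 1) 0 @ [1]) \<in> \<Theta>"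
    proof (rule collapse_power_ideal[OF per nm(2)])
      have "[] @ word_power [0, 1] k @ [] \<in> power_ideal k" by (rule power_idealI) simp
      then show "word_power [0, 1] k \<in> power_ideal n" using power_ideal_antimono[OF k] by auto
      have "[] @ word_power [0] (2 * k - 1) @ [1] \<in> power_ideal (2 * k - 1)" by (rule power_idealI) simp
      moreover have "n \<le> 2 * k - 1" using k nm(1) by linarith
      ultimately show "replicate (2 * k - 1) 0 @ [1] \<in> power_ideal n"
        using power_ideal_antimono by (auto simp: word_power_letter)
      show "length (word_power [0, 1] k) = length (replicate (2 * k - 1) (0::nat) @ [1])"
        using k nm(1) by simp
      show "set (word_power [0, 1] k) = set (replicate (2 * k - 1) (0::nat) @ [1])"
        using k nm(1) by (auto simp: set_power set_replicate_conv_if)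
    qed
    moreover have "nonerasing (\<lambda>z. if z = 1 then [0, 0] else [0])" by simp
    ultimately have "(substitute (\<lambda>z. if z = 1 then [0, 0] else [0]) (word_power [0, 1] k),
        substitute (\<lambda>z. if z = 1 then [0, 0] else [0]) (replicate (2 * k - 1) 0 @ [1])) \<in> \<Theta>"
      by (rule sub)
    moreover have "word_power [0, 0, 0] k = replicate (3 * k) (0::nat)" by (induction k) (simp_all add: numeral_3_eq_3)
    moreover have "replicate (2 * k - 1) 0 @ [0, 0] = replicate (2 * k + 1) (0::nat)"
    proof -
      have "replicate (2 * k - 1) 0 @ replicate 2 0 = replicate (2 * k - 1 + 2) (0::nat)" by (simp only: replicate_add)
      moreover have "2 * k - 1 + 2 = 2 * k + 1" using k nm(1) by linarith
      ultimately show ?thesis by (simp add: numeral_2_eq_2)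
    qed
    ultimately show ?thesis
      by (simp add: substitute_power substitute_replicate word_power_letter)
  qed
  have add: "replicate 3 0 @ replicate k 0 = replicate (k + 3) (0::nat)" for k
    by (simp only: replicate_add[symmetric] add.commute)
  have "(replicate 3 0 @ replicate (3 * n) 0, replicate 3 0 @ replicate (2 * n + 1) 0) \<in> \<Theta>"
    by (rule left[OF step]) simp
  moreover have e: "(2 * n + 1) + 3 = Suc (2 * n + 3)" "3 * Suc n = 3 * n + 3" "2 * Suc n + 1 = 2 * n + 3"
    by simp_all
  ultimately have 1: "(replicate (3 * n + 3) 0, replicate (Suc (2 * n + 3)) 0) \<in> \<Theta>"
    by (simp only: add)
  have "(replicate (3 * Suc n) 0, replicate (2 * Suc n + 1) 0) \<in> \<Theta>" by (rule step) simp
  then have 2: "(replicate (3 * n + 3) 0, replicate (2 * n + 3) 0) \<in> \<Theta>" by (simp only: e)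
  have "(replicate (2 * n + 3) 0, replicate (Suc (2 * n + 3)) 0) \<in> \<Theta>" by (rule trans[OF sym[OF 2] 1])
  from power_of_length[OF this] have "(word_power t (2 * n + 3), word_power t (Suc (2 * n + 3))) \<in> \<Theta>" for t
    by (simp only: length_replicate)
  moreover have "0 < 2 * n + 3" by simp
  ultimately show ?thesis by blast
qed

text \<open>By \<open>collapse_power_ideal\<close> such a word is related to \<open>x\<^sup>N\<^sup>+\<^sup>e c\<close>, where
  \<open>c\<close> lists the letters other than \<open>x\<close> and \<open>e\<close> adjusts the length; then
  \<open>t\<^sup>N\<^sup>+\<^sup>1 \<approx> t\<^sup>N\<close> removes \<open>e\<close>.\<close>

lemma power_ideal_same_letters:
  assumes N: "0 < N" and per: "\<And>t. (word_power t N, word_power t (Suc N)) \<in> \<Theta>"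
    and pq: "p \<in> power_ideal N" "q \<in> power_ideal N" "set p = set q"
  shows "(p, q) \<in> \<Theta>"
proof -
  have "p \<noteq> []" using pq(1) N by (auto simp: power_ideal_def word_power_eq_Nil)
  then obtain x where x: "x \<in> set p" by (cases p) auto
  obtain c where c: "set c = set p - {x}" "distinct c"
    using finite_distinct_list[of "set p - {x}"] by auto
  have E: "(replicate (N + e) x @ c, replicate N x @ c) \<in> \<Theta>" for e
  proof (induction e)
    case (Suc e)
    have "(word_power [x] e @ word_power [x] (Suc N) @ c, word_power [x] e @ word_power [x] N @ c) \<in> \<Theta>"
      by (rule ctx[OF sym[OF per]])
    then have "(word_power [x] (e + Suc N) @ c, word_power [x] (e + N) @ c) \<in> \<Theta>"
      by (simp only: word_power_add append.assoc)
    then have "(replicate (N + Suc e) x @ c, replicate (N + e) x @ c) \<in> \<Theta>"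
      by (simp only: word_power_letter add_Suc_right add_Suc add.commute[of e N])
    then show ?case using Suc by (rule trans)
  qed simp
  have "(w, replicate N x @ c) \<in> \<Theta>" if w: "w \<in> power_ideal N" "set w = set p" for w
  proof -
    obtain a t b where t: "t \<noteq> []" "w = a @ word_power t N @ b" using w(1) by (auto simp: power_ideal_def)
    have "card (set w) = length c + 1"
      using c x w(2) distinct_card[OF c(2)] card_Suc_Diff1[of "set p" x] by simp
    moreover have "set w = set (a @ t @ b)" using t N by (simp add: set_power)
    then have "card (set w) \<le> length a + length t + length b" using card_length[of "a @ t @ b"] by simp
    moreover have "length t + (N - 1) \<le> N * length t"
    proof -
      have "length t + (N - 1) * 1 \<le> length t + (N - 1) * length t"
        using t(1) by (intro add_left_mono mult_left_mono) (simp_all add: Suc_leI)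
      also have "\<dots> = N * length t" using N by (cases N) simp_all
      finally show ?thesis by simp
    qed
    ultimately have "N + length c \<le> length w" using t(2) N by simp
    then obtain e where e: "length w = N + e + length c" by (metis add.assoc add.commute le_Suc_ex)
    have "(w, replicate (N + e) x @ c) \<in> \<Theta>"
    proof (rule collapse_power_ideal[OF per lessI w(1)])
      have "[] @ word_power [x] (N + e) @ c \<in> power_ideal (N + e)" by (rule power_idealI) simp
      then show "replicate (N + e) x @ c \<in> power_ideal N"
        using power_ideal_antimono[of N "N + e"] by (auto simp: word_power_letter)
      show "length w = length (replicate (N + e) x @ c)" using e by simp
      show "set w = set (replicate (N + e) x @ c)"
        using c(1) x w(2) N by (auto simp: set_replicate_conv_if)
    qed
    then show ?thesis using E trans by blast
  qed
  from this[OF pq(1) HOL.refl] this[OF pq(2) pq(3)[symmetric]] show ?thesis using trans sym by blast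
qed

end

locale aperiodic_congruence = cancellable_congruence \<Theta> for \<Theta> +
  fixes N :: nat
  assumes N_pos: "0 < N" and per: "(word_power t N, word_power t (Suc N)) \<in> \<Theta>"
begin

text \<open>The words that turn out to be the zero words of \<open>\<Theta>\<close>, up to their letters in the
  case of a congruence below \<open>same_letters\<close>.\<close>

definition Z :: "word set" where
  "Z = {w. \<exists>w'\<in>power_ideal N. (w, w') \<in> \<Theta>}"

lemma power_in_Z: "t \<noteq> [] \<Longrightarrow> a @ word_power t N @ b \<in> Z"
  using power_idealI[of t a N b] refl by (auto simp: Z_def)

lemma Z_saturated: "(u, v) \<in> \<Theta> \<Longrightarrow> u \<in> Z \<Longrightarrow> v \<in> Z"
  unfolding Z_def using trans sym by blast

sublocale Z: verbal_ideal Z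
proof
  show "[] \<notin> Z"
  proof
    assume "[] \<in> Z"
    then obtain w' where w': "w' \<in> power_ideal N" "([], w') \<in> \<Theta>" by (auto simp: Z_def)
    then show False using Nil[OF w'(2)] N_pos by (auto simp: power_ideal_def word_power_eq_Nil)
  qed
  show "a @ w @ b \<in> Z" if w: "w \<in> Z" for w a b
  proof -
    obtain c t d where t: "t \<noteq> []" "(w, c @ word_power t N @ d) \<in> \<Theta>"
      using w by (auto simp: Z_def power_ideal_def)
    have "(a @ w @ b, (a @ c) @ word_power t N @ (d @ b)) \<in> \<Theta>" using ctx[OF t(2), of a b] by simp
    then show ?thesis unfolding Z_def using power_idealI[OF t(1)] by blast
  qed
  show "substitute \<sigma> w \<in> Z" if w: "w \<in> Z" and \<sigma>: "nonerasing \<sigma>" for w \<sigma>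
  proof -
    obtain c t d where t: "t \<noteq> []" "(w, c @ word_power t N @ d) \<in> \<Theta>"
      using w by (auto simp: Z_def power_ideal_def)
    have "(substitute \<sigma> w, substitute \<sigma> c @ word_power (substitute \<sigma> t) N @ substitute \<sigma> d) \<in> \<Theta>"
      using sub[OF t(2) \<sigma>] by (simp add: substitute_power)
    moreover have "substitute \<sigma> t \<noteq> []" using t(1) \<sigma> by simp
    ultimately show ?thesis unfolding Z_def using power_idealI by blast
  qed
qed

text \<open>If \<open>\<Theta>\<close> relates words with different letters, then \<open>x\<^sup>N\<close> absorbs words with
  arbitrary further letters, so all words of the ideal are related to words with the same
  letters.\<close>

lemma power_ideal_related:
  assumes "\<not> \<Theta> \<subseteq> same_letters" and p: "p \<in> power_ideal N"
  shows "(p, word_power [0] N) \<in> \<Theta>"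
proof -
  note J = power_ideal_same_letters[OF N_pos per]
  have in_J: "word_power t N @ b \<in> power_ideal N" if "t \<noteq> []" for t b
    using power_idealI[OF that, of "[]" N b] by simp
  obtain a b where "(a, b) \<in> \<Theta>" "set a \<noteq> set b" using assms(1) by (auto simp: same_letters_def)
  then obtain L where L: "\<And>u t. u \<noteq> [] \<Longrightarrow> t \<noteq> [] \<Longrightarrow> \<exists>w. (word_power u L, w) \<in> \<Theta> \<and> set w = set u \<union> set t"
    using power_with_more_letters[OF ficong_axioms] by blast
  have pne: "p \<noteq> []" using p N_pos by (auto simp: power_ideal_def word_power_eq_Nil)
  have enlarge: "\<exists>w. (word_power u N, word_power u N @ w) \<in> \<Theta> \<and> set w = set u \<union> set t" if ut: "u \<noteq> []" "t \<noteq> []" for u t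
  proof -
    obtain w where w: "(word_power u L, w) \<in> \<Theta>" "set w = set u \<union> set t" using L[OF ut] by blast
    have "(word_power u N, word_power u N @ word_power u L) \<in> \<Theta>"
      using J[OF in_J[OF ut(1), of "[]"] in_J[OF ut(1)]] N_pos by (simp add: set_power)
    then show ?thesis using trans left[OF w(1)] w(2) by blast
  qed
  obtain w where w: "(word_power [0] N, word_power [0] N @ w) \<in> \<Theta>" "set w = {0} \<union> set p"
    using enlarge[of "[0]" p] pne by auto
  obtain w' where w': "(word_power p N, word_power p N @ w') \<in> \<Theta>" "set w' = set p \<union> {0}"
    using enlarge[of p "[0]"] pne by auto
  have "(p, word_power p N) \<in> \<Theta>"
    using J[OF p in_J[OF pne, of "[]"]] N_pos by (simp add: set_power)
  moreover have "(word_power p N @ w', word_power [0] N @ w) \<in> \<Theta>"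
    by (rule J[OF in_J[OF pne] in_J]) (use w w' N_pos in \<open>auto simp: set_power\<close>)
  ultimately show ?thesis using w(1) w'(1) trans sym by blast
qed

lemma Z_cases:
  "(\<forall>u\<in>Z. \<forall>v\<in>Z. (u, v) \<in> \<Theta>) \<or>
    (\<Theta> \<subseteq> same_letters \<and> (\<forall>u\<in>Z. \<forall>v\<in>Z. set u = set v \<longrightarrow> (u, v) \<in> \<Theta>))"
proof (cases "\<Theta> \<subseteq> same_letters")
  case True
  have "(u, v) \<in> \<Theta>" if uv: "u \<in> Z" "v \<in> Z" "set u = set v" for u v
  proof -
    obtain u' v' where u': "u' \<in> power_ideal N" "(u, u') \<in> \<Theta>" and v': "v' \<in> power_ideal N" "(v, v') \<in> \<Theta>"
      using uv(1,2) by (auto simp: Z_def)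
    have "set u = set u'" "set v = set v'" using True u'(2) v'(2) by (auto simp: same_letters_def)
    then have "(u', v') \<in> \<Theta>" using power_ideal_same_letters[OF N_pos per u'(1) v'(1)] uv(3) by simp
    then show ?thesis using u'(2) v'(2) trans sym by blast
  qed
  then show ?thesis using True by blast
next
  case False
  have "(u, word_power [0] N) \<in> \<Theta>" if u: "u \<in> Z" for u
  proof -
    obtain u' where u': "u' \<in> power_ideal N" "(u, u') \<in> \<Theta>" using u by (auto simp: Z_def)
    show ?thesis by (rule trans[OF u'(2) power_ideal_related[OF False u'(1)]])
  qed
  then show ?thesis using trans sym by blast
qed

lemma Z_same_letters: "u \<in> Z \<Longrightarrow> v \<in> Z \<Longrightarrow> set u = set v \<Longrightarrow> (u, v) \<in> \<Theta>"
  using Z_cases by blast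

text \<open>\<open>v\<close> is related to the word \<open>v'\<close> that arises by exchanging the two letters, and different
  from it. If \<open>u\<close> did not occur in \<open>v\<close>, then it would be incomparable with both, as no
  word of \<open>Z\<close> occurs in \<open>u\<close>.\<close>

lemma two_letter_comparable:
  assumes u: "u \<notin> Z" "set u = {0, 1}" and v: "v \<in> Z" "set v = {0, 1}"
  shows "occurs u v"
proof (rule ccontr)
  assume nocc: "\<not> occurs u v"
  define f where "f z = (if z = 0 then 1 else 0 :: nat)" for z :: nat
  define v' where "v' = map f v"
  have v': "v' \<in> Z" unfolding v'_def by (rule Z.rename[OF v(1)])
  have set': "set v' = {0, 1}" using v(2) by (auto simp: v'_def f_def)
  have "map f (map f v) = v" unfolding map_map by (rule map_idI) (use v(2) in \<open>auto simp: f_def\<close>)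
  then have v_v': "occurs v' v" using occurs_map[of v' f] by (simp only: v'_def)
  have "0 \<in> set v" "0 \<in> set u" using v(2) u(2) by simp_all
  then have "v \<noteq> []" "u \<noteq> []" by auto
  then have "hd v' = f (hd v)" by (simp add: v'_def hd_map)
  then have ne: "v \<noteq> v'" by (auto simp: f_def split: if_splits)
  show False
  proof (rule incomparable_impossible[of v u v'])
    show "set v = set u" "set v' = set v" using u(2) v(2) set' by simp_all
    show "length v' = length v" by (simp add: v'_def)
    show "(v, v') \<in> \<Theta>" by (rule Z_same_letters[OF v(1) v']) (simp add: v(2) set')
    show "v \<noteq> v'" "u \<noteq> []" "\<not> occurs u v" by fact+
    show "(u, v) \<notin> \<Theta>" using Z_saturated[OF sym] u(1) v(1) by blast
    show "\<not> occurs v u" "\<not> occurs v' u" using Z.occurs u(1) v(1) v' by blast+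
    show "\<not> occurs u v'" using nocc occurs_trans[OF _ v_v'] by blast
  qed
qed

lemma two_letter_minimal:
  assumes v: "v \<in> Z" "set v = {0, 1}" and u: "set u = {0, 1}" "length u = length v"
  shows "u \<in> Z"
proof (rule ccontr)
  assume "u \<notin> Z"
  then obtain f where f: "v = map f u"
    using occurs_same_length[OF two_letter_comparable[OF _ u(1) v] u(2)] by blast
  then have "f ` {0, 1} = {0, 1}" using u v by (metis set_map)
  then have "f 0 \<noteq> f 1" by (auto simp: doubleton_eq_iff)
  then have "inj_on f (set u)" unfolding u(1) by (simp add: inj_on_def)
  then have "u = map (inv_into (set u) f) v" unfolding f by (rule inverse_renaming[symmetric])
  then show False using Z.rename[OF v(1)] \<open>u \<notin> Z\<close> by metis
qed

text \<open>Let \<open>L\<close> be the least length of a word of \<open>Z\<close> with two letters. All such words of length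
  \<open>L\<close> lie in \<open>Z\<close>, and \<open>L\<close> is at most 3: else \<open>0\<^sup>L\<^sup>-\<^sup>2 1\<close>, which is not
  in \<open>Z\<close>, would have to occur in the word \<open>0 1 0\<^sup>L\<^sup>-\<^sup>2\<close> of \<open>Z\<close>.\<close>

lemma cubic_words: "[0, 0, 1] \<in> Z" "[0, 1, 0] \<in> Z" "[1, 0, 0] \<in> Z"
proof -
  define P where "P l \<longleftrightarrow> (\<exists>v\<in>Z. set v = {0, 1} \<and> length v = l)" for l
  have "word_power [0] N @ [1] \<in> Z" using power_in_Z[of "[0]" "[]" "[1]"] by simp
  moreover have "set (word_power [0] N @ [1]) = {0, 1}" using N_pos by (auto simp: set_power)
  ultimately have "P (length (word_power [0] N @ [1]))" unfolding P_def by blast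
  define L where "L = (LEAST l. P l)"
  have PL: "P L" unfolding L_def by (rule LeastI) fact
  have below: "\<not> P l" if "l < L" for l using that not_less_Least unfolding L_def by blast
  obtain v where v: "v \<in> Z" "set v = {0, 1}" "length v = L" using PL by (auto simp: P_def)
  have allL: "w \<in> Z" if "set w = {0, 1}" "length w = L" for w
    using two_letter_minimal[OF v(1,2) that(1)] that(2) v(3) by simp
  have "2 \<le> L" using card_length[of v] v(2,3) by simp
  have "L \<le> 3"
  proof (rule ccontr)
    assume "\<not> L \<le> 3"
    then have "L = Suc (Suc (Suc (Suc (L - 4))))" by simp
    then obtain k where k: "L = Suc (Suc (Suc (Suc k)))" by blast
    define u where "u = replicate (Suc (Suc k)) 0 @ [1::nat]"
    define w where "w = 0 # 1 # replicate (Suc (Suc k)) (0::nat)"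
    have "set u = {0, 1}" "length u = Suc (Suc (Suc k))" by (auto simp: u_def)
    then have "u \<notin> Z" using below[of "Suc (Suc (Suc k))"] k by (auto simp: P_def)
    have "w \<in> Z" by (rule allL) (auto simp: w_def k)
    moreover have "set w = {0, 1}" by (auto simp: w_def)
    ultimately have "occurs u w" using two_letter_comparable[OF \<open>u \<notin> Z\<close> \<open>set u = {0, 1}\<close>] by blast
    then obtain a \<sigma> b where \<sigma>: "nonerasing \<sigma>" "w = a @ substitute \<sigma> u @ b" unfolding occurs_def by blast
    have eq: "w = a @ \<sigma> 0 @ \<sigma> 0 @ word_power (\<sigma> 0) k @ \<sigma> 1 @ b"
      using \<sigma>(2) by (simp add: u_def substitute_replicate)
    have pos: "0 < length (\<sigma> 0)" "0 < length (\<sigma> 1)" using \<sigma>(1) by simp_all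
    have len: "k + 4 = length a + (k + 2) * length (\<sigma> 0) + length (\<sigma> 1) + length b"
      using arg_cong[OF eq, of length] by (simp add: w_def algebra_simps)
    have "length (\<sigma> 0) < 2"
    proof (rule ccontr)
      assume "\<not> length (\<sigma> 0) < 2"
      then have "(k + 2) * 2 \<le> (k + 2) * length (\<sigma> 0)" by (intro mult_left_mono) simp_all
      also have "\<dots> < k + 4" unfolding len using pos(2) by simp
      finally show False by simp
    qed
    then have "length (\<sigma> 0) = Suc 0" using pos(1) by linarith
    then obtain c where c: "\<sigma> 0 = [c]" by (cases "\<sigma> 0") auto
    have "k + 4 = length a + (k + 2) + length (\<sigma> 1) + length b" using len c by simp
    then have "length a \<le> 1" using pos(2) by linarith
    then consider "a = []" | d where "a = [d]" by (cases a; cases "tl a") auto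
    then show False
      using eq c by cases (auto simp: w_def)
  qed
  then consider "L = 2" | "L = 3" using \<open>2 \<le> L\<close> by linarith
  then have "[0, 0, 1] \<in> Z \<and> [0, 1, 0] \<in> Z \<and> [1, 0, 0] \<in> Z"
  proof cases
    case 1
    then have "[0, 1] \<in> Z" "[1, 0] \<in> Z" by (auto intro!: allL)
    then show ?thesis using Z.left[of "[0, 1]" "[0]"] Z.right[of "[0, 1]" "[0]"] Z.right[of "[1, 0]" "[0]"] by simp
  next
    case 2
    then show ?thesis by (auto intro!: allL)
  qed
  then show "[0, 0, 1] \<in> Z" "[0, 1, 0] \<in> Z" "[1, 0, 0] \<in> Z" by auto
qed

lemma nonlinear: "\<not> distinct w \<Longrightarrow> 3 \<le> length w \<Longrightarrow> w \<in> Z"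
  using nonlinear_pattern[of 0 1 w] cubic_words Z.occurs by auto

text \<open>A letter that occurs in \<open>u\<close> only may be replaced by its \<open>N\<close>-th power, which would put
  \<open>v\<close> into \<open>Z\<close>.\<close>

lemma outside_same_letters:
  assumes uv: "(u, v) \<in> \<Theta>" and u: "u \<notin> Z"
  shows "set u = set v"
proof -
  have *: "set x \<subseteq> set y" if xy: "(x, y) \<in> \<Theta>" "y \<notin> Z" for x y
  proof
    fix z assume z: "z \<in> set x"
    show "z \<in> set y"
    proof (rule ccontr)
      assume "z \<notin> set y"
      then have y: "substitute (replace z (word_power [z] N)) y = y"
        by (simp only: substitute_upd_notin substitute_id not_False_eq_True)
      have "word_power [z] N \<noteq> []" using N_pos by (simp add: word_power_eq_Nil)
      then have "nonerasing (replace z (word_power [z] N))" by simp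
      then have "(substitute (replace z (word_power [z] N)) x, y) \<in> \<Theta>" using sub[OF xy(1)] y by metis
      moreover obtain a b where "x = a @ z # b" using split_list[OF z] by blast
      then have "substitute (replace z (word_power [z] N)) x =
          substitute (replace z (word_power [z] N)) a @ word_power [z] N @ substitute (replace z (word_power [z] N)) b" by simp
      then have "substitute (replace z (word_power [z] N)) x \<in> Z" using power_in_Z[of "[z]"] by simp
      ultimately show False using Z_saturated xy(2) by blast
    qed
  qed
  have "v \<notin> Z" using Z_saturated[OF sym[OF uv]] u by blast
  then show ?thesis using *[OF uv] *[OF sym[OF uv] u] by blast
qed

lemma outside_linear:
  assumes uv: "(u, v) \<in> \<Theta>" "u \<noteq> v" and u: "u \<notin> Z"
  shows "distinct u \<and> distinct v"
proof -
  have v: "v \<notin> Z" using Z_saturated[OF sym[OF uv(1)]] u by blast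
  have sets: "set u = set v" by (rule outside_same_letters[OF uv(1) u])
  have *: "distinct x" if x: "x \<notin> Z" "y \<notin> Z" "(x, y) \<in> \<Theta>" "x \<noteq> y" "set x = set y" for x y
  proof (rule ccontr)
    assume nd: "\<not> distinct x"
    then obtain a where a: "x = [a, a]" using nonlinear x(1) nonlinear_short[of x] by fastforce
    have "distinct y"
    proof (rule ccontr)
      assume "\<not> distinct y"
      then obtain b where b: "y = [b, b]" using nonlinear x(2) nonlinear_short[of y] by fastforce
      then have "b = a" using a x(5) by simp
      then show False using a b x(4) by simp
    qed
    then have y: "y = [a]" using a x(5) by (intro distinct_one_letter) simp_all
    have "([a, a, a], [a, a]) \<in> \<Theta>" using left[OF x(3), of "[a]"] a y by simp
    then have "([a, a, a], [a]) \<in> \<Theta>" using trans x(3) a y by blast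
    moreover have "[a, a, a] \<in> Z" by (rule nonlinear) simp_all
    ultimately show False using Z_saturated x(2) y by blast
  qed
  show ?thesis using *[OF u v uv sets] *[OF v u sym[OF uv(1)] uv(2)[symmetric] sets[symmetric]] by blast
qed

end

section \<open>Necessity: permutation identities\<close>

text \<open>The complement consists of the linear words of length at most \<open>k\<close>.\<close>

definition beyond :: "nat \<Rightarrow> word set" where
  "beyond k = {w. \<not> distinct w \<or> k < length w}"

lemma verbal_ideal_beyond: "verbal_ideal (beyond k)"
proof
  show "[] \<notin> beyond k" by (simp add: beyond_def)
  show "a @ w @ b \<in> beyond k" if "w \<in> beyond k" for w a b
    using that by (auto simp: beyond_def)
  show "substitute \<sigma> w \<in> beyond k" if "w \<in> beyond k" "nonerasing \<sigma>" for w \<sigma>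
    using that length_substitute_ge[OF that(2), of w] not_distinct_substitute[OF _ that(2), of w]
    by (auto simp: beyond_def)
qed

definition position_swap :: "nat \<Rightarrow> (nat \<Rightarrow> nat) \<Rightarrow> (word \<times> word) set" where
  "position_swap k \<tau> = Id \<union> beyond k \<times> beyond k \<union>
     {(map \<rho> [0..<k], map (\<rho> \<circ> \<tau>) [0..<k]) | \<rho>. inj_on \<rho> {..<k}}"

text \<open>As \<open>\<tau>\<close> is an involution, \<open>position_swap k \<tau>\<close> is an instance of \<open>merge\<close>.\<close>

lemma ficong_position_swap:
  assumes inv: "\<And>i. \<tau> (\<tau> i) = i" and \<tau>: "\<And>i. i < k \<Longrightarrow> \<tau> i < k"
  shows "ficong (position_swap k \<tau>)"
proof -
  let ?w = "[0..<k]"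
  let ?v = "map \<tau> ?w"
  have set_v: "set ?v = {..<k}"
  proof -
    have "i \<in> \<tau> ` {..<k}" if "i < k" for i using inv[of i] \<tau>[OF that] by (metis imageI lessThan_iff)
    then show ?thesis using \<tau> by (auto simp: atLeast0LessThan)
  qed
  have inj: "inj_on (\<rho> \<circ> \<tau>) {..<k}" if "inj_on \<rho> {..<k}" for \<rho> :: "nat \<Rightarrow> nat"
  proof (rule inj_onI)
    fix i j assume ij: "i \<in> {..<k}" "j \<in> {..<k}" "(\<rho> \<circ> \<tau>) i = (\<rho> \<circ> \<tau>) j"
    then have "\<tau> i = \<tau> j" using that \<tau> by (simp add: inj_on_def)
    then show "i = j" using inv by metis
  qed
  have renamed: "\<exists>f. inj_on f {..<k} \<and> w = map f x"
    if x: "occurs x w" "set x = {..<k}" "length x = k" and w: "w \<notin> beyond k" for x w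
  proof -
    have "length w = k" using occurs_length[OF x(1)] x(3) w by (simp add: beyond_def)
    then obtain f where f: "w = map f x" using occurs_same_length[OF x(1)] x(3) by auto
    then show ?thesis using w x(2) by (auto simp: beyond_def distinct_map)
  qed
  have "{(map \<rho> ?v, map \<rho> ?w) | \<rho> :: nat \<Rightarrow> nat. inj_on \<rho> {..<k}} \<subseteq> {(map \<rho> ?w, map \<rho> ?v) | \<rho>. inj_on \<rho> {..<k}}"
  proof (intro subsetI, elim CollectE exE conjE)
    fix e and \<rho> :: "nat \<Rightarrow> nat" assume e: "e = (map \<rho> ?v, map \<rho> ?w)" "inj_on \<rho> {..<k}"
    have "e = (map (\<rho> \<circ> \<tau>) ?w, map (\<rho> \<circ> \<tau>) ?v)" unfolding e(1) by (simp add: inv)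
    then show "e \<in> {(map \<rho> ?w, map \<rho> ?v) | \<rho>. inj_on \<rho> {..<k}}" using inj[OF e(2)] by blast
  qed
  then have "position_swap k \<tau> = merge (beyond k) ?w ?v"
    unfolding position_swap_def merge_def set_upt atLeast0LessThan map_map
    by (intro Un_absorb2[symmetric] le_supI2)
  moreover have "ficong (merge (beyond k) ?w ?v)"
  proof (rule ficong_merge[OF verbal_ideal_beyond])
    show "set ?v = set ?w" using set_v by (simp add: atLeast0LessThan)
    show "?w \<notin> beyond k" by (simp add: beyond_def)
    show "?v \<notin> beyond k" using inj[of id] by (simp add: beyond_def distinct_map atLeast0LessThan)
    show "map \<rho> ?v = map \<rho>' ?w" if "map \<rho> ?w = map \<rho>' ?v" for \<rho> \<rho>'
    proof -
      have "\<rho> i = \<rho>' (\<tau> i)" if "i < k" for i using \<open>map \<rho> ?w = map \<rho>' ?v\<close> that by simp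
      then show ?thesis using \<tau> inv by simp
    qed
    show "\<exists>f. inj_on f (set ?w) \<and> w = map f ?w" if "occurs ?w w" "w \<notin> beyond k" for w
      using renamed[OF that(1) _ _ that(2)] by (simp add: atLeast0LessThan)
    show "\<exists>f. inj_on f (set ?w) \<and> w = map f ?v" if "occurs ?v w" "w \<notin> beyond k" for w
      using renamed[OF that(1) set_v _ that(2)] by (simp add: atLeast0LessThan)
  qed
  ultimately show ?thesis by simp
qed

context cancellable_congruence
begin

text \<open>If \<open>g\<close> gives an identity of \<open>\<Theta>\<close>, then modulo \<open>\<Theta>\<close> every rearrangement of
  positions may be conjugated by \<open>g\<close>.\<close>

lemma position_swap_le:
  assumes g: "bij g" "\<And>i. i < k \<Longrightarrow> g i < k" "\<And>i. i < k \<Longrightarrow> inv g i < k"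
    and rel: "([0..<k], map g [0..<k]) \<in> \<Theta>"
    and conj: "\<And>i. g (\<tau> i) = \<tau>' (g i)" and inv: "\<And>i. \<tau> (\<tau> i) = i" and \<tau>: "\<And>i. i < k \<Longrightarrow> \<tau> i < k"
  shows "position_swap k \<tau>' \<subseteq> cjoin \<Theta> (position_swap k \<tau>)"
proof -
  let ?w = "[0..<k]" and ?J = "cjoin \<Theta> (position_swap k \<tau>)"
  interpret J: ficong ?J by (rule ficong_cjoin[OF ficong_axioms ficong_position_swap[OF inv \<tau>]])
  have "(map \<rho> ?w, map (\<rho> \<circ> \<tau>') ?w) \<in> ?J" if \<rho>: "inj_on \<rho> {..<k}" for \<rho>
  proof -
    have 1: "(map \<rho> ?w, map (\<rho> \<circ> g) ?w) \<in> \<Theta>" using rename[OF rel, of \<rho>] by simp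
    have "inj_on (\<rho> \<circ> g) {..<k}"
      using \<rho> g(1,2) by (intro comp_inj_on) (auto simp: inj_on_def bij_def)
    then have 2: "(map (\<rho> \<circ> g) ?w, map (\<rho> \<circ> g \<circ> \<tau>) ?w) \<in> position_swap k \<tau>"
      unfolding position_swap_def by blast
    have 3: "(map (\<rho> \<circ> \<tau>') ?w, map (\<rho> \<circ> g \<circ> \<tau>) ?w) \<in> \<Theta>"
      using rename[OF rel, of "\<rho> \<circ> \<tau>'"] conj by (simp add: o_def)
    show ?thesis
      using J.trans[OF subsetD[OF cjoin_upper(1) 1] J.trans[OF subsetD[OF cjoin_upper(2) 2]
          subsetD[OF cjoin_upper(1) sym[OF 3]]]] .
  qed
  moreover have "Id \<union> beyond k \<times> beyond k \<subseteq> ?J"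
    using cjoin_upper(2)[of "position_swap k \<tau>" \<Theta>] unfolding position_swap_def by blast
  ultimately show ?thesis unfolding position_swap_def[of k \<tau>'] by blast
qed

text \<open>Conjugation by \<open>g\<close> takes the transposition of \<open>i\<close> and \<open>j\<close> to that of \<open>g i\<close> and \<open>g j\<close>, so
  the two corresponding congruences have the same join with \<open>\<Theta>\<close>. Neither
  transposition is an identity of \<open>\<Theta>\<close>, so the intersections also coincide. By
  cancellation the two transpositions are equal.\<close>

lemma swap_preserved:
  assumes ij: "i < k" "j < k" "i \<noteq> j" and notrel: "([0..<k], map (transpose i j) [0..<k]) \<notin> \<Theta>"
    and g: "g permutes {..<k}" and rel: "([0..<k], map g [0..<k]) \<in> \<Theta>"
  shows "{g i, g j} = {i, j}"
proof -
  let ?w = "[0..<k]"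
  let ?\<tau> = "transpose i j" and ?\<tau>' = "transpose (g i) (g j)"
  have bij: "bij g" by (rule permutes_bij[OF g])
  have g_lt: "g x < k" if "x < k" for x using permutes_in_image[OF g, of x] that by simp
  have ginv: "inv g permutes {..<k}" by (rule permutes_inv[OF g])
  have ginv_lt: "inv g x < k" if "x < k" for x using permutes_in_image[OF ginv, of x] that by simp
  have gi: "inv g (g x) = x" "g (inv g x) = x" for x using permutes_inverses[OF g] by simp_all
  have conj: "g (?\<tau> x) = ?\<tau>' (g x)" for x
    using gi by (metis transpose_def)
  have conj': "inv g (?\<tau>' x) = ?\<tau> (inv g x)" for x
    using conj[of "inv g x"] gi by metis
  have \<tau>_lt: "?\<tau> x < k" "?\<tau>' x < k" if "x < k" for x
    using that ij g_lt by (auto simp: transpose_def)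
  have inv: "?\<tau> (?\<tau> x) = x" "?\<tau>' (?\<tau>' x) = x" for x by simp_all
  have rel': "(?w, map (inv g) ?w) \<in> \<Theta>"
  proof -
    have "map (inv g) (map g ?w) = ?w" using gi by (simp add: o_def)
    then show ?thesis using rename[OF rel, of "inv g"] sym by metis
  qed
  have notrel': "(?w, map ?\<tau>' ?w) \<notin> \<Theta>"
  proof
    assume "(?w, map ?\<tau>' ?w) \<in> \<Theta>"
    from rename[OF this, of "inv g"] have "(map (inv g) ?w, map (?\<tau> \<circ> inv g) ?w) \<in> \<Theta>"
      using conj' by (simp add: o_def)
    moreover have "(map ?\<tau> ?w, map (?\<tau> \<circ> inv g) ?w) \<in> \<Theta>" using rename[OF rel', of ?\<tau>] by simp
    ultimately have "(?w, map ?\<tau> ?w) \<in> \<Theta>" using rel' trans sym by blast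
    then show False using notrel by blast
  qed
  have unrelated: "(map \<rho> ?w, map (\<rho> \<circ> \<mu>) ?w) \<notin> \<Theta>"
    if \<rho>: "inj_on \<rho> {..<k}" and \<mu>: "(?w, map \<mu> ?w) \<notin> \<Theta>" "\<And>x. x < k \<Longrightarrow> \<mu> x < k" for \<rho> \<mu>
  proof
    assume "(map \<rho> ?w, map (\<rho> \<circ> \<mu>) ?w) \<in> \<Theta>"
    from rename[OF this, of "inv_into {..<k} \<rho>"]
    have "(map (\<lambda>x. inv_into {..<k} \<rho> (\<rho> x)) ?w, map (\<lambda>x. inv_into {..<k} \<rho> (\<rho> (\<mu> x))) ?w) \<in> \<Theta>"
      by (simp add: o_def)
    moreover have "map (\<lambda>x. inv_into {..<k} \<rho> (\<rho> x)) ?w = ?w"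
      by (rule map_idI) (use \<rho> in auto)
    moreover have "map (\<lambda>x. inv_into {..<k} \<rho> (\<rho> (\<mu> x))) ?w = map \<mu> ?w"
      using \<rho> \<mu>(2) by simp
    ultimately show False using \<mu>(1) by simp
  qed
  have f: "ficong (position_swap k ?\<tau>)" "ficong (position_swap k ?\<tau>')"
    using ficong_position_swap[OF inv(1) \<tau>_lt(1)] ficong_position_swap[OF inv(2) \<tau>_lt(2)] by blast+
  have int: "\<Theta> \<inter> position_swap k ?\<tau> = \<Theta> \<inter> (Id \<union> beyond k \<times> beyond k)"
    "\<Theta> \<inter> position_swap k ?\<tau>' = \<Theta> \<inter> (Id \<union> beyond k \<times> beyond k)"
    using unrelated[OF _ notrel \<tau>_lt(1)] unrelated[OF _ notrel' \<tau>_lt(2)] unfolding position_swap_def by blast+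
  have "position_swap k ?\<tau> = position_swap k ?\<tau>'"
  proof (rule cancelD[OF f])
    show "\<Theta> \<inter> position_swap k ?\<tau> = \<Theta> \<inter> position_swap k ?\<tau>'" using int by simp
    show "position_swap k ?\<tau>' \<subseteq> cjoin \<Theta> (position_swap k ?\<tau>)"
      by (rule position_swap_le[OF bij g_lt ginv_lt rel conj inv(1) \<tau>_lt(1)])
    have "inv (inv g) = g" by (rule permutes_inv_inv[OF g])
    then show "position_swap k ?\<tau> \<subseteq> cjoin \<Theta> (position_swap k ?\<tau>')"
      using position_swap_le[OF permutes_bij[OF ginv] ginv_lt _ rel' conj' inv(2) \<tau>_lt(2)] g_lt by simp
  qed
  moreover have "(?w, map ?\<tau> ?w) \<in> position_swap k ?\<tau>"
  proof -
    have "(map id ?w, map (id \<circ> ?\<tau>) ?w) \<in> position_swap k ?\<tau>"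
      unfolding position_swap_def using inj_on_id by blast
    then show ?thesis by simp
  qed
  ultimately have mem: "(?w, map ?\<tau> ?w) \<in> position_swap k ?\<tau>'" by simp
  have "?w \<notin> beyond k" by (simp add: beyond_def)
  moreover have "?w \<noteq> map ?\<tau> ?w"
  proof
    assume "?w = map ?\<tau> ?w"
    then have "?w ! i = map ?\<tau> ?w ! i" by simp
    then show False using ij by simp
  qed
  ultimately obtain \<rho> where \<rho>: "?w = map \<rho> ?w" "map ?\<tau> ?w = map (\<rho> \<circ> ?\<tau>') ?w"
    using mem unfolding position_swap_def by blast
  have \<rho>_id: "\<rho> x = x" if "x < k" for x using arg_cong[OF \<rho>(1), of "\<lambda>l. l ! x"] that by simp
  have "?\<tau> i = \<rho> (?\<tau>' i)" using arg_cong[OF \<rho>(2), of "\<lambda>l. l ! i"] ij by simp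
  then have "?\<tau>' i = j" using \<rho>_id[OF \<tau>_lt(2)[OF ij(1)]] by simp
  then show ?thesis using ij(3) by (auto simp: transpose_def split: if_splits)
qed

text \<open>Let \<open>g\<close> move \<open>a\<close> to \<open>b\<close>. Then \<open>g\<close> does not preserve \<open>{a, c}\<close> for \<open>c\<close> other than \<open>b\<close>, so
  the transposition of \<open>a\<close> and \<open>c\<close> is an identity of \<open>\<Theta>\<close>; these in turn leave no
  room for any transposition that is not.\<close>

lemma all_permutations:
  assumes g: "g permutes {..<k}" "g \<noteq> id" and rel: "([0..<k], map g [0..<k]) \<in> \<Theta>"
    and h: "h permutes {..<k}"
  shows "([0..<k], map h [0..<k]) \<in> \<Theta>"
proof -
  let ?w = "[0..<k]"
  obtain a where a: "g a \<noteq> a" using g(2) by (auto simp: fun_eq_iff)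
  define b where "b = g a"
  have ab: "a < k" "b < k" "a \<noteq> b" "g a = b"
    using a g(1) permutes_in_image[OF g(1), of a] permutes_not_in[OF g(1), of a] by (auto simp: b_def)
  have inj: "inj g" by (rule permutes_inj[OF g(1)])
  have perm: "transpose i j permutes {..<k}" if "i < k" "j < k" for i j
    using that by (intro permutes_swap_id) auto
  have star: "(?w, map (transpose a c) ?w) \<in> \<Theta>" if c: "c < k" "c \<noteq> a" "c \<noteq> b" for c
  proof (rule ccontr)
    assume "(?w, map (transpose a c) ?w) \<notin> \<Theta>"
    from swap_preserved[OF ab(1) c(1) c(2)[symmetric] this g(1) rel] have "{g a, g c} = {a, c}" .
    then have "b \<in> {a, c}" using ab(4) by blast
    then show False using ab(3) c by auto
  qed
  have starb: "(?w, map (transpose a b) ?w) \<in> \<Theta>"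
  proof (rule ccontr)
    assume no: "(?w, map (transpose a b) ?w) \<notin> \<Theta>"
    have "c = a \<or> c = b" if c: "c < k" for c
    proof (rule ccontr)
      assume "\<not> ?thesis"
      then have "c \<noteq> a" "c \<noteq> b" by auto
      from swap_preserved[OF ab(1-3) no perm[OF ab(1) c] star[OF c this]]
      show False using \<open>c \<noteq> a\<close> \<open>c \<noteq> b\<close> ab(3) by (auto simp: transpose_def doubleton_eq_iff)
    qed
    \<comment> \<open>only two positions: \<open>g\<close> is the transposition itself\<close>
    then have "map g ?w = map (transpose a b) ?w"
    proof (intro map_cong HOL.refl)
      fix x assume "x \<in> set ?w"
      then have x: "x = a \<or> x = b" using \<open>\<And>c. c < k \<Longrightarrow> c = a \<or> c = b\<close> by simp
      have "g b < k" using permutes_in_image[OF g(1), of b] ab(2) by simp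
      then have "g b = a \<or> g b = b" using \<open>\<And>c. c < k \<Longrightarrow> c = a \<or> c = b\<close> by blast
      moreover have "g b \<noteq> b" using inj ab(3,4) by (metis injD)
      ultimately show "g x = transpose a b x" using x ab(4) by (auto simp: transpose_def)
    qed
    then show False using rel no by (simp only:)
  qed
  have stara: "(?w, map (transpose a c) ?w) \<in> \<Theta>" if "c < k" for c
    using star[OF that] starb by (cases "c = a \<or> c = b") auto
  have swaps: "(?w, map (transpose i j) ?w) \<in> \<Theta>" if ij: "i < k" "j < k" for i j
  proof (rule ccontr)
    assume no: "(?w, map (transpose i j) ?w) \<notin> \<Theta>"
    have "i \<noteq> j" using no by auto
    have "i \<noteq> a" using no stara[OF ij(2)] by auto
    moreover have "j \<noteq> a" using no stara[OF ij(1)] by (auto simp: transpose_commute)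
    moreover have "{transpose a i i, transpose a i j} = {i, j}"
      by (rule swap_preserved[OF ij \<open>i \<noteq> j\<close> no perm[OF ab(1) ij(1)] stara[OF ij(1)]])
    ultimately show False using \<open>i \<noteq> j\<close> by (auto simp: transpose_def doubleton_eq_iff)
  qed
  show ?thesis
    using h finite_lessThan[of k]
  proof (induction h rule: permutes_induct)
    case id
    then show ?case by simp
  next
    case (swap i j p)
    have "(map (transpose i j) ?w, map (transpose i j \<circ> p) ?w) \<in> \<Theta>"
      using rename[OF swap.IH, of "transpose i j"] by simp
    then show ?case using swaps[of i j] swap.hyps trans by blast
  qed
qed

end

lemma permutation_between:
  assumes "distinct u" "distinct v" "set u = set v"
  shows "\<exists>h. h permutes {..<length u} \<and> v = map (\<lambda>i. u ! h i) [0..<length u]"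
proof -
  have "mset v = mset u" using assms by (simp add: set_eq_iff_mset_eq_distinct)
  then obtain h where "h permutes {..<length u}" "permute_list h u = v"
    by (rule mset_eq_permutation)
  then show ?thesis by (auto simp: permute_list_def)
qed

context cancellable_congruence
begin

lemma linear_words_related:
  assumes u: "distinct u" "distinct u'" "set u = set u'" "u \<noteq> u'" "(u, u') \<in> \<Theta>"
    and v: "distinct v" "distinct v'" "set v = set v'" "length v = length u"
  shows "(v, v') \<in> \<Theta>"
proof -
  let ?k = "length u"
  obtain g where g: "g permutes {..<?k}" "u' = map (\<lambda>i. u ! g i) [0..<?k]"
    using permutation_between[OF u(1-3)] by blast
  obtain h where h: "h permutes {..<?k}" "v' = map (\<lambda>i. v ! h i) [0..<?k]"
    using permutation_between[OF v(1-3)] v(4) by auto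
  have nth: "map ((!) w) [0..<?k] = w" if "length w = ?k" for w :: word
    using that map_nth[of w] by simp
  obtain f where f: "map f u = [0..<?k]" using rename_to[OF u(1), of "[0..<?k]"] by auto
  then have fu: "f (u ! i) = i" if "i < ?k" for i
    using that by (metis add.left_neutral nth_map nth_upt)
  have g_lt: "g i < ?k" if "i < ?k" for i using permutes_in_image[OF g(1), of i] that by simp
  have "map f u' = map g [0..<?k]" using g(2) fu g_lt by simp
  then have rel: "([0..<?k], map g [0..<?k]) \<in> \<Theta>" using rename[OF u(5), of f] f by simp
  have "g \<noteq> id" using g(2) u(4) nth[of u] by auto
  from all_permutations[OF g(1) this rel h(1)] have "([0..<?k], map h [0..<?k]) \<in> \<Theta>" .
  from rename[OF this, of "(!) v"] show ?thesis using nth[of v] v(4) h(2) by (simp add: o_def)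
qed

end

context aperiodic_congruence
begin

text \<open>The bound \<open>length u \<le> k\<close> makes this monotone by definition; a nontrivial
  rearrangement remains one when new letters are appended.\<close>

definition Q :: "nat \<Rightarrow> bool" where
  "Q k \<longleftrightarrow> (\<exists>u v. distinct u \<and> distinct v \<and> set u = set v \<and> u \<noteq> v \<and> length u \<le> k \<and> (u, v) \<in> \<Theta>)"

lemma Q_related:
  assumes "Q (length u)" "distinct u" "distinct v" "set u = set v"
  shows "(u, v) \<in> \<Theta>"
proof -
  obtain a b where ab: "distinct a" "distinct b" "set a = set b" "a \<noteq> b" "length a \<le> length u" "(a, b) \<in> \<Theta>"
    using assms(1) by (auto simp: Q_def)
  define e where "e = [Suc (Max (insert 0 (set a)))..<Suc (Max (insert 0 (set a))) + (length u - length a)]"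
  have disj: "set a \<inter> set e = {}"
  proof -
    have "x \<le> Max (insert 0 (set a))" if "x \<in> set a" for x using that by simp
    then show ?thesis by (fastforce simp: e_def)
  qed
  have "distinct e" "length e = length u - length a"
    by (simp_all only: e_def distinct_upt length_upt diff_add_inverse)
  then have "distinct (a @ e)" "distinct (b @ e)" "set (a @ e) = set (b @ e)" "a @ e \<noteq> b @ e"
    "length u = length (a @ e)" "(a @ e, b @ e) \<in> \<Theta>"
    using ab disj right[OF ab(6)] by auto
  then show ?thesis using linear_words_related assms(2-4) by blast
qed

sublocale special \<Theta> Z Q
proof
  show "w \<in> Z" if "\<not> distinct w" "3 \<le> length w" for w by (rule nonlinear[OF that])
  show "(\<forall>u\<in>Z. \<forall>v\<in>Z. (u, v) \<in> \<Theta>) \<or>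
      (\<Theta> \<subseteq> same_letters \<and> (\<forall>u\<in>Z. \<forall>v\<in>Z. set u = set v \<longrightarrow> (u, v) \<in> \<Theta>))"
    by (rule Z_cases)
  show "(u, v) \<in> \<Theta> \<longleftrightarrow> u = v \<or> distinct u \<and> distinct v \<and> set u = set v \<and> Q (length u)"
    if u: "u \<notin> Z" "u \<noteq> []" for u v
  proof
    assume uv: "(u, v) \<in> \<Theta>"
    show "u = v \<or> distinct u \<and> distinct v \<and> set u = set v \<and> Q (length u)"
    proof (cases "u = v")
      case False
      then have "distinct u \<and> distinct v" "set u = set v"
        using outside_linear[OF uv _ u(1)] outside_same_letters[OF uv u(1)] by blast+
      then show ?thesis using uv False by (auto simp: Q_def)
    qed simp
  qed (use Q_related in auto)
qed

end

section \<open>The congruences of the classification\<close>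

definition zero_words :: "nat \<Rightarrow> enat \<Rightarrow> word set" where
  "zero_words c n = {w. w \<noteq> [] \<and> (\<not> distinct w \<and> c \<le> length w \<or> n \<le> enat (length w))}"

text \<open>The theory of the variety \<open>X_variety m n\<close> for \<open>c = 3\<close>, and of \<open>Y_variety m n\<close> for
  \<open>c = 2\<close>. For \<open>n = 1\<close> all words are zero.\<close>

definition nil_congruence :: "nat \<Rightarrow> enat \<Rightarrow> enat \<Rightarrow> (word \<times> word) set" where
  "nil_congruence c m n = {(u, v). u = v \<or> u \<in> zero_words c n \<and> v \<in> zero_words c n \<or>
     distinct u \<and> distinct v \<and> set u = set v \<and> m \<le> enat (length u)}"

lemma mset_substitute: "mset (substitute \<sigma> w) = (\<Sum>x\<in>#mset w. mset (\<sigma> x))"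
  by (induction w) auto

lemma verbal_ideal_zero_words: "verbal_ideal (zero_words c n)"
proof
  show "[] \<notin> zero_words c n" by (simp add: zero_words_def)
  show "a @ w @ b \<in> zero_words c n" if "w \<in> zero_words c n" for w a b
  proof -
    have "enat (length w) \<le> enat (length (a @ w @ b))" by simp
    then show ?thesis using that by (auto simp: zero_words_def simp del: enat_ord_simps intro: order.trans)
  qed
  show "substitute \<sigma> w \<in> zero_words c n" if w: "w \<in> zero_words c n" and \<sigma>: "nonerasing \<sigma>" for w \<sigma>
  proof -
    have len: "length w \<le> length (substitute \<sigma> w)" by (rule length_substitute_ge[OF \<sigma>])
    have "substitute \<sigma> w \<noteq> []" using w \<sigma> by (simp add: zero_words_def)
    moreover have "\<not> distinct w \<and> c \<le> length w \<or> n \<le> enat (length w)" using w by (simp add: zero_words_def)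
    moreover have "n \<le> enat (length (substitute \<sigma> w))" if "n \<le> enat (length w)"
      using that len by (meson enat_ord_simps(1) order.trans)
    ultimately show ?thesis
      using not_distinct_substitute[OF _ \<sigma>, of w] len by (auto simp: zero_words_def)
  qed
qed

text \<open>A nonlinear word is zero unless it is some \<open>aa\<close> with \<open>c = 3\<close>, which is determined by its
  letters.\<close>

lemma nil_congruence_same_mset:
  assumes "c \<le> 3" "mset u = mset v" "m \<le> enat (length u)"
  shows "(u, v) \<in> nil_congruence c m n"
proof -
  have eq: "distinct u \<longleftrightarrow> distinct v" "set u = set v" "length u = length v"
    using assms(2) mset_eq_imp_distinct_iff mset_eq_setD mset_eq_length by blast+
  show ?thesis
  proof (cases "distinct u")
    case True
    then show ?thesis using eq assms(3) by (simp add: nil_congruence_def)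
  next
    case False
    then have nd: "\<not> distinct u" "\<not> distinct v" using eq(1) by simp_all
    show ?thesis
    proof (cases "length u < 3")
      case True
      then obtain a b where ab: "u = [a, a]" "v = [b, b]"
        using nonlinear_short[OF nd(1)] nonlinear_short[OF nd(2)] eq(3) by auto
      then have "u = v" using eq(2) by simp
      then show ?thesis by (simp add: nil_congruence_def)
    next
      case False
      then have "u \<in> zero_words c n" "v \<in> zero_words c n"
        using nd eq(3) assms(1) by (auto simp: zero_words_def)
      then show ?thesis by (simp add: nil_congruence_def)
    qed
  qed
qed

lemma ficong_nil_congruence:
  assumes "c \<le> 3"
  shows "ficong (nil_congruence c m n)"
proof -
  interpret Z: verbal_ideal "zero_words c n" by (rule verbal_ideal_zero_words)
  have cases: "u = v \<or> u \<in> zero_words c n \<and> v \<in> zero_words c n \<or> mset u = mset v \<and> m \<le> enat (length u)"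
    if "(u, v) \<in> nil_congruence c m n" for u v
    using that by (auto simp: nil_congruence_def set_eq_iff_mset_eq_distinct)
  have zero: "(u, v) \<in> nil_congruence c m n" if "u \<in> zero_words c n" "v \<in> zero_words c n" for u v
    using that by (simp add: nil_congruence_def)
  have mono: "m \<le> enat (length v)" if "m \<le> enat (length u)" "length u \<le> length v" for u v :: word
    using that by (meson enat_ord_simps(1) order.trans)
  have linear_zero: "v \<in> zero_words c n" if "u \<in> zero_words c n" "distinct u" "distinct v" "set u = set v" for u v
  proof -
    have "length v = length u" using that(2-4) by (metis distinct_card)
    then show ?thesis using that by (auto simp: zero_words_def)
  qed
  show ?thesis
  proof
    show "(w, w) \<in> nil_congruence c m n" for w by (simp add: nil_congruence_def)
    show "(v, u) \<in> nil_congruence c m n" if "(u, v) \<in> nil_congruence c m n" for u v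
    proof -
      have "length u = length v" if "distinct u" "distinct v" "set u = set v"
        using that by (metis distinct_card)
      then show ?thesis using that unfolding nil_congruence_def by auto
    qed
    show "(u, w) \<in> nil_congruence c m n"
      if uvw: "(u, v) \<in> nil_congruence c m n" "(v, w) \<in> nil_congruence c m n" for u v w
    proof -
      consider "u = v" | "v = w" | "u \<in> zero_words c n" "v \<in> zero_words c n" "w \<in> zero_words c n"
        | "u \<in> zero_words c n" "v \<in> zero_words c n" "distinct v" "distinct w" "set v = set w"
        | "v \<in> zero_words c n" "w \<in> zero_words c n" "distinct u" "distinct v" "set u = set v"
        | "distinct u" "distinct v" "set u = set v" "distinct w" "set v = set w" "m \<le> enat (length u)"
        using uvw unfolding nil_congruence_def by blast
      then show ?thesis
      proof cases
        case 4
        then show ?thesis using zero linear_zero by blast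
      next
        case 5
        then show ?thesis using zero linear_zero[of v u] by blast
      next
        case 6
        then show ?thesis by (simp add: nil_congruence_def)
      qed (use uvw zero in auto)
    qed
    show "v = []" if "([], v) \<in> nil_congruence c m n" for v
      using cases[OF that] Z.nonempty by auto
    show "(a @ u @ b, a @ v @ b) \<in> nil_congruence c m n" if uv: "(u, v) \<in> nil_congruence c m n" for u v a b
      using cases[OF uv]
    proof (elim disjE conjE)
      assume "mset u = mset v" "m \<le> enat (length u)"
      then show ?thesis using mono[of u "a @ u @ b"]
        by (intro nil_congruence_same_mset[OF assms]) simp_all
    next
      assume "u \<in> zero_words c n" "v \<in> zero_words c n"
      then show ?thesis using zero[OF Z.mult Z.mult] by blast
    qed (simp add: nil_congruence_def)
    show "(substitute \<sigma> u, substitute \<sigma> v) \<in> nil_congruence c m n"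
      if uv: "(u, v) \<in> nil_congruence c m n" and \<sigma>: "nonerasing \<sigma>" for u v \<sigma>
      using cases[OF uv]
    proof (elim disjE conjE)
      assume *: "mset u = mset v" "m \<le> enat (length u)"
      show ?thesis
        by (rule nil_congruence_same_mset[OF assms _ mono[OF *(2) length_substitute_ge[OF \<sigma>]]])
          (simp add: mset_substitute *(1))
    next
      assume "u \<in> zero_words c n" "v \<in> zero_words c n"
      then show ?thesis using zero[OF Z.sub Z.sub] \<sigma> by blast
    qed (simp add: nil_congruence_def)
  qed
qed

lemma special_nil_congruence:
  assumes c: "c \<le> 3" and B: "B = UNIV \<or> B = same_letters"
  shows "special (nil_congruence c m n \<inter> B) (zero_words c n) (\<lambda>k. m \<le> enat k)"
proof -
  have "ficong (nil_congruence c m n \<inter> B)"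
    using B ficong_nil_congruence[OF c] ficong_Int[OF ficong_nil_congruence[OF c] ficong_same_letters] by auto
  moreover have "w \<in> zero_words c n" if "\<not> distinct w" "3 \<le> length w" for w
    using that c by (auto simp: zero_words_def)
  moreover have "(\<forall>u\<in>zero_words c n. \<forall>v\<in>zero_words c n. (u, v) \<in> nil_congruence c m n \<inter> B) \<or>
      (nil_congruence c m n \<inter> B \<subseteq> same_letters \<and>
       (\<forall>u\<in>zero_words c n. \<forall>v\<in>zero_words c n. set u = set v \<longrightarrow> (u, v) \<in> nil_congruence c m n \<inter> B))"
    using B by (auto simp: nil_congruence_def same_letters_def)
  moreover have "(u, v) \<in> nil_congruence c m n \<inter> B \<longleftrightarrow>
      u = v \<or> distinct u \<and> distinct v \<and> set u = set v \<and> m \<le> enat (length u)"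
    if "u \<notin> zero_words c n" for u v
    using B that by (auto simp: nil_congruence_def same_letters_def)
  ultimately show ?thesis
    using verbal_ideal_zero_words[of c n] by (simp add: special_def special_axioms_def)
qed

theorem cancel_nil_congruence:
  assumes "c \<le> 3"
  shows "cancel (nil_congruence c m n)" "cancel (nil_congruence c m n \<inter> same_letters)"
  using special.cancel[OF special_nil_congruence[OF assms, of UNIV m n]]
    special.cancel[OF special_nil_congruence[OF assms, of same_letters m n]] by simp_all

lemma least_enat:
  assumes "\<And>k l. P k \<Longrightarrow> k \<le> l \<Longrightarrow> P l"
  shows "\<exists>n :: enat. \<forall>k. P k \<longleftrightarrow> n \<le> enat k"
proof (cases "\<exists>k. P k")
  case True
  then have "P (LEAST k. P k)" by (rule LeastI_ex)
  then have "P k \<longleftrightarrow> (LEAST k. P k) \<le> k" for k using Least_le[of P k] assms by blast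
  then obtain k0 where "\<And>k. P k \<longleftrightarrow> k0 \<le> k" by blast
  then show ?thesis by (intro exI[of _ "enat k0"]) simp
next
  case False
  then show ?thesis by (intro exI[of _ "\<infinity>"]) simp
qed

text \<open>\<open>c\<close>, \<open>m\<close> and \<open>n\<close> are the lengths from which nonlinear words are zero, linear words may
  be rearranged, and all words are zero.\<close>

theorem cancel_classification:
  assumes "ficong \<Theta>" "cancel \<Theta>" "\<Theta> \<noteq> Id"
  shows "\<exists>c m n. (c = 2 \<or> c = 3) \<and> (n = 1 \<or> 2 \<le> m \<and> m \<le> n) \<and>
    (\<Theta> = nil_congruence c m n \<or> \<Theta> = nil_congruence c m n \<inter> same_letters)"
proof -
  interpret cancellable_congruence \<Theta>
    using assms by (simp add: cancellable_congruence_def cancellable_congruence_axioms_def)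
  obtain N where "0 < N" "\<And>t. (word_power t N, word_power t (Suc N)) \<in> \<Theta>" using aperiodic[OF assms(3)] by blast
  then interpret aperiodic_congruence \<Theta> N by unfold_locales
  have upt_Z: "w \<in> Z" if "[0..<length w] \<in> Z" for w
    using Z.rename[OF that, of "(!) w"] by (simp add: map_nth)
  have "[0..<l] \<in> Z" if "[0..<k] \<in> Z" "k \<le> l" for k l
  proof -
    have "[0..<l] = [0..<k] @ [k..<l]" using that(2) upt_add_eq_append[of 0 k "l - k"] by simp
    then show ?thesis using Z.right[OF that(1)] by simp
  qed
  then obtain n where n: "\<And>k. [0..<k] \<in> Z \<longleftrightarrow> n \<le> enat k"
    using least_enat[of "\<lambda>k. [0..<k] \<in> Z"] by blast
  have "Q l" if "Q k" "k \<le> l" for k l using that order.trans unfolding Q_def by blast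
  then obtain m where m: "\<And>k. Q k \<longleftrightarrow> m \<le> enat k" using least_enat[of Q] by blast
  define c where "c = (if [0, 0] \<in> Z then 2 else 3 :: nat)"
  have zero: "w \<in> Z \<longleftrightarrow> w \<in> zero_words c n" if one: "[0] \<notin> Z \<or> n = 1" for w
  proof
    assume w: "w \<in> Z"
    have wne: "w \<noteq> []" using w Z.nonempty by auto
    show "w \<in> zero_words c n"
    proof (cases "distinct w")
      case True
      then obtain f where "map f w = [0..<length w]" using rename_to[of w "[0..<length w]"] by auto
      then have "[0..<length w] \<in> Z" using Z.rename[OF w, of f] by simp
      then show ?thesis using n wne by (simp add: zero_words_def)
    next
      case False
      have "c \<le> length w"
      proof (cases "length w < 3")
        case True
        then obtain a where a: "w = [a, a]" using nonlinear_short[OF False] by blast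
        then have "[0, 0] \<in> Z" using Z.rename[OF w, of "\<lambda>_. 0"] by simp
        then show ?thesis using a by (simp add: c_def)
      qed (simp add: c_def)
      then show ?thesis using False wne by (simp add: zero_words_def)
    qed
  next
    assume "w \<in> zero_words c n"
    then consider "\<not> distinct w" "c \<le> length w" | "n \<le> enat (length w)" by (auto simp: zero_words_def)
    then show "w \<in> Z"
    proof cases
      case 1
      show ?thesis
      proof (cases "length w < 3")
        case True
        then have "[0, 0] \<in> Z" using 1(2) by (auto simp: c_def split: if_splits)
        moreover obtain a where "w = [a, a]" using nonlinear_short[OF 1(1) True] by blast
        ultimately show ?thesis using Z.rename[of "[0, 0]" "\<lambda>_. a"] by simp
      qed (use nonlinear[OF 1(1)] in simp)
    next
      case 2
      then show ?thesis using n upt_Z by blast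
    qed
  qed
  have main: "\<Theta> = nil_congruence c m n \<or> \<Theta> = nil_congruence c m n \<inter> same_letters"
    if one: "[0] \<notin> Z \<or> n = 1"
  proof -
    note zero = zero[OF one]
    have sub: "\<Theta> \<subseteq> nil_congruence c m n"
    proof (rule subrelI)
      fix u v assume uv: "(u, v) \<in> \<Theta>"
      consider "u = []" | "u \<in> Z" | "u \<notin> Z" "u \<noteq> []" by blast
      then show "(u, v) \<in> nil_congruence c m n"
      proof cases
        case 1
        then have "v = []" using uv Nil by simp
        then show ?thesis using 1 by (simp add: nil_congruence_def)
      next
        case 2
        then have "v \<in> Z" using Z_saturated[OF uv] by blast
        then show ?thesis using 2 zero by (simp add: nil_congruence_def)
      next
        case 3
        then have "u = v \<or> distinct u \<and> distinct v \<and> set u = set v \<and> m \<le> enat (length u)"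
          using outside[OF 3, of v] uv m by blast
        then show ?thesis by (auto simp: nil_congruence_def)
      qed
    qed
    have linear: "(u, v) \<in> \<Theta>" if "distinct u" "distinct v" "set u = set v" "m \<le> enat (length u)" for u v
      using Q_related that m by blast
    show ?thesis using Z_cases
    proof
      assume all: "\<forall>u\<in>Z. \<forall>v\<in>Z. (u, v) \<in> \<Theta>"
      have "nil_congruence c m n \<subseteq> \<Theta>"
        using all linear zero unfolding nil_congruence_def by auto
      then show ?thesis using sub by blast
    next
      assume SL: "\<Theta> \<subseteq> same_letters \<and> (\<forall>u\<in>Z. \<forall>v\<in>Z. set u = set v \<longrightarrow> (u, v) \<in> \<Theta>)"
      have "nil_congruence c m n \<inter> same_letters \<subseteq> \<Theta>"
        using SL linear zero unfolding nil_congruence_def same_letters_def by auto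
      then show ?thesis using sub SL by blast
    qed
  qed
  have c23: "c = 2 \<or> c = 3" by (simp add: c_def)
  show ?thesis
  proof (cases "[0] \<in> Z")
    case True
    then have "n \<le> 1" using n[of 1] by (simp add: one_enat_def)
    moreover have "n \<noteq> 0" using n[of 0] Z.nonempty by (auto simp: zero_enat_def)
    ultimately have "n = 1" by (metis ileI1 one_eSuc order_antisym zero_less_iff_neq_zero)
    then show ?thesis using c23 main by blast
  next
    case False
    have two: "2 \<le> k" if "\<not> k \<le> enat 1" for k
      using that by (cases k) (auto simp: numeral_eq_enat)
    have "[0..<1] \<notin> Z" using False by simp
    then have n2: "2 \<le> n" using n two by blast
    have "\<not> Q 1"
    proof
      assume "Q 1"
      then obtain u v :: word where uv: "distinct u" "distinct v" "set u = set v" "u \<noteq> v" "length u \<le> 1"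
        by (auto simp: Q_def)
      show False
      proof (cases u)
        case Nil
        then show False using uv by simp
      next
        case (Cons a u')
        then have "u = [a]" using uv(5) by simp
        then show False using distinct_one_letter[OF uv(2), of a] uv(3,4) by simp
      qed
    qed
    then have m2: "2 \<le> m" using m two by blast
    have mn: "m \<le> n"
    proof (cases n)
      case (enat k)
      then have kZ: "[0..<k] \<in> Z" using n by simp
      have k: "2 \<le> k" using n2 enat by (simp add: numeral_eq_enat)
      \<comment> \<open>zero words with the same letters are related, so they include a permutation identity\<close>
      let ?\<tau> = "transpose 0 (1::nat)"
      have perm: "?\<tau> permutes {..<k}" using k by (intro permutes_swap_id) auto
      have sets: "set [0..<k] = set (map ?\<tau> [0..<k])"
        using permutes_image[OF perm] by (simp add: atLeast0LessThan)
      have d: "distinct (map ?\<tau> [0..<k])" by (simp add: distinct_map)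
      have ne: "[0..<k] \<noteq> map ?\<tau> [0..<k]"
      proof
        assume "[0..<k] = map ?\<tau> [0..<k]"
        then have "[0..<k] ! 0 = map ?\<tau> [0..<k] ! 0" by (rule arg_cong)
        then show False using k by simp
      qed
      have "([0..<k], map ?\<tau> [0..<k]) \<in> \<Theta>"
        by (rule Z_same_letters[OF kZ Z.rename[OF kZ] sets])
      moreover have "length [0..<k] \<le> k" by simp
      ultimately have "Q k" unfolding Q_def using sets d ne distinct_upt by blast
      then show ?thesis using m enat by simp
    qed simp
    show ?thesis using c23 main False m2 mn by blast
  qed
qed

section \<open>The varieties of the classification\<close>

text \<open>The theory of \<open>var \<Sigma>\<close> is the least fully invariant congruence that contains
  \<open>\<Sigma>\<close>; this form avoids constructing it.\<close>

lemma identities_var_generators: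
  assumes inf: "infinite (UNIV :: 'a set)" and N: "ficong N" and gen: "\<Sigma> \<subseteq> N"
    and least: "\<And>\<theta>. ficong \<theta> \<Longrightarrow> \<Sigma> \<subseteq> \<theta> \<Longrightarrow> N \<subseteq> \<theta>" and ne: "\<And>u v. (u, v) \<in> \<Sigma> \<Longrightarrow> u \<noteq> [] \<and> v \<noteq> []"
  shows "identities (var \<Sigma> :: 'a magma set) = N"
proof
  have "\<Sigma> \<subseteq> identities (var \<Sigma> :: 'a magma set)" using ne by (auto simp: identities_def var_def)
  moreover have "ficong (identities (var \<Sigma> :: 'a magma set))"
    by (rule ficong_identities_variety[OF variety_var[OF ne]])
  ultimately show "N \<subseteq> identities (var \<Sigma> :: 'a magma set)" using least by blast
  have "identities (var \<Sigma> :: 'a magma set) \<subseteq> identities (var N :: 'a magma set)"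
    using var_antimono[OF gen] by (auto simp: identities_def)
  then show "identities (var \<Sigma> :: 'a magma set) \<subseteq> N" using identities_var[OF inf N] by simp
qed

context ficong
begin

definition zeros :: "word set" where
  "zeros = {w. \<forall>a b. (a @ w @ b, w) \<in> \<theta>}"

lemma zeros_related: "u \<in> zeros \<Longrightarrow> v \<in> zeros \<Longrightarrow> (u, v) \<in> \<theta>"
proof -
  assume "u \<in> zeros" "v \<in> zeros"
  then have "([] @ u @ v, u) \<in> \<theta>" "(u @ v @ [], v) \<in> \<theta>" unfolding zeros_def by blast+
  then have "(u @ v, u) \<in> \<theta>" "(u @ v, v) \<in> \<theta>" by simp_all
  then show ?thesis by (rule trans[OF sym])
qed

lemma zeros_context: "w \<in> zeros \<Longrightarrow> a @ w @ b \<in> zeros"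
proof -
  assume w: "w \<in> zeros"
  have "(c @ (a @ w @ b) @ d, a @ w @ b) \<in> \<theta>" for c d
  proof -
    have "((c @ a) @ w @ (b @ d), w) \<in> \<theta>" "(a @ w @ b, w) \<in> \<theta>" using w unfolding zeros_def by blast+
    then have "(c @ (a @ w @ b) @ d, w) \<in> \<theta>" "(w, a @ w @ b) \<in> \<theta>" using sym by simp_all
    then show ?thesis by (rule trans)
  qed
  then show ?thesis by (simp add: zeros_def)
qed

text \<open>The letter \<open>x\<close> in \<open>w x \<approx> w\<close> and \<open>x w \<approx> w\<close> may be replaced by any word.\<close>

lemma zero_ids_substitute:
  assumes "zero_ids w \<subseteq> \<theta>" and \<sigma>: "nonerasing \<sigma>"
  shows "substitute \<sigma> w \<in> zeros"
proof -
  obtain x where x: "x \<notin> set w" using ex_new_if_finite[of "set w"] by auto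
  then have ids: "(w @ [x], w) \<in> \<theta>" "(x # w, w) \<in> \<theta>" using assms(1) by (auto simp: zero_ids_def)
  have upd: "substitute (\<sigma>(x := t)) w = substitute \<sigma> w" for t by (rule substitute_upd_notin[OF x])
  have R: "(substitute \<sigma> w @ b, substitute \<sigma> w) \<in> \<theta>" for b
  proof (cases "b = []")
    case False
    then have "nonerasing (\<sigma>(x := b))" using \<sigma> by simp
    then have "(substitute (\<sigma>(x := b)) (w @ [x]), substitute (\<sigma>(x := b)) w) \<in> \<theta>" by (rule sub[OF ids(1)])
    then show ?thesis by (simp only: substitute_simps upd fun_upd_same append_Nil2)
  qed simp
  have L: "(a @ substitute \<sigma> w, substitute \<sigma> w) \<in> \<theta>" for a
  proof (cases "a = []")
    case False
    then have "nonerasing (\<sigma>(x := a))" using \<sigma> by simp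
    then have "(substitute (\<sigma>(x := a)) (x # w), substitute (\<sigma>(x := a)) w) \<in> \<theta>" by (rule sub[OF ids(2)])
    then show ?thesis by (simp only: substitute_simps upd fun_upd_same)
  qed simp
  show ?thesis unfolding zeros_def using trans[OF left[OF R] L] by blast
qed

declare upt_Suc [simp del]

lemma long_zeros:
  assumes "zero_ids [1..<k + 1] \<subseteq> \<theta>" "1 \<le> k" "k \<le> length w"
  shows "w \<in> zeros"
proof -
  have l: "length [1..<k + 1] = k" by (simp del: upt_Suc)
  then have "[1..<k + 1] = [] \<Longrightarrow> w = []" using assms(2) by (metis list.size(3) not_one_le_zero)
  then obtain \<sigma> where "nonerasing \<sigma>" "substitute \<sigma> [1..<k + 1] = w"
    using cut_exists[of "[1..<k + 1]" w] assms(3) distinct_upt unfolding l by blast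
  then show ?thesis using zero_ids_substitute[OF assms(1)] by blast
qed

lemma nonlinear_zeros:
  assumes ids: "zero_ids [1, 1, 2] \<subseteq> \<theta>" "zero_ids [1, 2, 1] \<subseteq> \<theta>" "zero_ids [2, 1, 1] \<subseteq> \<theta>"
    and w: "\<not> distinct w" "3 \<le> length w"
  shows "w \<in> zeros"
proof -
  obtain u where u: "u \<in> {[1, 1, 2], [1, 2, 1], [2, 1, 1]}" "occurs u w"
    using nonlinear_pattern[of 1 2 w] w by auto
  then obtain a \<sigma> b where "nonerasing \<sigma>" "w = a @ substitute \<sigma> u @ b" unfolding occurs_def by blast
  moreover have "zero_ids u \<subseteq> \<theta>" using u(1) ids by blast
  ultimately show ?thesis using zeros_context zero_ids_substitute by blast
qed

lemma square_zeros:
  assumes "zero_ids [1, 1] \<subseteq> \<theta>" "\<not> distinct w" "length w < 3"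
  shows "w \<in> zeros"
proof -
  obtain a where "w = [a, a]" using nonlinear_short[OF assms(2,3)] by blast
  then show ?thesis using zero_ids_substitute[OF assms(1), of "\<lambda>_. [a]"] by simp
qed

lemma permutation_ids_base:
  assumes ids: "\<And>\<pi>. \<pi> permutes {1..k} \<Longrightarrow> perm_id k \<pi> \<in> \<theta>"
    and uv: "distinct u" "distinct v" "set u = set v" "length u = k"
  shows "(u, v) \<in> \<theta>"
proof -
  let ?w = "[1..<k + 1]"
  have lw: "length u = length ?w" using uv(4) by simp
  obtain f where f: "map f u = ?w" using rename_to[OF uv(1) lw] by blast
  obtain g where g: "map g ?w = u" using rename_to[OF distinct_upt lw[symmetric]] by blast
  define v0 where "v0 = map f v"
  have "map (g \<circ> f) u = u" using f g by (metis map_map)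
  then have gf: "g (f x) = x" if "x \<in> set u" for x using that by (metis comp_apply map_eq_conv map_ident)
  then have v: "map g v0 = v" using uv(3) by (simp add: v0_def map_idI)
  have "inj_on f (set u)" using gf by (metis inj_onI)
  then have d0: "distinct v0" using uv(2,3) by (simp add: v0_def distinct_map)
  have s0: "set v0 = {1..k}" using arg_cong[OF f, of set] uv(3) by (auto simp: v0_def)
  have l0: "length v0 = k" using distinct_card[OF d0] s0 by simp
  define \<pi> where "\<pi> x = (if x \<in> {1..k} then v0 ! (x - 1) else x)" for x
  have mapv: "map \<pi> ?w = v0"
    by (rule nth_equalityI) (simp_all add: l0 \<pi>_def)
  have "\<pi> permutes {1..k}"
  proof (rule bij_imp_permutes)
    have w: "set ?w = {1..k}" by auto
    have "inj_on \<pi> (set ?w)" using d0 mapv distinct_map by metis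
    moreover have "\<pi> ` set ?w = {1..k}" using mapv s0 by (metis set_map)
    ultimately show "bij_betw \<pi> {1..k} {1..k}" unfolding w bij_betw_def by blast
  qed (auto simp: \<pi>_def)
  then have "(?w, v0) \<in> \<theta>" using ids[of \<pi>] mapv by (simp only: perm_id_def)
  from rename[OF this, of g] show ?thesis using g v by (simp only:)
qed

text \<open>For words longer than \<open>k\<close>, first letters \<open>x\<close> and \<open>y\<close> that differ are exchanged by way of
  \<open>x y r\<close> and \<open>y x r\<close>, where \<open>r\<close> lists the remaining letters: this exchange does not
  involve the last letter of \<open>r\<close>, so it follows from a law for shorter words.\<close>

lemma permutation_ids:
  assumes ids: "\<And>\<pi>. \<pi> permutes {1..k} \<Longrightarrow> perm_id k \<pi> \<in> \<theta>" and k: "2 \<le> k"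
    and uv: "distinct u" "distinct v" "set u = set v" "k \<le> length u"
  shows "(u, v) \<in> \<theta>"
  using uv(4,1-3)
proof (induction "length u" arbitrary: u v rule: nat_induct_at_least)
  case base
  then show ?case using permutation_ids_base[OF ids] by simp
next
  case (Suc l)
  have lv: "length v = Suc l" using Suc.hyps(3) Suc.prems by (metis distinct_card)
  obtain x u' where u: "u = x # u'" using Suc.hyps(3) by (cases u) auto
  obtain y v' where v: "v = y # v'" using lv by (cases v) auto
  have l: "l = length u'" "l = length v'" using Suc.hyps(3) u lv v by simp_all
  have d: "distinct u'" "distinct v'" "x \<notin> set u'" "y \<notin> set v'" using Suc.prems u v by auto
  have IH: "(s, t) \<in> \<theta>" if "l = length s" "distinct s" "distinct t" "set s = set t" for s t
    using Suc.hyps(2)[of s t] that by blast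
  show ?case
  proof (cases "x = y")
    case True
    then have "set u' = set v'" using Suc.prems(3) u v d by (metis insert_ident list.simps(15))
    then show ?thesis using left[OF IH[OF l(1) d(1,2)], of "[x]"] u v True by simp
  next
    case False
    obtain r where r: "set r = set u - {x, y}" "distinct r"
      using finite_distinct_list[of "set u - {x, y}"] by auto
    have xy: "y \<in> set u'" "x \<in> set v'" using Suc.prems(3) u v False by auto
    have eqs: "set u' = set (y # r)" "set v' = set (x # r)"
      using r(1) xy d(3,4) u v Suc.prems(3) False by auto
    have dr: "distinct (y # r)" "distinct (x # r)" using r by auto
    have lr: "length (y # r) = l" using l(1) eqs(1) d(1) dr(1) by (metis distinct_card)
    have "r \<noteq> []" using lr Suc.hyps(1) k by auto
    then obtain r' z where rz: "r = r' @ [z]" by (metis rev_exhaust)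
    have "(u, x # y # r) \<in> \<theta>" using left[OF IH[OF l(1) d(1) dr(1) eqs(1)], of "[x]"] u by simp
    moreover have "(x # y # r', y # x # r') \<in> \<theta>"
      using r rz lr False by (intro IH) auto
    then have "(x # y # r, y # x # r) \<in> \<theta>" using right[of "x # y # r'" "y # x # r'" "[z]"] rz by simp
    moreover have "(v, y # x # r) \<in> \<theta>" using left[OF IH[OF l(2) d(2) dr(2) eqs(2)], of "[y]"] v by simp
    ultimately show ?thesis using trans sym by blast
  qed
qed

end

lemma zero_ids_subset:
  assumes "w \<in> zero_words c n"
  shows "zero_ids w \<subseteq> nil_congruence c m n"
proof -
  interpret verbal_ideal "zero_words c n" by (rule verbal_ideal_zero_words)
  have "x # w \<in> zero_words c n" "w @ [x] \<in> zero_words c n" for x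
    using left[OF assms, of "[x]"] right[OF assms, of "[x]"] by simp_all
  then show ?thesis using assms by (auto simp: zero_ids_def nil_congruence_def)
qed

definition classification_ids :: "nat \<Rightarrow> enat \<Rightarrow> enat \<Rightarrow> identity set" where
  "classification_ids c m n =
     zero_ids [1, 1, 2] \<union> zero_ids [1, 2, 1] \<union> zero_ids [2, 1, 1] \<union>
     (case m of enat k \<Rightarrow> {perm_id k \<pi> | \<pi>. \<pi> permutes {1..k}} | \<infinity> \<Rightarrow> {}) \<union>
     (case n of enat k \<Rightarrow> zero_ids [1..<k + 1] | \<infinity> \<Rightarrow> {}) \<union>
     (if c = 2 then zero_ids [1, 1] else {})"

lemma identities_classification:
  assumes inf: "infinite (UNIV :: 'a set)" and mn: "2 \<le> m" "2 \<le> n" and c: "c = 2 \<or> c = 3"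
  shows "identities (var (classification_ids c m n) :: 'a magma set) = nil_congruence c m n"
proof (rule identities_var_generators[OF inf])
  show "ficong (nil_congruence c m n)" using c by (intro ficong_nil_congruence) auto
  show "classification_ids c m n \<subseteq> nil_congruence c m n"
  proof -
    have "zero_ids [1, 1, 2] \<subseteq> nil_congruence c m n" "zero_ids [1, 2, 1] \<subseteq> nil_congruence c m n"
      "zero_ids [2, 1, 1] \<subseteq> nil_congruence c m n"
      using c by (intro zero_ids_subset; auto simp: zero_words_def)+
    moreover have "zero_ids [1..<k + 1] \<subseteq> nil_congruence c m n" if "n = enat k" for k
      using that mn(2) by (intro zero_ids_subset) (auto simp: zero_words_def numeral_eq_enat)
    moreover have "zero_ids [1, 1] \<subseteq> nil_congruence c m n" if "c = 2"
      using that by (intro zero_ids_subset) (auto simp: zero_words_def)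
    moreover have "perm_id k \<pi> \<in> nil_congruence c m n" if k: "m = enat k" and \<pi>: "\<pi> permutes {1..k}" for k \<pi>
    proof -
      have w: "set [1..<k + 1] = {1..k}" by auto
      have "distinct (map \<pi> [1..<k + 1])" using permutes_inj_on[OF \<pi>] w by (simp only: distinct_map distinct_upt)
      moreover have "set (map \<pi> [1..<k + 1]) = set [1..<k + 1]" using permutes_image[OF \<pi>] w by (simp only: set_map)
      ultimately show ?thesis using k by (simp add: perm_id_def nil_congruence_def)
    qed
    ultimately show ?thesis unfolding classification_ids_def by (auto split: enat.splits if_splits)
  qed
  show "u \<noteq> [] \<and> v \<noteq> []" if "(u, v) \<in> classification_ids c m n" for u v
    using that mn by (auto simp: classification_ids_def zero_ids_def perm_id_def numeral_eq_enat
        split: enat.splits if_splits)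
  show "nil_congruence c m n \<subseteq> \<theta>" if \<theta>: "ficong \<theta>" and gen: "classification_ids c m n \<subseteq> \<theta>" for \<theta>
  proof (rule subrelI)
    interpret ficong \<theta> by fact
    have ids: "zero_ids [1, 1, 2] \<subseteq> \<theta>" "zero_ids [1, 2, 1] \<subseteq> \<theta>" "zero_ids [2, 1, 1] \<subseteq> \<theta>"
      using gen unfolding classification_ids_def by (simp_all only: Un_subset_iff)
    have zero: "w \<in> zeros" if "w \<in> zero_words c n" for w
    proof -
      have "\<not> distinct w \<and> c \<le> length w \<or> n \<le> enat (length w)" using that by (simp add: zero_words_def)
      then show ?thesis
      proof (elim disjE conjE)
        assume w: "\<not> distinct w" "c \<le> length w"
        show ?thesis
        proof (cases "length w < 3")
          case True
          then have "c = 2" using c w(2) by auto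
          then have "zero_ids [1, 1] \<subseteq> \<theta>"
            using gen unfolding classification_ids_def by (simp only: simp_thms if_True Un_subset_iff)
          then show ?thesis using square_zeros w(1) True by blast
        next
          case False
          then show ?thesis using nonlinear_zeros[OF ids w(1)] by simp
        qed
      next
        assume n: "n \<le> enat (length w)"
        then obtain k where k: "n = enat k" by (cases n) auto
        have "zero_ids [1..<k + 1] \<subseteq> \<theta>"
          using gen unfolding classification_ids_def k by (simp only: enat.case Un_subset_iff)
        moreover have "1 \<le> k" "k \<le> length w" using mn(2) n k by (simp_all add: numeral_eq_enat)
        ultimately show ?thesis by (rule long_zeros)
      qed
    qed
    fix u v assume "(u, v) \<in> nil_congruence c m n"
    then consider "u = v" | "u \<in> zero_words c n" "v \<in> zero_words c n"
      | "distinct u" "distinct v" "set u = set v" "m \<le> enat (length u)"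
      unfolding nil_congruence_def by blast
    then show "(u, v) \<in> \<theta>"
    proof cases
      case 3
      then obtain k where k: "m = enat k" by (cases m) auto
      have "perm_id k \<pi> \<in> \<theta>" if "\<pi> permutes {1..k}" for \<pi>
        using gen that unfolding classification_ids_def k by (simp only: enat.case Un_subset_iff) blast
      then show ?thesis
        by (rule permutation_ids[of k]) (use 3 k mn(1) in \<open>auto simp: numeral_eq_enat\<close>)
    qed (use zero zeros_related in auto)
  qed
qed

lemma identities_X:
  assumes "infinite (UNIV :: 'a set)" "2 \<le> m" "2 \<le> n"
  shows "identities (X_variety m n :: 'a magma set) = nil_congruence 3 m n"
proof -
  have "(X_variety m n :: 'a magma set) = var (classification_ids 3 m n)"
    by (simp add: X_variety_def X_inf_inf_def classification_ids_def all_semigroups_var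
        flip: var_Un split: enat.split)
  then show ?thesis using identities_classification[OF assms] by simp
qed

lemma identities_Y:
  assumes "infinite (UNIV :: 'a set)" "2 \<le> m" "2 \<le> n"
  shows "identities (Y_variety m n :: 'a magma set) = nil_congruence 2 m n"
proof -
  have "(Y_variety m n :: 'a magma set) = var (classification_ids 2 m n)"
    by (simp add: Y_variety_def X_variety_def X_inf_inf_def classification_ids_def all_semigroups_var
        flip: var_Un split: enat.split)
  then show ?thesis using identities_classification[OF assms] by simp
qed

lemma identities_trivial:
  assumes inf: "infinite (UNIV :: 'a set)"
  shows "identities (trivial_variety :: 'a magma set) = {(u, v). u = [] \<longleftrightarrow> v = []}"
  unfolding trivial_variety_var
proof (rule identities_var_generators[OF inf])
  show "ficong {(u, v). u = ([] :: word) \<longleftrightarrow> v = ([] :: word)}"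
    by unfold_locales auto
  show "{(u, v). u = [] \<longleftrightarrow> v = []} \<subseteq> \<theta>" if \<theta>: "ficong \<theta>" "{([1], [2])} \<subseteq> \<theta>" for \<theta>
  proof -
    interpret ficong \<theta> by fact
    have "(u, v) \<in> \<theta>" if "u \<noteq> []" "v \<noteq> []" for u v
      using sub[of "[1]" "[2]" "\<lambda>x. if x = 1 then u else v"] that \<theta>(2) by simp
    then show ?thesis using refl by auto
  qed
qed auto

lemma nil_congruence_all: "nil_congruence c m 1 = {(u, v). u = [] \<longleftrightarrow> v = []}"
proof -
  have "w \<in> zero_words c 1 \<longleftrightarrow> w \<noteq> []" for w
    by (cases w) (auto simp: zero_words_def one_enat_def)
  then show ?thesis by (auto simp: nil_congruence_def)
qed

lemma identities_semilattices:
  assumes inf: "infinite (UNIV :: 'a set)"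
  shows "identities (semilattices :: 'a magma set) = same_letters"
  unfolding semilattices_var
proof (rule identities_var_generators[OF inf])
  show "ficong same_letters" by (rule ficong_same_letters)
  show "{([1, 2], [2, 1]), ([1, 1], [1])} \<subseteq> same_letters" by (auto simp: same_letters_def)
  show "same_letters \<subseteq> \<theta>" if \<theta>: "ficong \<theta>" "{([1, 2], [2, 1]), ([1, 1], [1])} \<subseteq> \<theta>" for \<theta>
  proof (rule subrelI)
    interpret ficong \<theta> by fact
    have comm: "(u @ v, v @ u) \<in> \<theta>" for u v
    proof (cases "u = [] \<or> v = []")
      case False
      then show ?thesis using sub[of "[1, 2]" "[2, 1]" "\<lambda>x. if x = 1 then u else v"] \<theta>(2) by simp
    qed auto
    have idem: "([x, x], [x]) \<in> \<theta>" for x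
      using rename[of "[1, 1]" "[1]" "\<lambda>_. x"] \<theta>(2) by simp
    have front: "(a @ x # b, x # a @ b) \<in> \<theta>" for a x b
      using right[OF comm[of a "[x]"], of b] by simp
    have absorb: "(x # w, w) \<in> \<theta>" if x: "x \<in> set w" for x w
    proof -
      obtain a b where w: "w = a @ x # b" using split_list[OF x] by blast
      have "(x # w, x # x # a @ b) \<in> \<theta>" using left[OF front, of "[x]" a x b] w by simp
      moreover have "(x # x # a @ b, x # a @ b) \<in> \<theta>" using right[OF idem, of x "a @ b"] by simp
      moreover have "(x # a @ b, w) \<in> \<theta>" using sym[OF front[of a x b]] w by simp
      ultimately show ?thesis using trans by blast
    qed
    have rem: "(w, remdups w) \<in> \<theta>" for w
    proof (induction w)
      case (Cons x w)
      have 1: "(x # w, x # remdups w) \<in> \<theta>" using left[OF Cons, of "[x]"] by simp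
      show ?case
      proof (cases "x \<in> set w")
        case True
        then have "(x # remdups w, remdups w) \<in> \<theta>" by (intro absorb) simp
        then show ?thesis using trans[OF 1] True by simp
      qed (use 1 in simp)
    qed simp
    have dist: "(u, v) \<in> \<theta>" if "distinct u" "distinct v" "set u = set v" for u v
      using that
    proof (induction u arbitrary: v)
      case (Cons x u)
      then have "x \<in> set v" by auto
      then obtain a b where v: "v = a @ x # b" using split_list by metis
      have "set u = set (a @ b)" using Cons.prems v by auto
      then have "(u, a @ b) \<in> \<theta>" using Cons v by simp
      then have "(x # u, x # a @ b) \<in> \<theta>" using left[of u "a @ b" "[x]"] by simp
      then show ?case using trans sym front v by blast
    qed simp
    fix u v assume "(u, v) \<in> same_letters"
    then have "(remdups u, remdups v) \<in> \<theta>" by (intro dist) (auto simp: same_letters_def)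
    then show "(u, v) \<in> \<theta>" using rem trans sym by blast
  qed
qed auto

lemma identities_all:
  assumes inf: "infinite (UNIV :: 'a set)"
  shows "identities (all_semigroups :: 'a magma set) = Id"
  unfolding all_semigroups_var
  by (rule identities_var_generators[OF inf ficong_Id]) (auto simp: ficong.refl)

theorem theorem1p1:
  fixes V :: "'a magma set"
  assumes "infinite (UNIV :: 'a set)"
    and "variety V"
  shows "cancellable SEM V \<longleftrightarrow>
    V = all_semigroups \<or>
    (\<exists>M N. V = M \<squnion>\<^bsub>SEM\<^esub> N \<and>
      (M = trivial_variety \<or> M = semilattices) \<and>
      (N = trivial_variety \<or>
       (\<exists>m n :: enat. 2 \<le> m \<and> m \<le> n \<and> (N = X_variety m n \<or> N = Y_variety m n))))"
    (is "_ \<longleftrightarrow> _ \<or> ?join")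
proof -
  note inf = assms(1) and V = assms(2)
  have fV: "ficong (identities V)" by (rule ficong_identities_variety[OF V])
  let ?all = "{(u, v). u = ([] :: word) \<longleftrightarrow> v = ([] :: word)}"
  define nil where "nil N \<longleftrightarrow> N = trivial_variety \<or>
       (\<exists>m n :: enat. 2 \<le> m \<and> m \<le> n \<and> (N = X_variety m n \<or> N = Y_variety m n))" for N :: "'a magma set"
  have nilD: "variety N \<and> (\<exists>c m n. c \<le> 3 \<and> identities N = nil_congruence c m n)" if "nil N" for N
  proof -
    consider "N = trivial_variety" | m n where "2 \<le> m" "m \<le> n" "N = X_variety m n"
      | m n where "2 \<le> m" "m \<le> n" "N = Y_variety m n" using \<open>nil N\<close> unfolding nil_def by blast
    then show ?thesis
    proof cases
      case 1
      then have "identities N = nil_congruence 3 1 1" using identities_trivial[OF inf] nil_congruence_all by metis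
      then show ?thesis using 1 variety_trivial by blast
    next
      case 2
      have "2 \<le> n" by (rule order.trans[OF 2(1,2)])
      then show ?thesis using 2 variety_X identities_X[OF inf 2(1)] by blast
    next
      case 3
      have "2 \<le> n" by (rule order.trans[OF 3(1,2)])
      then have "identities N = nil_congruence 2 m n" using 3 identities_Y[OF inf 3(1)] by blast
      moreover have "(2::nat) \<le> 3" by simp
      ultimately show ?thesis using 3 \<open>2 \<le> n\<close> variety_Y by blast
    qed
  qed
  have nilI: "\<exists>N. nil N \<and> variety N \<and> identities N = nil_congruence c m n"
    if c: "c = 2 \<or> c = 3" and mn: "n = 1 \<or> 2 \<le> m \<and> m \<le> n" for c m n
  proof (cases "n = 1")
    case True
    have "identities (trivial_variety :: 'a magma set) = nil_congruence c m 1"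
      using identities_trivial[OF inf] nil_congruence_all by metis
    then show ?thesis using True variety_trivial unfolding nil_def by blast
  next
    case False
    then have m: "2 \<le> m" "m \<le> n" using mn by auto
    have n: "2 \<le> n" by (rule order.trans[OF m])
    show ?thesis
    proof (cases "c = 3")
      case True
      then show ?thesis using m n variety_X identities_X[OF inf m(1) n] unfolding nil_def by blast
    next
      case False
      then have "c = 2" using c by blast
      then show ?thesis using m n variety_Y identities_Y[OF inf m(1) n] unfolding nil_def by blast
    qed
  qed
  have join_T: "identities (trivial_variety \<squnion>\<^bsub>SEM\<^esub> N) = identities N" if N: "variety N" for N :: "'a magma set"
  proof -
    interpret N: ficong "identities N" by (rule ficong_identities_variety[OF N])
    have "identities N \<subseteq> ?all" using N.Nil_iff by blast
    then show ?thesis using identities_join[OF inf variety_trivial N] identities_trivial[OF inf] by blast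
  qed
  have join_SL: "identities (semilattices \<squnion>\<^bsub>SEM\<^esub> N) = identities N \<inter> same_letters"
    if N: "variety N" for N :: "'a magma set"
    using identities_join[OF inf variety_semilattices N] identities_semilattices[OF inf] by blast
  have join: "?join \<longleftrightarrow> (\<exists>N. nil N \<and> (V = trivial_variety \<squnion>\<^bsub>SEM\<^esub> N \<or> V = semilattices \<squnion>\<^bsub>SEM\<^esub> N))"
    unfolding nil_def by blast
  have eqI: "V = W" if "variety W" "identities V = identities W" for W
    using identities_inject[OF V that(1)] that(2) by blast
  show ?thesis unfolding cancellable_iff_cancel[OF inf V] join
  proof
    assume c: "cancel (identities V)"
    show "V = all_semigroups \<or>
      (\<exists>N. nil N \<and> (V = trivial_variety \<squnion>\<^bsub>SEM\<^esub> N \<or> V = semilattices \<squnion>\<^bsub>SEM\<^esub> N))"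
    proof (cases "identities V = Id")
      case True
      have "variety (all_semigroups :: 'a magma set)" unfolding all_semigroups_var by (rule variety_all)
      then show ?thesis using eqI identities_all[OF inf] True by blast
    next
      case False
      then obtain c m n where cmn: "c = 2 \<or> c = 3" "n = 1 \<or> 2 \<le> m \<and> m \<le> n"
        "identities V = nil_congruence c m n \<or> identities V = nil_congruence c m n \<inter> same_letters"
        using cancel_classification[OF fV c] by blast
      obtain N where N: "nil N" "variety N" "identities N = nil_congruence c m n"
        using nilI[OF cmn(1,2)] by blast
      have "V = trivial_variety \<squnion>\<^bsub>SEM\<^esub> N \<or> V = semilattices \<squnion>\<^bsub>SEM\<^esub> N"
        using cmn(3) eqI[OF variety_join[OF variety_trivial N(2)]] eqI[OF variety_join[OF variety_semilattices N(2)]]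
          join_T[OF N(2)] join_SL[OF N(2)] N(3) by blast
      then show ?thesis using N(1) by blast
    qed
  next
    assume "V = all_semigroups \<or>
      (\<exists>N. nil N \<and> (V = trivial_variety \<squnion>\<^bsub>SEM\<^esub> N \<or> V = semilattices \<squnion>\<^bsub>SEM\<^esub> N))"
    then show "cancel (identities V)"
    proof (elim disjE exE conjE)
      assume "V = all_semigroups"
      then have id: "identities V = Id" using identities_all[OF inf] by simp
      have "cjoin Id \<beta> = \<beta>" if "ficong \<beta>" for \<beta>
      proof -
        interpret ficong \<beta> by fact
        show ?thesis using cjoin_least[OF ficong_axioms, of Id \<beta>] cjoin_upper(2)[of \<beta> Id] refl by blast
      qed
      then show ?thesis unfolding id cancel_def by blast
    next
      fix N assume N: "nil N" "V = trivial_variety \<squnion>\<^bsub>SEM\<^esub> N"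
      then obtain c m n where "variety N" "c \<le> 3" "identities N = nil_congruence c m n" using nilD by blast
      then show ?thesis using N(2) join_T cancel_nil_congruence(1) by metis
    next
      fix N assume N: "nil N" "V = semilattices \<squnion>\<^bsub>SEM\<^esub> N"
      then obtain c m n where "variety N" "c \<le> 3" "identities N = nil_congruence c m n" using nilD by blast
      then show ?thesis using N(2) join_SL cancel_nil_congruence(2) by metis
    qed
  qed
qed

end
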